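(* Let $0<m\le M$ and let $f:\mathbb{R}^p\to\mathbb{R}$ be twice differentiable with Hessian satisfying $m\mathbf{I}_p\preceq\nabla^2 f(x)\preceq M\mathbf{I}_p$ for every $x\in\mathbb{R}^p$. Let $\pi$ be the probability measure on $\mathbb{R}^p$ with density proportional to $e^{-f}$. Let the initial condition $(v_0,\vartheta_0)$ of the KLMC algorithm with friction $\gamma$ and step-size $h>0$ be drawn from the product distribution $\mu=\mathcal{N}(\mathbf{0}_p,\mathbf{I}_p)\otimes\nu_0$, where $\nu_0$ is a probability measure on $\mathbb{R}^p$. Then for every $\gamma\ge\sqrt{m+M}$ and $h\le m/(4\gamma M)$, the distribution $\nu_k$ of the $k$th iterate $\vartheta_k$ of the KLMC algorithm satisfies $$W_2(\nu_k,\pi)\le\sqrt{2}\Big(1-\frac{0.75\,mh}{\gamma}\Big)^kW_2(\nu_0,\pi)+\frac{Mh\sqrt{2p}}{m}.$$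
   Context: Define $\psi_0(t)=e^{-\gamma t}$ and $\psi_{k+1}(t)=\int_0^t\psi_k(s)\,ds$ for $k\ge0$. The KLMC (kinetic Langevin Monte Carlo) algorithm with friction $\gamma>0$ and step-size $h>0$ is the recursion in $\mathbb{R}^p\times\mathbb{R}^p$, for $k=0,1,2,\ldots$, $$v_{k+1}=\psi_0(h)v_k-\psi_1(h)\nabla f(\vartheta_k)+\sqrt{2\gamma}\,\xi_{k+1},$$ $$\vartheta_{k+1}=\vartheta_k+\psi_1(h)v_k-\psi_2(h)\nabla f(\vartheta_k)+\sqrt{2\gamma}\,\xi'_{k+1},$$ where the $2p$-dimensional centered Gaussian vectors $(\xi_j,\xi'_j)$, $j\ge1$, are iid and independent of $(v_0,\vartheta_0)$, and for each fixed $j$ the two-dimensional vectors $((\xi_j)_i,(\xi'_j)_i)$, $i=1,\ldots,p$, are iid with covariance matrix $$\mathbf{C}=\int_0^h[\psi_0(t)\ \psi_1(t)]^\top[\psi_0(t)\ \psi_1(t)]\,dt.$$ $W_2$ is the Wasserstein distance of order 2 with respect to the Euclidean norm. *)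

theory Defs
  imports "HOL-Probability.Probability"
begin

subsection \<open>Smoothness and the Loewner order\<close>

definition gradient :: "('a::real_inner \<Rightarrow> real) \<Rightarrow> 'a \<Rightarrow> 'a" where
  "gradient f x = (THE D. GDERIV f x :> D)"

definition twice_differentiable :: "(real^'n \<Rightarrow> real) \<Rightarrow> bool" where
  "twice_differentiable f \<longleftrightarrow>
     (\<forall>x. f differentiable (at x)) \<and> (\<forall>x. gradient f differentiable (at x))"

definition hessian :: "(real^'n \<Rightarrow> real) \<Rightarrow> real^'n \<Rightarrow> real^'n^'n" where
  "hessian f x = jacobian (gradient f) (at x)"

definition pos_semidef :: "real^'n^'n \<Rightarrow> bool" where
  "pos_semidef A \<longleftrightarrow> transpose A = A \<and> (\<forall>u. 0 \<le> u \<bullet> (A *v u))"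

definition loewner_le :: "real^'n^'n \<Rightarrow> real^'n^'n \<Rightarrow> bool"  (infix \<open>\<preceq>\<^sub>L\<close> 50) where
  "A \<preceq>\<^sub>L B \<longleftrightarrow> pos_semidef (B - A)"

subsection \<open>Probability measures\<close>

definition gibbs :: "(real^'n \<Rightarrow> real) \<Rightarrow> (real^'n) measure" where
  "gibbs f = density lborel
     (\<lambda>x. ennreal (exp (- f x)) / (\<integral>\<^sup>+y. ennreal (exp (- f y)) \<partial>lborel))"

definition std_gaussian :: "(real^'n) measure" where
  "std_gaussian = density lborel (\<lambda>x. ennreal (\<Prod>i\<in>UNIV. std_normal_density (x $ i)))"

text \<open>
  \<open>N\<close> is the normal distribution with mean \<open>b\<close> and covariance matrix \<open>S\<close>: the law of
  \<open>b + A Z\<close> with \<open>Z\<close> standard normal and \<open>A A\<^sup>T = S\<close>. Any two such \<open>A\<close> give the same law, and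
  singular \<open>S\<close> are allowed.
\<close>

definition is_gaussian :: "(real^'n) measure \<Rightarrow> real^'n \<Rightarrow> real^'n^'n \<Rightarrow> bool" where
  "is_gaussian N b S \<longleftrightarrow>
     (\<exists>A :: real^'n^'n. A ** transpose A = S \<and> N = distr std_gaussian borel (\<lambda>z. b + A *v z))"

subsection \<open>Wasserstein distance of order 2\<close>

definition couplings ::
    "'a::euclidean_space measure \<Rightarrow> 'a measure \<Rightarrow> ('a \<times> 'a) measure set" where
  "couplings \<mu> \<nu> = {K. sets K = sets (borel \<Otimes>\<^sub>M borel) \<and>
     distr K borel fst = \<mu> \<and> distr K borel snd = \<nu>}"

definition ennreal_sqrt :: "ennreal \<Rightarrow> ennreal" where
  "ennreal_sqrt x = (if x = \<infinity> then \<infinity> else ennreal (sqrt (enn2real x)))"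

text \<open>The value is \<open>\<infinity>\<close> when no coupling has finite cost, which happens for laws without second
  moments.\<close>

definition W2 :: "'a::euclidean_space measure \<Rightarrow> 'a measure \<Rightarrow> ennreal" where
  "W2 \<mu> \<nu> = ennreal_sqrt
     (INF K\<in>couplings \<mu> \<nu>. \<integral>\<^sup>+z. ennreal ((norm (fst z - snd z))\<^sup>2) \<partial>K)"

subsection \<open>The KLMC algorithm\<close>

text \<open>Only arguments \<open>t \<ge> 0\<close> are meaningful: the integral over \<open>{0..t}\<close> is \<open>0\<close> for \<open>t < 0\<close>.\<close>

primrec psi :: "real \<Rightarrow> nat \<Rightarrow> real \<Rightarrow> real" where
  "psi \<gamma> 0 = (\<lambda>t. exp (- \<gamma> * t))"
| "psi \<gamma> (Suc k) = (\<lambda>t. integral {0..t} (psi \<gamma> k))"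

definition klmc_cov :: "real \<Rightarrow> real \<Rightarrow> real^2^2" where
  "klmc_cov \<gamma> h = integral {0..h}
     (\<lambda>t. let w = vector [psi \<gamma> 0 t, psi \<gamma> 1 t] :: real^2 in (\<chi> i j. w $ i * w $ j))"

text \<open>
  The initial pair and the noise vectors of all steps form one independent family, index \<open>0\<close> being
  the initial pair; the values \<open>\<xi> 0\<close> and \<open>\<xi>' 0\<close> are never used. For \<open>j \<ge> 1\<close> the coordinate pairs
  of \<open>(\<xi> j, \<xi>' j)\<close> are iid centered Gaussian, so the vectors \<open>(\<xi> j, \<xi>' j)\<close> are themselves centered
  Gaussian and identically distributed.
\<close>

definition klmc_noise ::
    "'w measure \<Rightarrow> real \<Rightarrow> real \<Rightarrow> ('w \<Rightarrow> real^'n) \<Rightarrow> ('w \<Rightarrow> real^'n) \<Rightarrow>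
     (nat \<Rightarrow> 'w \<Rightarrow> real^'n) \<Rightarrow> (nat \<Rightarrow> 'w \<Rightarrow> real^'n) \<Rightarrow> bool" where
  "klmc_noise P \<gamma> h v0 \<theta>0 \<xi> \<xi>' \<longleftrightarrow>
     prob_space.indep_vars P (\<lambda>_. borel)
       (\<lambda>j \<omega>. if j = 0 then (v0 \<omega>, \<theta>0 \<omega>) else (\<xi> j \<omega>, \<xi>' j \<omega>)) UNIV \<and>
     (\<forall>j\<ge>1. prob_space.indep_vars P (\<lambda>_. borel)
       (\<lambda>i \<omega>. vector [\<xi> j \<omega> $ i, \<xi>' j \<omega> $ i] :: real^2) UNIV) \<and>
     (\<forall>j\<ge>1. \<forall>i. is_gaussian
       (distr P borel (\<lambda>\<omega>. vector [\<xi> j \<omega> $ i, \<xi>' j \<omega> $ i])) 0 (klmc_cov \<gamma> h))"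

primrec klmc ::
    "(real^'n \<Rightarrow> real) \<Rightarrow> real \<Rightarrow> real \<Rightarrow> ('w \<Rightarrow> real^'n) \<Rightarrow> ('w \<Rightarrow> real^'n) \<Rightarrow>
     (nat \<Rightarrow> 'w \<Rightarrow> real^'n) \<Rightarrow> (nat \<Rightarrow> 'w \<Rightarrow> real^'n) \<Rightarrow> nat \<Rightarrow> 'w \<Rightarrow> (real^'n) \<times> (real^'n)" where
  "klmc f \<gamma> h v0 \<theta>0 \<xi> \<xi>' 0 = (\<lambda>\<omega>. (v0 \<omega>, \<theta>0 \<omega>))"
| "klmc f \<gamma> h v0 \<theta>0 \<xi> \<xi>' (Suc k) = (\<lambda>\<omega>.
     let (v, \<theta>) = klmc f \<gamma> h v0 \<theta>0 \<xi> \<xi>' k \<omega> in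
       (psi \<gamma> 0 h *\<^sub>R v - psi \<gamma> 1 h *\<^sub>R gradient f \<theta> + sqrt (2 * \<gamma>) *\<^sub>R \<xi> (Suc k) \<omega>,
        \<theta> + psi \<gamma> 1 h *\<^sub>R v - psi \<gamma> 2 h *\<^sub>R gradient f \<theta> + sqrt (2 * \<gamma>) *\<^sub>R \<xi>' (Suc k) \<omega>))"

end

theory Submission
  imports Defs
begin

text \<open>
  The usual proof couples the algorithm with the stationary kinetic Langevin diffusion driven by the
  same Brownian motion. Here the diffusion is replaced by a discrete chain with step \<open>\<epsilon> = h / N\<close>
  that preserves \<open>\<rho> = N(0, I) \<otimes> \<pi>\<close> exactly: a Metropolis-adjusted leapfrog step (three shears and
  an accept/reject decision) followed by an exact Ornstein--Uhlenbeck refreshment of the velocity. The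
  algorithm is interpolated on the same fine grid with its gradient frozen and driven by the same
  Gaussian noise. As \<open>f\<close> is twice differentiable, the trapezoidal energy error is \<open>o(\<epsilon>\<^sup>2)\<close>, so
  rejections contribute only \<open>o(\<epsilon>)\<close> per fine step in \<open>L\<^sup>2\<close> and disappear as \<open>N \<rightarrow> \<infinity>\<close>.

  In the coordinates \<open>a = \<Delta>v + \<gamma> \<Delta>\<theta>\<close>, \<open>b = \<Delta>v\<close> one coarse step with gradient difference
  \<open>\<nabla>f(\<theta>) - \<nabla>f(\<theta>')\<close> contracts by the factor \<open>1 - 0.75 m h / \<gamma>\<close>; only co-coercivity of the gradient
  is used. The remaining error per coarse step is \<open>M \<integral>\<^sub>0\<^sup>h s ds \<surd>p = M h\<^sup>2 \<surd>p / 2\<close> in each coordinate,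
  because the stationary velocity has second moment \<open>p\<close>. Summing the geometric series gives
  \<open>4/3 M h \<surd>p / m\<close>, and the gap between \<open>4/3\<close> and \<open>\<surd>2\<close> absorbs the discretization of the stationary
  chain.
\<close>

section \<open>One-step contraction\<close>

text \<open>With its gradient frozen, the algorithm passes to the fine grid without error, so only
  the comparison chain is discretized. It must preserve \<rho> exactly: an approximately invariant
  law would bring in a bias of its own. The accept/reject decision achieves this at a price, since a
  rejection reverses the velocity and so causes a jump of size about 2|v|. A rejection probability
  O(\<epsilon>^2) would make the jump O(\<epsilon>) in L2, and h/\<epsilon> fine steps would leave
  an error that does not vanish. Hence o(\<epsilon>^2) is needed.

  Friction cancels in a: it moves by exactly -h times the gradient difference. The two copies start
  with equal velocities, so (a, b) has initial norm \<gamma> |\<Delta>\<theta>|; at the end \<gamma>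
  \<Delta>\<theta> = a - b costs a factor sqrt 2, the one in front of the contracting term. The
  error of a coarse step sits in both coordinates, which costs a second sqrt 2, and 2 (M h^2 sqrt p
  / 2) / (3/4 m h) is the 4/3 M h sqrt p / m of the overview.\<close>

lemma le_if_scaled_diff_nonneg:
  fixes k p q s :: real
  assumes "k * (q - p) = s" "0 < k" "0 \<le> s"
  shows "p \<le> q"
  using assms by (metis diff_ge_0_iff_ge zero_le_mult_iff not_less)

text \<open>The difference of the two sides has nonnegative coefficients in the Bernstein basis of the unit
  square; below, on a triangle, it has nonnegative coefficients in barycentric coordinates.\<close>

lemma contraction_certificate_square:
  fixes g u y w :: real
  assumes "0 \<le> g" "0 \<le> u" "g + u = 1" "0 \<le> y" "0 \<le> w" "y + w = 1"
  defines "\<mu> \<equiv> g / 2"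
  defines "z \<equiv> 1 - \<mu>"
  defines "c \<equiv> (z + \<mu>) / 2" and "r \<equiv> (z - \<mu>) / 2" and "e \<equiv> 4 * z"
  shows "(e^2 + y*((-3*\<mu> + 8*r*c + 9/8*\<mu>^2)*e + 12/5*\<mu>*y*\<mu>))^2
    \<le> 4 * (1/2*e^2 - 23/16*y*\<mu>^2*e - 4*r*c^2*y^2*\<mu>)
        * (e^2 + y*((-2 + 6*r + 9/8*\<mu>^2)*e + (15/16 - 141/20*r)*y*\<mu>))" (is "?D^2 \<le> 4 * ?A * ?B")
proof -
  have u: "u = 1 - g" and w: "w = 1 - y" using assms by auto
  \<comment> \<open>6400 clears the denominators. After inserting g + u = 1 and y + w = 1 the right
    side is homogeneous of degree 6 in (g, u) and of degree 4 in (y, w), which is what makes the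
    signs of its coefficients conclusive.\<close>
  have id: "6400 * (4 * ?A * ?B - ?D^2) =
      (1638400*w^4 + 5734400*y*w^3 + 6963200*y^2*w^2 + 3276800*y^3*w + 409600*y^4)*u^6
      + (6553600*w^4 + 22937600*y*w^3 + 28509440*y^2*w^2 + 14394880*y^3*w + 2269440*y^4)*g*u^5
      + (10649600*w^4 + 36684800*y*w^3 + 45047040*y^2*w^2 + 22563840*y^3*w + 3560280*y^4)*g^2*u^4
      + (9011200*w^4 + 30067200*y*w^3 + 35407040*y^2*w^2 + 16666970*y^3*w + 2329490*y^4)*g^3*u^3
      + (4198400*w^4 + 13369600*y*w^3 + 14734500*y^2*w^2 + 6270445*y^3*w + 707121*y^4)*g^4*u^2
      + (1024000*w^4 + 3068800*y*w^3 + 3099140*y^2*w^2 + 1156290*y^3*w + 94342*y^4)*g^5*u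
      + (102400*w^4 + 284800*y*w^3 + 258505*y^2*w^2 + 82305*y^3*w + 3896*y^4)*g^6"
    unfolding c_def r_def e_def z_def \<mu>_def u w by (simp add: field_simps power_numeral_reduce)
  show ?thesis using assms(1,2,4,5)
    by (intro le_if_scaled_diff_nonneg[OF id] add_nonneg_nonneg mult_nonneg_nonneg zero_le_power) simp_all
qed

lemma contraction_certificate_triangle:
  fixes g t b :: real
  assumes "0 \<le> g" "0 \<le> t" "0 \<le> b" "g + t + b = 1"
  defines "\<mu> \<equiv> g / 2"
  defines "z \<equiv> \<mu> + t"
  defines "c \<equiv> (z + \<mu>) / 2" and "r \<equiv> (z - \<mu>) / 2" and "e \<equiv> 4 * z"
  shows "\<mu> * (e^2 + ((-3*\<mu> + 8*r*c + 9/8*\<mu>^2)*e + 12/5*\<mu>*\<mu>))^2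
    \<le> 4 * (1/2*e^2 - 23/16*\<mu>^2*e - 4*r*c^2*\<mu>)
        * (\<mu>*e^2 + 2*b*e^2 + \<mu>*((-2 + 6*r + 9/8*\<mu>^2)*e + (15/16 - 141/20*r)*\<mu>))" (is "\<mu> * ?D^2 \<le> 4 * ?A * ?B")
proof -
  have b: "b = 1 - g - t" using assms by auto
  have id: "12800 * (4 * ?A * ?B - \<mu> * ?D^2) =
      (13107200*t^4*b^4 + 39321600*t^5*b^3 + 39321600*t^6*b^2 + 13107200*t^7*b)
      + (24576000*t^3*b^4 + 115507200*t^4*b^3 + 157696000*t^5*b^2 + 67174400*t^6*b + 409600*t^7)*g
      + (17299200*t^2*b^4 + 127101440*t^3*b^3 + 248171520*t^4*b^2 + 141048320*t^5*b + 2679040*t^6)*g^2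
      + (5420800*t*b^4 + 66856960*t^2*b^3 + 195436360*t^3*b^2 + 154754720*t^4*b + 5829720*t^5)*g^3
      + (638400*b^4 + 17025310*t*b^3 + 81821510*t^2*b^2 + 95128290*t^3*b + 5889770*t^4)*g^4
      + (1693391*b^3 + 17427773*t*b^2 + 32843033*t^2*b + 3036611*t^3)*g^5
      + (1487853*b^2 + 5937476*t*b + 801463*t^2)*g^6
      + (436758*b + 98238*t)*g^7
      + (3896)*g^8"
    unfolding c_def r_def e_def z_def \<mu>_def b by (simp add: field_simps power_numeral_reduce)
  show ?thesis using assms(1,2,3)
    by (intro le_if_scaled_diff_nonneg[OF id] add_nonneg_nonneg mult_nonneg_nonneg zero_le_power) simp_all
qed

text \<open>\<open>A\<close>, \<open>D\<close>, \<open>B\<close> bound the coefficients of the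
  quadratic form that measures the slack in one contraction step. With e = 4 z and y = \<tau> e /
  \<mu>, multiplication by e^2 turns them into polynomials, and e^4 is cancelled at the end. On the
  face \<mu> + z = 1 the free variables 2 \<mu> and y fill a unit square; on the face 4 \<tau> z =
  \<mu>, where y = 1, the pair (\<mu>, z) fills a triangle.\<close>

lemma contraction_discriminant:
  fixes \<mu> z \<tau> :: real
  assumes \<mu>: "0 < \<mu>" "\<mu> \<le> z" "\<mu> + z \<le> 1" and \<tau>: "0 < \<tau>" "4 * \<tau> * z \<le> \<mu>"
    and dich: "\<mu> + z = 1 \<or> 4 * \<tau> * z = \<mu>"
  defines "c \<equiv> (z + \<mu>) / 2" and "r \<equiv> (z - \<mu>) / 2"
  defines "A \<equiv> \<mu>/2 - 23/16*\<tau>*\<mu>^2 - 4*r*\<tau>^2*c^2"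
    and "B \<equiv> \<mu> + 2*(1 - \<mu> - z) + \<tau>*(-2 + 15/16*\<tau> + 6*r - 141/20*r*\<tau> + 9/8*\<mu>^2)"
    and "D \<equiv> \<mu> + \<tau>*(-3*\<mu> + 12/5*\<tau>*\<mu> + 8*r*c + 9/8*\<mu>^2)"
  shows "D^2 \<le> 4 * A * B" "0 < A"
proof -
  define e where "e = 4 * z"
  have e: "0 < e" using \<mu> by (simp add: e_def)
  have "e^4 * D^2 \<le> e^4 * (4 * A * B)"
    using dich
  proof
    assume s: "\<mu> + z = 1"
    define y where "y = 4 * \<tau> * z / \<mu>"
    have y: "0 \<le> y" "y \<le> 1" and ye: "\<tau> * e = y * \<mu>"
      using \<mu> \<tau> by (auto simp: y_def e_def)
    have z: "z = 1 - \<mu>" using s by simp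
    let ?D = "e^2 + y*((-3*\<mu> + 8*r*c + 9/8*\<mu>^2)*e + 12/5*\<mu>*y*\<mu>)"
    let ?A = "1/2*e^2 - 23/16*y*\<mu>^2*e - 4*r*c^2*y^2*\<mu>"
    let ?B = "e^2 + y*((-2 + 6*r + 9/8*\<mu>^2)*e + (15/16 - 141/20*r)*y*\<mu>)"
    have "?D^2 \<le> 4 * ?A * ?B"
      using contraction_certificate_square[of "2*\<mu>" "1-2*\<mu>" y "1-y"] \<mu> y
      unfolding c_def r_def e_def z by (simp add: mult_ac)
    moreover have "e^2 * D = \<mu> * ?D"
    proof -
      have "e^2 * D = \<mu> * e^2 + (\<tau>*e)*((-3*\<mu> + 8*r*c + 9/8*\<mu>^2)*e + 12/5*\<mu>*(\<tau>*e))"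
        unfolding D_def by (simp add: algebra_simps power2_eq_square)
      then show ?thesis unfolding ye by (simp add: algebra_simps)
    qed
    moreover have "e^2 * A = \<mu> * ?A"
    proof -
      have "e^2 * A = \<mu>/2 * e^2 - 23/16*(\<tau>*e)*\<mu>^2*e - 4*r*(\<tau>*e)^2*c^2"
        unfolding A_def by (simp add: algebra_simps power2_eq_square)
      then show ?thesis unfolding ye by (simp add: algebra_simps power2_eq_square)
    qed
    moreover have "e^2 * B = \<mu> * ?B"
    proof -
      have "e^2 * B = \<mu> * e^2 + (\<tau>*e)*((-2 + 6*r + 9/8*\<mu>^2)*e + (15/16 - 141/20*r)*(\<tau>*e))"
        unfolding B_def using s by (simp add: algebra_simps power2_eq_square)
      then show ?thesis unfolding ye by (simp add: algebra_simps)
    qed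
    moreover have "e^4 * D^2 = (e^2 * D)^2" "e^4 * (4 * A * B) = 4 * (e^2*A) * (e^2*B)"
      by (simp_all add: power2_eq_square power4_eq_xxxx)
    moreover have "(\<mu> * ?D)^2 \<le> 4 * (\<mu> * ?A) * (\<mu> * ?B)"
      using mult_left_mono[OF calculation(1), of "\<mu>^2"] by (simp add: power_mult_distrib power2_eq_square mult_ac)
    ultimately show ?thesis by metis
  next
    assume s: "4 * \<tau> * z = \<mu>"
    have ye: "\<tau> * e = \<mu>"
      using s by (auto simp: e_def)
    let ?D = "e^2 + ((-3*\<mu> + 8*r*c + 9/8*\<mu>^2)*e + 12/5*\<mu>*\<mu>)"
    let ?A = "1/2*e^2 - 23/16*\<mu>^2*e - 4*r*c^2*\<mu>"
    \<comment> \<open>Here 1 - \<mu> - z need not vanish, so e^2 B has no common factor \<mu>,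
      unlike e^2 A and e^2 D. The inequality for this face therefore carries \<mu> to the first
      power only.\<close>
    let ?B = "\<mu>*e^2 + 2*(1-\<mu>-z)*e^2 + \<mu>*((-2 + 6*r + 9/8*\<mu>^2)*e + (15/16 - 141/20*r)*\<mu>)"
    have "\<mu> * ?D^2 \<le> 4 * ?A * ?B"
      using contraction_certificate_triangle[of "2*\<mu>" "z-\<mu>" "1-\<mu>-z"] \<mu>
      unfolding c_def r_def e_def by (simp add: mult_ac)
    moreover have "e^2 * D = \<mu> * ?D"
    proof -
      have "e^2 * D = \<mu> * e^2 + (\<tau>*e)*((-3*\<mu> + 8*r*c + 9/8*\<mu>^2)*e + 12/5*\<mu>*(\<tau>*e))"
        unfolding D_def by (simp add: algebra_simps power2_eq_square)
      then show ?thesis unfolding ye by (simp add: algebra_simps)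
    qed
    moreover have "e^2 * A = \<mu> * ?A"
    proof -
      have "e^2 * A = \<mu>/2 * e^2 - 23/16*(\<tau>*e)*\<mu>^2*e - 4*r*(\<tau>*e)^2*c^2"
        unfolding A_def by (simp add: algebra_simps power2_eq_square)
      then show ?thesis unfolding ye by (simp add: algebra_simps power2_eq_square)
    qed
    moreover have "e^2 * B = ?B"
    proof -
      have "e^2 * B = \<mu> * e^2 + 2*(1-\<mu>-z)*e^2 + (\<tau>*e)*((-2 + 6*r + 9/8*\<mu>^2)*e + (15/16 - 141/20*r)*(\<tau>*e))"
        unfolding B_def by (simp add: algebra_simps power2_eq_square)
      then show ?thesis unfolding ye by simp
    qed
    moreover have "e^4 * D^2 = (e^2 * D)^2" "e^4 * (4 * A * B) = 4 * (e^2*A) * (e^2*B)"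
      by (simp_all add: power2_eq_square power4_eq_xxxx)
    moreover have "(\<mu> * ?D)^2 \<le> 4 * (\<mu> * ?A) * ?B"
      using mult_left_mono[OF calculation(1), of "\<mu>"] \<mu> by (simp add: power_mult_distrib power2_eq_square mult_ac)
    ultimately show ?thesis by metis
  qed
  then show "D^2 \<le> 4 * A * B" using e by (simp add: mult_le_cancel_left)
  have \<tau>4: "\<tau> \<le> 1/4"
  proof -
    have "4 * \<tau> * z \<le> z" using \<mu> \<tau> by linarith
    then show ?thesis using \<mu> by (auto simp: mult_le_cancel_right1)
  qed
  have "\<tau> * \<mu> \<le> 1/4 * (1/2)" using \<tau>4 \<mu> \<tau> by (intro mult_mono) auto
  then have 1: "\<tau> * \<mu> * \<mu> \<le> 1/8 * \<mu>" using \<mu> by (intro mult_right_mono) auto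
  have "r * \<tau> \<le> z * \<tau> / 2" using \<mu> \<tau> by (simp add: r_def field_simps)
  also have "\<dots> \<le> \<mu> / 8" using \<tau> by (simp add: field_simps)
  finally have 2: "r * \<tau> \<le> \<mu>/8" .
  have c: "0 \<le> c" "c \<le> 1/2" using \<mu> by (auto simp: c_def)
  then have "c^2 \<le> (1/2)^2" by (intro power_mono) auto
  then have "\<tau> * c^2 \<le> 1/4 * (1/4)" using \<tau>4 \<tau> by (intro mult_mono) (auto simp: power2_eq_square)
  then have "(r * \<tau>) * (\<tau> * c^2) \<le> \<mu>/8 * (1/16)" using 2 \<mu> \<tau> by (intro mult_mono) auto
  moreover have "A = \<mu>/2 - 23/16*(\<tau>*\<mu>*\<mu>) - 4 * ((r * \<tau>) * (\<tau> * c^2))"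
    by (simp add: A_def power2_eq_square)
  ultimately show "0 < A" using 1 \<mu>(1) by linarith
qed

lemma exp_minus_bounds:
  fixes \<tau> :: real
  assumes "0 \<le> \<tau>"
  shows "exp (-\<tau>) \<le> 1 - \<tau> + \<tau>^2/2" "1 - \<tau> + \<tau>^2/2 - \<tau>^3/6 \<le> exp (-\<tau>)"
proof -
  have d2: "exp (-\<tau>) \<le> 1 - \<tau> + \<tau>^2/2" if "0 \<le> \<tau>" for \<tau> :: real
  proof -
    have "(\<lambda>t. 1 - t + t^2/2 - exp (-t)) 0 \<le> (\<lambda>t. 1 - t + t^2/2 - exp (-t)) \<tau>"
    proof (rule DERIV_nonneg_imp_nondecreasing[OF that])
      fix x :: real assume "0 \<le> x" "x \<le> \<tau>"
      have "0 \<le> -1 + x + exp (-x)" using exp_ge_add_one_self[of "-x"] by simp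
      then show "\<exists>y. ((\<lambda>t. 1 - t + t^2/2 - exp (-t)) has_real_derivative y) (at x) \<and> 0 \<le> y"
        by (intro exI[of _ "-1 + x + exp (-x)"] conjI) (auto intro!: derivative_eq_intros)
    qed
    then show ?thesis by simp
  qed
  show "exp (-\<tau>) \<le> 1 - \<tau> + \<tau>^2/2" using d2[OF assms] .
  have "(\<lambda>t. exp (-t) - (1 - t + t^2/2 - t^3/6)) 0 \<le> (\<lambda>t. exp (-t) - (1 - t + t^2/2 - t^3/6)) \<tau>"
  proof (rule DERIV_nonneg_imp_nondecreasing[OF assms])
    fix x :: real assume "0 \<le> x" "x \<le> \<tau>"
    then have "0 \<le> - exp (-x) + 1 - x + x^2/2" using d2[of x] by simp
    then show "\<exists>y. ((\<lambda>t. exp (-t) - (1 - t + t^2/2 - t^3/6)) has_real_derivative y) (at x) \<and> 0 \<le> y"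
      by (intro exI[of _ "- exp (-x) + 1 - x + x^2/2"] conjI) (auto intro!: derivative_eq_intros simp: field_simps)
  qed
  then show "1 - \<tau> + \<tau>^2/2 - \<tau>^3/6 \<le> exp (-\<tau>)" by simp
qed

lemma norm_sq_lincomb:
  fixes b d :: "'a::real_inner"
  shows "(norm (x *\<^sub>R b + y *\<^sub>R d))\<^sup>2 = x^2 * (b \<bullet> b) + 2 * x * y * (b \<bullet> d) + y^2 * (d \<bullet> d)"
  unfolding power2_norm_eq_inner
  by (simp add: inner_simps inner_commute power2_eq_square algebra_simps)

text \<open>Completing the square, with X an inner product and p, q the squared norms:
  Cauchy-Schwarz takes the place of X^2 = p q. Only an upper bound for the modulus of the mixed
  coefficient enters, so the exact coefficients may be replaced by simpler bounds
  beforehand.\<close>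

lemma quadratic_form_nonneg:
  fixes A B D D' X p q :: real
  assumes D: "D^2 \<le> 4 * A * B" and A: "0 < A" and D': "\<bar>D'\<bar> \<le> D"
    and pq: "0 \<le> p" "0 \<le> q" "X^2 \<le> p * q"
  shows "0 \<le> A * q + D' * X + B * p"
proof (cases "q = 0")
  case True
  have "0 \<le> 4 * A * B" by (rule order_trans[OF zero_le_power2 D])
  then have "0 \<le> B" using A zero_le_mult_iff[of "4 * A" B] by auto
  moreover have "X = 0" using True pq by simp
  ultimately show ?thesis using True pq by simp
next
  case False
  then have q: "0 < q" using pq by simp
  have "D'^2 \<le> D^2" using D' by (metis abs_ge_zero power2_abs power_mono)
  then have "D'^2 * X^2 \<le> (4 * A * B) * (p * q)" using D pq order_trans[OF zero_le_power2 D] by (intro mult_mono) auto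
  then have "(2 * A * q + D' * X)^2 \<le> (4 * A * q) * (A * q + D' * X + B * p)"
    by (simp add: power2_eq_square algebra_simps)
  then have "0 \<le> (4 * A * q) * (A * q + D' * X + B * p)" by (rule order_trans[OF zero_le_power2])
  moreover have "0 < 4 * A * q" using A q by simp
  ultimately show ?thesis using zero_le_mult_iff not_less by blast
qed

text \<open>The hypothesis on G describes the ball |G - c d| <= r |d| around c d, where d = a - b
  and c, r are midpoint and half-width of [\<mu>, z]. Writing G = c d + e and eliminating e leaves a
  quadratic form in d and b as slack. To first order in \<tau> its coefficients are \<mu>/2, \<mu>
  and \<mu> + 2 (1 - \<mu> - z). For |d|^2 the available rate is 2 (c - r) = 2 \<mu>, of which the
  factor 3/4 in the claim spends 3/2 \<mu>; \<mu> + z <= 1 keeps the coefficient of |b|^2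
  positive.\<close>

lemma contraction_step_boundary:
  fixes a b G :: "'a::real_inner"
  assumes \<mu>: "0 < \<mu>" "\<mu> \<le> z" "\<mu> + z \<le> 1" and \<tau>: "0 < \<tau>" "4 * \<tau> * z \<le> \<mu>"
    and dich: "\<mu> + z = 1 \<or> 4 * \<tau> * z = \<mu>"
    and G: "0 \<le> (G - \<mu> *\<^sub>R (a - b)) \<bullet> (z *\<^sub>R (a - b) - G)"
  defines "\<delta> \<equiv> 1 - exp (-\<tau>)"
  shows "(norm (a - \<tau> *\<^sub>R G))\<^sup>2 + (norm ((1 - \<delta>) *\<^sub>R b - \<delta> *\<^sub>R G))\<^sup>2
    \<le> (1 - 3/4 * \<mu> * \<tau>)\<^sup>2 * ((norm a)\<^sup>2 + (norm b)\<^sup>2)"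
proof -
  define d where "d = a - b"
  have a: "a = b + d" by (simp add: d_def)
  define c r where "c = (z + \<mu>) / 2" and "r = (z - \<mu>) / 2"
  define e where "e = G - c *\<^sub>R d"
  have Ge: "G = c *\<^sub>R d + e" by (simp add: e_def)
  have r0: "0 \<le> r" using \<mu> by (simp add: r_def)
  have c0: "0 \<le> c" "c \<le> 1/2" using \<mu> by (auto simp: c_def)
  have \<tau>4: "\<tau> \<le> 1/4"
  proof -
    have "4 * \<tau> * z \<le> z" using \<mu> \<tau> by linarith
    then show ?thesis using \<mu> by (auto simp: mult_le_cancel_right1)
  qed
  have e2: "e \<bullet> e \<le> r^2 * (d \<bullet> d)"
  proof -
    have "(G - \<mu> *\<^sub>R d) \<bullet> (z *\<^sub>R d - G) = (r *\<^sub>R d + e) \<bullet> (r *\<^sub>R d - e)"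
      by (simp add: Ge c_def r_def scaleR_diff_left scaleR_add_left algebra_simps add_divide_distrib diff_divide_distrib flip: scaleR_add_left)
    also have "\<dots> = r^2 * (d \<bullet> d) - e \<bullet> e"
      by (simp add: inner_simps inner_commute power2_eq_square algebra_simps)
    finally show ?thesis using G by (simp add: d_def)
  qed
  \<comment> \<open>With \<delta> = \<tau> (1 - s \<tau>) all coefficients become polynomials in s
    and \<tau>, the exponential surviving only in the bounds on s, which is close to 1/2. Below, k
    is (\<delta>/\<tau>)^2.\<close>
  define s where "s = (\<tau> - \<delta>) / \<tau>^2"
  have \<delta>: "\<delta> = \<tau> * (1 - s * \<tau>)" using \<tau> by (simp add: s_def field_simps power2_eq_square)
  have s: "1/2 - \<tau>/6 \<le> s" "s \<le> 1/2"
    using exp_minus_bounds[of \<tau>] \<tau> by (auto simp: s_def \<delta>_def field_simps power2_eq_square power3_eq_cube)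
  define k where "k = (1 - s * \<tau>)^2"
  have "0 \<le> s" using s \<tau>4 by linarith
  then have s\<tau>: "0 \<le> s * \<tau>" "s * \<tau> \<le> 1/8"
    using s \<tau> \<tau>4 mult_mono[of s "1/2" \<tau> "1/4"] by auto
  have k: "0 \<le> k" "k \<le> 1" unfolding k_def using s\<tau> by (auto intro: power_le_one)
  have s\<tau>2: "(s * \<tau>)^2 \<le> \<tau> / 16"
  proof -
    have "(s * \<tau>)^2 \<le> (\<tau> / 2)^2" using s s\<tau> \<tau> by (intro power_mono) auto
    also have "\<dots> \<le> \<tau> / 16" using \<tau> \<tau>4 by (simp add: power2_eq_square)
    finally show ?thesis .
  qed
  have k_eq: "k = 1 - 2 * s * \<tau> + (s * \<tau>)^2" by (simp add: k_def power2_diff)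
  have k2s: "k + 2 * s \<le> 2 - 15/16 * \<tau>"
    using s\<tau>2 mult_right_mono[OF s(2), of "2 * (1 - \<tau>)"] \<tau>4 by (simp add: k_eq algebra_simps)
  have j: "3/2 - 6/5 * \<tau> \<le> s + k" "s + k \<le> 3/2"
  proof -
    have "(1/2 - \<tau>/6) * (1 - 2*\<tau>) \<le> s * (1 - 2 * \<tau>)" "s * (1 - 2*\<tau>) \<le> 1/2 * (1 - 2*\<tau>)"
      using s \<tau>4 by (intro mult_right_mono; simp)+
    moreover have "s + k = 1 + s * (1 - 2*\<tau>) + (s * \<tau>)^2" by (simp add: k_eq algebra_simps)
    moreover have "(1/2 - \<tau>/6) * (1 - 2*\<tau>) = 1/2 - 7/6*\<tau> + \<tau>^2/3" by (simp add: field_simps power2_eq_square)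
    moreover have "0 \<le> (s * \<tau>)^2" by auto
    moreover have "1/2 * (1 - 2*\<tau>) = 1/2 - \<tau>" by simp
    moreover define p q where "p = s * (1 - 2*\<tau>)" and "q = (s * \<tau>)^2"
    ultimately have "1/2 - 7/6*\<tau> + \<tau>^2/3 \<le> p" "p \<le> 1/2 - \<tau>" "s + k = 1 + p + q" "0 \<le> q" "q \<le> \<tau> / 16"
      using s\<tau>2 by auto
    then show "3/2 - 6/5 * \<tau> \<le> s + k" "s + k \<le> 3/2" using \<tau>(1) zero_le_power2[of \<tau>] by linarith+
  qed
  \<comment> \<open>\<open>u\<close> collects everything that meets e linearly: the expanded squares
    contain e only in -2 e.u and in |e|^2.\<close>
  define u where "u = \<tau> *\<^sub>R (a - (\<tau> * c) *\<^sub>R d) + \<delta> *\<^sub>R ((1 - \<delta>) *\<^sub>R b - (\<delta> * c) *\<^sub>R d)"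
  have "(norm (a - \<tau> *\<^sub>R G))\<^sup>2 + (norm ((1 - \<delta>) *\<^sub>R b - \<delta> *\<^sub>R G))\<^sup>2
    = (norm (a - (\<tau> * c) *\<^sub>R d))\<^sup>2 + (norm ((1 - \<delta>) *\<^sub>R b - (\<delta> * c) *\<^sub>R d))\<^sup>2
      + (\<tau>^2 + \<delta>^2) * (e \<bullet> e) - 2 * (e \<bullet> u)"
    unfolding Ge u_def power2_norm_eq_inner
    by (simp add: inner_simps inner_commute power2_eq_square algebra_simps)
  \<comment> \<open>Young's inequality with weight \<tau>. As u is \<tau> times a vector of order
    one, both resulting terms have order \<tau>.\<close>
  moreover have "- 2 * (e \<bullet> u) \<le> r * \<tau> * (d \<bullet> d) + r / \<tau> * (u \<bullet> u)"
  proof -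
    have ne: "norm e \<le> r * norm d"
      using e2 r0 by (simp add: norm_eq_sqrt_inner real_sqrt_le_iff real_le_lsqrt power_mult_distrib)
    have "- 2 * (e \<bullet> u) \<le> 2 * (norm e * norm u)"
      using Cauchy_Schwarz_ineq2[of e u] by linarith
    also have "\<dots> \<le> 2 * (r * norm d * norm u)" using ne by (intro mult_left_mono mult_right_mono) auto
    also have "\<dots> = r * (2 * norm d * norm u)" by simp
    also have "\<dots> \<le> r * (\<tau> * (norm d)^2 + (norm u)^2 / \<tau>)"
    proof (intro mult_left_mono[OF _ r0])
      have "0 \<le> (\<tau> * norm d - norm u)^2 / \<tau>" using \<tau> by simp
      then show "2 * norm d * norm u \<le> \<tau> * (norm d)^2 + (norm u)^2 / \<tau>"
        using \<tau> by (simp add: power2_diff field_simps power2_eq_square)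
    qed
    finally show ?thesis by (simp add: power2_norm_eq_inner algebra_simps)
  qed
  ultimately have 1: "(norm (a - \<tau> *\<^sub>R G))\<^sup>2 + (norm ((1 - \<delta>) *\<^sub>R b - \<delta> *\<^sub>R G))\<^sup>2
    \<le> (norm (a - (\<tau> * c) *\<^sub>R d))\<^sup>2 + (norm ((1 - \<delta>) *\<^sub>R b - (\<delta> * c) *\<^sub>R d))\<^sup>2
      + (\<tau>^2 + \<delta>^2) * (r^2 * (d \<bullet> d)) + (r * \<tau> * (d \<bullet> d) + r / \<tau> * (u \<bullet> u))"
    using mult_left_mono[OF e2 add_nonneg_nonneg[OF zero_le_power2[of \<tau>] zero_le_power2[of \<delta>]]] by linarith
  define bb bd dd where "bb = b \<bullet> b" and "bd = b \<bullet> d" and "dd = d \<bullet> d"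
  have n1: "(norm (a - (\<tau> * c) *\<^sub>R d))\<^sup>2 = bb + 2 * (1 - \<tau> * c) * bd + (1 - \<tau>*c)^2 * dd"
    using norm_sq_lincomb[of 1 b "1 - \<tau>*c" d] by (simp add: a bb_def bd_def dd_def algebra_simps)
  have n2: "(norm ((1 - \<delta>) *\<^sub>R b - (\<delta> * c) *\<^sub>R d))\<^sup>2 = (1-\<delta>)^2 * bb - 2 * (1-\<delta>) * (\<delta>*c) * bd + (\<delta>*c)^2 * dd"
    using norm_sq_lincomb[of "1-\<delta>" b "-(\<delta> * c)" d] by (simp add: bb_def bd_def dd_def)
  define u1 u2 where "u1 = 1 + (1 - s*\<tau>)*(1 - \<delta>)" and "u2 = 1 - \<tau> * c - (1 - s*\<tau>) * (\<delta> * c)"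
  have n3: "u \<bullet> u = \<tau>^2 * (u1^2 * bb + 2 * u1 * u2 * bd + u2^2 * dd)"
  proof -
    have "u = \<tau> *\<^sub>R (u1 *\<^sub>R b + u2 *\<^sub>R d)"
    proof -
      have "u = (\<tau> + \<delta> * (1 - \<delta>)) *\<^sub>R b + (\<tau> * (1 - \<tau> * c) - \<delta> * (\<delta> * c)) *\<^sub>R d"
        unfolding u_def a by (simp add: scaleR_add_right scaleR_diff_right scaleR_add_left scaleR_diff_left right_diff_distrib)
      moreover have "\<tau> + \<delta> * (1 - \<delta>) = \<tau> * u1" "\<tau> * (1 - \<tau> * c) - \<delta> * (\<delta> * c) = \<tau> * u2"
        unfolding u1_def u2_def by (simp_all add: \<delta> algebra_simps)
      ultimately show ?thesis by (simp add: scaleR_add_right)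
    qed
    then have "u \<bullet> u = \<tau>^2 * ((u1 *\<^sub>R b + u2 *\<^sub>R d) \<bullet> (u1 *\<^sub>R b + u2 *\<^sub>R d))"
      by (simp only: inner_scaleR_left inner_scaleR_right power2_eq_square mult.assoc)
    then have "u \<bullet> u = \<tau>^2 * (norm (u1 *\<^sub>R b + u2 *\<^sub>R d))^2"
      by (simp only: power2_norm_eq_inner)
    then show ?thesis unfolding norm_sq_lincomb by (simp add: bb_def bd_def dd_def)
  qed
  have n4: "(norm a)\<^sup>2 + (norm b)\<^sup>2 = 2 * bb + 2 * bd + dd"
    using norm_sq_lincomb[of 1 b 1 d] by (simp add: a bb_def bd_def dd_def power2_norm_eq_inner)
  define A where "A = \<mu>/2 + \<tau> * (-(1+k)*\<mu>^2 - r*\<tau>*(1+k)^2*c^2 + 9/16*\<mu>^2)"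
  define B where "B = \<mu> + 2*(1-\<mu>-z) + \<tau> * (-(k + 2 * s) + 4*r*(s+k) - r*\<tau>*(s+k)^2 + 9/8*\<mu>^2)"
  define D where "D = \<mu> + \<tau> * (-2*(s+k)*\<mu> + 4*r*c*(1+k) - 2*r*\<tau>*(s+k)*(1+k)*c + 9/8*\<mu>^2)"
  have z: "z = 2 * c - \<mu>" and r: "r = c - \<mu>" by (auto simp: c_def r_def field_simps)
  have id: "(1 - 3/4 * \<mu> * \<tau>)\<^sup>2 * (2 * bb + 2 * bd + dd) -
    ((bb + 2 * (1 - \<tau> * c) * bd + (1 - \<tau>*c)^2 * dd) + ((1-\<delta>)^2 * bb - 2 * (1-\<delta>) * (\<delta>*c) * bd + (\<delta>*c)^2 * dd)
     + (\<tau>^2 + \<delta>^2) * (r^2 * dd) + (r * \<tau> * dd + r * \<tau> * (u1^2 * bb + 2 * u1 * u2 * bd + u2^2 * dd)))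
    = \<tau> * (A * dd + D * bd + B * bb)"
    unfolding A_def B_def D_def u1_def u2_def \<delta> z r k_def
    by (simp add: field_simps power_numeral_reduce)
  \<comment> \<open>The same coefficients with s and k replaced by their bounds. Putting k = 1 gives
    -2 + 9/16 = -23/16, and 4 (s + k) - \<tau> (s + k)^2 >= 6 - (24/5 + 9/4) \<tau> gives 141/20.
    The terms in 9/16 and 9/8 come from the square of 3/4 \<mu> \<tau>.\<close>
  define A' where "A' = \<mu>/2 - 23/16*\<tau>*\<mu>^2 - 4*r*\<tau>^2*c^2"
  define B' where "B' = \<mu> + 2*(1 - \<mu> - z) + \<tau>*(-2 + 15/16*\<tau> + 6*r - 141/20*r*\<tau> + 9/8*\<mu>^2)"
  define D' where "D' = \<mu> + \<tau>*(-3*\<mu> + 12/5*\<tau>*\<mu> + 8*r*c + 9/8*\<mu>^2)"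
  have disc: "D'^2 \<le> 4 * A' * B'" "0 < A'"
    using contraction_discriminant[OF \<mu> \<tau> dich] unfolding A'_def B'_def D'_def c_def r_def by auto
  have "A' \<le> A"
  proof -
    have "(1+k)^2 \<le> 2^2" using k by (intro power_mono) auto
    then have "A - A' = \<tau> * ((1 - k) * \<mu>^2 + r * \<tau> * c^2 * (4 - (1+k)^2))" "(1+k)^2 \<le> 4"
      by (simp_all add: A_def A'_def algebra_simps power2_eq_square)
    moreover have "0 \<le> \<tau> * ((1 - k) * \<mu>^2 + r * \<tau> * c^2 * (4 - (1+k)^2))"
      using \<tau> k r0 calculation(2) by (intro mult_nonneg_nonneg add_nonneg_nonneg) auto
    ultimately show ?thesis by linarith
  qed
  have j0: "0 \<le> s + k" using \<open>0 \<le> s\<close> k by simp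
  have "B' \<le> B"
  proof -
    have "(s+k)^2 \<le> (3/2)^2" using j j0 by (intro power_mono) auto
    then have "\<tau> * (s+k)^2 \<le> \<tau> * (9/4)" using \<tau> by (intro mult_left_mono) (auto simp: power2_eq_square)
    then have "r * (6 - 141/20*\<tau>) \<le> r * (4*(s+k) - \<tau>*(s+k)^2)" using j r0 by (intro mult_left_mono) auto
    then have "-2 + 15/16*\<tau> + 6*r - 141/20*r*\<tau> + 9/8*\<mu>^2 \<le> -(k + 2 * s) + 4*r*(s+k) - r*\<tau>*(s+k)^2 + 9/8*\<mu>^2"
      using k2s by (simp add: algebra_simps)
    then show ?thesis unfolding B_def B'_def using \<tau> by simp
  qed
  have rc: "0 \<le> r * c * (1 + k)" "r * c * (1 + k) \<le> r * c * 2"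
    using r0 c0 k by (auto intro!: mult_left_mono)
  have "\<tau> * (s+k) \<le> 1/4 * (3/2)" using \<tau> \<tau>4 j j0 by (intro mult_mono) auto
  then have "0 \<le> 2 * (r * c * (1+k)) * (2 - \<tau> * (s+k))"
    using rc by (simp add: zero_le_mult_iff)
  moreover have D_eq: "D = \<mu> * (1 - 2 * (\<tau> * (s+k))) + \<tau> * (2 * (r * c * (1+k)) * (2 - \<tau> * (s+k)) + 9/8*\<mu>^2)"
    by (simp add: D_def algebra_simps)
  ultimately have "0 \<le> D" using \<open>\<tau> * (s+k) \<le> 1/4 * (3/2)\<close> \<mu> \<tau> r0 c0 k
    by (simp only: D_eq) (intro add_nonneg_nonneg mult_nonneg_nonneg; simp)
  have "D \<le> D'"
  proof -
    have "(3/2 - 6/5 * \<tau>) * \<mu> \<le> (s+k) * \<mu>" using j \<mu> by (intro mult_right_mono) auto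
    moreover have "0 \<le> (r * c * (1+k)) * (\<tau> * (s+k))" using rc \<tau> j0 r0 c0 k by (intro mult_nonneg_nonneg) auto
    ultimately have "-2*(s+k)*\<mu> + 4*r*c*(1+k) - 2*r*\<tau>*(s+k)*(1+k)*c + 9/8*\<mu>^2
      \<le> -3*\<mu> + 12/5*\<tau>*\<mu> + 8*r*c + 9/8*\<mu>^2"
      using rc by (simp add: algebra_simps)
    then show ?thesis unfolding D_def D'_def using \<tau> by simp
  qed
  have "0 \<le> A * dd + D * bd + B * bb"
  proof -
    have "0 \<le> A' * dd + D * bd + B' * bb"
      using disc \<open>0 \<le> D\<close> \<open>D \<le> D'\<close> Cauchy_Schwarz_ineq[of b d]
      by (intro quadratic_form_nonneg) (auto simp: bb_def dd_def bd_def)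
    also have "\<dots> \<le> A * dd + D * bd + B * bb"
      using mult_right_mono[OF \<open>A' \<le> A\<close>, of dd] mult_right_mono[OF \<open>B' \<le> B\<close>, of bb] by (simp add: bb_def dd_def)
    finally show ?thesis .
  qed
  then have "0 \<le> \<tau> * (A * dd + D * bd + B * bb)" using \<tau> by simp
  moreover have "r / \<tau> * (u \<bullet> u) = r * \<tau> * (u1^2 * bb + 2 * u1 * u2 * bd + u2^2 * dd)"
    unfolding n3 using \<tau> by (simp add: power2_eq_square)
  ultimately show ?thesis using 1 id unfolding n1 n2 n4 dd_def[symmetric] by linarith
qed

lemma contraction_step_normalized:
  fixes a b G :: "'a::real_inner"
  assumes \<mu>: "0 < \<mu>" "\<mu> \<le> \<Lambda>" "\<mu> + \<Lambda> \<le> 1" and \<tau>: "0 < \<tau>" "4 * \<tau> * \<Lambda> \<le> \<mu>"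
    and G: "0 \<le> (G - \<mu> *\<^sub>R (a - b)) \<bullet> (\<Lambda> *\<^sub>R (a - b) - G)"
  shows "(norm (a - \<tau> *\<^sub>R G))\<^sup>2 + (norm (exp (-\<tau>) *\<^sub>R b - (1 - exp (-\<tau>)) *\<^sub>R G))\<^sup>2
    \<le> (1 - 3/4 * \<mu> * \<tau>)\<^sup>2 * ((norm a)\<^sup>2 + (norm b)\<^sup>2)"
proof -
  \<comment> \<open>Enlarging \<open>\<Lambda>\<close> weakens the hypothesis on \<open>G\<close>, so one of the two constraints may be taken to be tight.\<close>
  define z where "z = min (1 - \<mu>) (\<mu> / (4 * \<tau>))"
  have z: "\<Lambda> \<le> z" using \<mu> \<tau> by (auto simp: z_def field_simps)
  define d where "d = a - b"
  \<comment> \<open>This sign is what makes the hypothesis weaker as \<Lambda> grows: passing to z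
    adds (z - \<Lambda>) times it. It is read off the hypothesis after division by \<Lambda> -
    \<mu>; for \<mu> = \<Lambda> the hypothesis forces G = \<mu> d instead.\<close>
  have "0 \<le> (G - \<mu> *\<^sub>R d) \<bullet> d"
  proof (cases "\<mu> = \<Lambda>")
    case True
    have "(G - \<mu> *\<^sub>R d) \<bullet> (\<mu> *\<^sub>R d - G) = - ((G - \<mu> *\<^sub>R d) \<bullet> (G - \<mu> *\<^sub>R d))"
      by (metis inner_minus_right minus_diff_eq)
    then have "G - \<mu> *\<^sub>R d = 0" using G True by (simp add: d_def inner_gt_zero_iff not_less[symmetric] del: not_less)
    then show ?thesis by simp
  next
    case False
    have "(G - \<mu> *\<^sub>R d) \<bullet> (\<Lambda> *\<^sub>R d - G) = (\<Lambda> - \<mu>) * ((G - \<mu> *\<^sub>R d) \<bullet> d) - (G - \<mu> *\<^sub>R d) \<bullet> (G - \<mu> *\<^sub>R d)"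
      by (simp add: inner_simps inner_commute algebra_simps)
    then have "0 \<le> (\<Lambda> - \<mu>) * ((G - \<mu> *\<^sub>R d) \<bullet> d)" using G inner_ge_zero[of "G - \<mu> *\<^sub>R d"] unfolding d_def by linarith
    then show ?thesis using False \<mu> by (simp add: zero_le_mult_iff)
  qed
  then have "0 \<le> (z - \<Lambda>) * ((G - \<mu> *\<^sub>R d) \<bullet> d)" using z by simp
  moreover have "(G - \<mu> *\<^sub>R d) \<bullet> (z *\<^sub>R d - G) = (G - \<mu> *\<^sub>R d) \<bullet> (\<Lambda> *\<^sub>R d - G) + (z - \<Lambda>) * ((G - \<mu> *\<^sub>R d) \<bullet> d)"
    by (simp add: inner_simps algebra_simps)
  ultimately have "0 \<le> (G - \<mu> *\<^sub>R d) \<bullet> (z *\<^sub>R d - G)" using G by (simp add: d_def)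
  moreover have "\<mu> + z \<le> 1" "4 * \<tau> * z \<le> \<mu>" "\<mu> + z = 1 \<or> 4 * \<tau> * z = \<mu>"
    using \<tau> by (auto simp: z_def min_def field_simps)
  ultimately show ?thesis
    using contraction_step_boundary[of \<mu> z \<tau> G a b] \<mu> \<tau> z unfolding d_def by simp
qed

text \<open>Friction units: \<tau> = \<gamma> h, G = g / \<gamma>, and \<gamma> x is the difference
  of the two coordinates. The curvature bounds m, M then become m/\<gamma>^2 and M/\<gamma>^2, and
  the two conditions on \<gamma> and h become those of the normalized lemma.\<close>

lemma contraction_step:
  fixes v x g :: "'a::real_inner"
  assumes m: "0 < m" "m \<le> M" and \<gamma>: "0 < \<gamma>" "m + M \<le> \<gamma>\<^sup>2" and h: "0 < h" "h \<le> m / (4 * \<gamma> * M)"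
    and g: "0 \<le> (g - m *\<^sub>R x) \<bullet> (M *\<^sub>R x - g)"
  shows "(norm (v + \<gamma> *\<^sub>R x - h *\<^sub>R g))\<^sup>2 + (norm (exp (-\<gamma>*h) *\<^sub>R v - ((1 - exp (-\<gamma>*h)) / \<gamma>) *\<^sub>R g))\<^sup>2
    \<le> (1 - 3/4 * m * h / \<gamma>)\<^sup>2 * ((norm (v + \<gamma> *\<^sub>R x))\<^sup>2 + (norm v)\<^sup>2)"
proof -
  let ?G = "(1/\<gamma>) *\<^sub>R g"
  have M: "0 < M" using m by simp
  have x: "(v + \<gamma> *\<^sub>R x) - v = \<gamma> *\<^sub>R x" by simp
  have s: "(c/\<gamma>\<^sup>2) *\<^sub>R (\<gamma> *\<^sub>R x) = (1/\<gamma>) *\<^sub>R (c *\<^sub>R x)" for c using \<gamma> by (simp add: power2_eq_square)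
  have "0 \<le> (?G - (m/\<gamma>\<^sup>2) *\<^sub>R (\<gamma> *\<^sub>R x)) \<bullet> ((M/\<gamma>\<^sup>2) *\<^sub>R (\<gamma> *\<^sub>R x) - ?G)"
    unfolding s scaleR_diff_right[symmetric] using g \<gamma> by simp
  moreover have "4 * (\<gamma>*h) * (M/\<gamma>\<^sup>2) \<le> m/\<gamma>\<^sup>2" using h M \<gamma> by (simp add: field_simps)
  moreover have "m/\<gamma>\<^sup>2 + M/\<gamma>\<^sup>2 \<le> 1" using \<gamma> by (simp add: field_simps)
  moreover have "0 < m/\<gamma>\<^sup>2" "m/\<gamma>\<^sup>2 \<le> M/\<gamma>\<^sup>2" "0 < \<gamma> * h" using m \<gamma> h by (auto intro: divide_right_mono)
  ultimately have "(norm (v + \<gamma> *\<^sub>R x - (\<gamma>*h) *\<^sub>R ?G))\<^sup>2 + (norm (exp (-(\<gamma>*h)) *\<^sub>R v - (1 - exp (-(\<gamma>*h))) *\<^sub>R ?G))\<^sup>2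
    \<le> (1 - 3/4 * (m/\<gamma>\<^sup>2) * (\<gamma>*h))\<^sup>2 * ((norm (v + \<gamma> *\<^sub>R x))\<^sup>2 + (norm v)\<^sup>2)"
    by (intro contraction_step_normalized[where \<Lambda>="M/\<gamma>\<^sup>2"]) (simp_all only: x)
  moreover have "3/4 * (m/\<gamma>\<^sup>2) * (\<gamma>*h) = 3/4 * m * h / \<gamma>" using \<gamma> by (simp add: power2_eq_square)
  ultimately show ?thesis using \<gamma> by simp
qed

section \<open>Strongly convex functions with Lipschitz gradient\<close>

text \<open>The second derivative enters through two-sided bounds on its quadratic form at each
  point and may be discontinuous. The estimates therefore use the mean value theorem and
  monotonicity along segments rather than integrals of the Hessian.\<close>

locale strongly_convex_smooth =
  fixes f :: "'a::euclidean_space \<Rightarrow> real" and g :: "'a \<Rightarrow> 'a" and m M :: real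
  assumes m_pos: "0 < m" and m_le_M: "m \<le> M"
    and f_deriv: "\<And>x. (f has_derivative (\<lambda>u. g x \<bullet> u)) (at x)"
    and g_deriv: "\<And>x. \<exists>H. (g has_derivative H) (at x) \<and>
      (\<forall>u. m * (norm u)\<^sup>2 \<le> u \<bullet> H u \<and> u \<bullet> H u \<le> M * (norm u)\<^sup>2)"
begin

lemma M_pos: "0 < M"
  using m_pos m_le_M by simp

lemma g_continuous: "continuous_on UNIV g"
  using g_deriv by (meson continuous_at_imp_continuous_on has_derivative_continuous)

lemma f_continuous: "continuous_on UNIV f"
  using f_deriv by (meson continuous_at_imp_continuous_on has_derivative_continuous)

lemma borel_measurable_g [measurable]: "g \<in> borel_measurable borel"
  by (rule borel_measurable_continuous_onI[OF g_continuous])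

lemma borel_measurable_f [measurable]: "f \<in> borel_measurable borel"
  by (rule borel_measurable_continuous_onI[OF f_continuous])

lemma f_deriv_line: "((\<lambda>t. f (x + t *\<^sub>R d)) has_real_derivative g (x + t *\<^sub>R d) \<bullet> d) (at t)"
proof -
  have "((\<lambda>t. f (x + t *\<^sub>R d)) has_derivative (\<lambda>s. g (x + t *\<^sub>R d) \<bullet> (s *\<^sub>R d))) (at t)"
    by (rule has_derivative_compose[OF _ f_deriv]) (auto intro!: derivative_eq_intros)
  then show ?thesis
    by (rule has_derivative_imp_has_field_derivative) (simp add: mult.commute)
qed

lemma g_mono_line:
  "m * (norm (y - x))\<^sup>2 \<le> (g y - g x) \<bullet> (y - x)" "(g y - g x) \<bullet> (y - x) \<le> M * (norm (y - x))\<^sup>2"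
proof -
  define d where "d = y - x"
  obtain H where H: "\<And>x. (g has_derivative H x) (at x)"
    and Hb: "\<And>x u. m * (norm u)\<^sup>2 \<le> u \<bullet> H x u" "\<And>x u. u \<bullet> H x u \<le> M * (norm u)\<^sup>2"
    using g_deriv by metis
  have der: "((\<lambda>t. g (x + t *\<^sub>R d) \<bullet> d) has_real_derivative d \<bullet> H (x + t *\<^sub>R d) d) (at t)" for t
  proof -
    have "((\<lambda>t. g (x + t *\<^sub>R d)) has_derivative (\<lambda>s. H (x + t *\<^sub>R d) (s *\<^sub>R d))) (at t)"
      by (rule has_derivative_compose[OF _ H]) (auto intro!: derivative_eq_intros)
    then have "((\<lambda>t. g (x + t *\<^sub>R d) \<bullet> d) has_derivative (\<lambda>s. H (x + t *\<^sub>R d) (s *\<^sub>R d) \<bullet> d)) (at t)"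
      by (auto intro!: derivative_eq_intros)
    moreover have "H (x + t *\<^sub>R d) (s *\<^sub>R d) = s *\<^sub>R H (x + t *\<^sub>R d) d" for s
      using H[of "x + t *\<^sub>R d"] by (simp add: has_derivative_bounded_linear linear_simps)
    ultimately show ?thesis
      by (intro has_derivative_imp_has_field_derivative) (auto simp: inner_commute mult.commute)
  qed
  obtain \<xi> where "g (x + 1 *\<^sub>R d) \<bullet> d - g (x + 0 *\<^sub>R d) \<bullet> d = (1 - 0) * (d \<bullet> H (x + \<xi> *\<^sub>R d) d)"
    using MVT2[OF zero_less_one der] by blast
  then have "(g y - g x) \<bullet> (y - x) = d \<bullet> H (x + \<xi> *\<^sub>R d) d"
    by (simp add: d_def inner_diff_left)
  then show "m * (norm (y - x))\<^sup>2 \<le> (g y - g x) \<bullet> (y - x)" "(g y - g x) \<bullet> (y - x) \<le> M * (norm (y - x))\<^sup>2"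
    using Hb by (simp_all add: d_def)
qed

text \<open>Along the segment, f minus its tangent and minus c t^2 |d|^2 / 2 is increasing for c = m
  and decreasing for c = M.\<close>

lemma f_quadratic_bounds:
  "f x + g x \<bullet> (y - x) + m * (norm (y - x))\<^sup>2 / 2 \<le> f y"
  "f y \<le> f x + g x \<bullet> (y - x) + M * (norm (y - x))\<^sup>2 / 2"
proof -
  define d where "d = y - x"
  have der: "((\<lambda>t. f (x + t *\<^sub>R d) - t * (g x \<bullet> d) - c * t\<^sup>2 / 2 * (norm d)\<^sup>2) has_real_derivative
    (g (x + t *\<^sub>R d) - g x) \<bullet> d - c * t * (norm d)\<^sup>2) (at t)" for t c
    by (auto intro!: derivative_eq_intros f_deriv_line simp: inner_diff_left field_simps)
  have b: "m * t * (norm d)\<^sup>2 \<le> (g (x + t *\<^sub>R d) - g x) \<bullet> d \<and> (g (x + t *\<^sub>R d) - g x) \<bullet> d \<le> M * t * (norm d)\<^sup>2"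
    if "0 \<le> t" for t
  proof (cases "t = 0")
    case False
    then show ?thesis
      using g_mono_line[of "x + t *\<^sub>R d" x] that
      by (simp add: power2_eq_square mult_ac)
  qed simp
  have "f (x + 0 *\<^sub>R d) - 0 * (g x \<bullet> d) - m * 0\<^sup>2 / 2 * (norm d)\<^sup>2 \<le> f (x + 1 *\<^sub>R d) - 1 * (g x \<bullet> d) - m * 1\<^sup>2 / 2 * (norm d)\<^sup>2"
    using der[of m] b by (intro DERIV_nonneg_imp_nondecreasing[OF zero_le_one]) (meson diff_ge_0_iff_ge)
  then show "f x + g x \<bullet> (y - x) + m * (norm (y - x))\<^sup>2 / 2 \<le> f y" by (simp add: d_def)
  have "f (x + 0 *\<^sub>R d) - 0 * (g x \<bullet> d) - M * 0\<^sup>2 / 2 * (norm d)\<^sup>2 \<ge> f (x + 1 *\<^sub>R d) - 1 * (g x \<bullet> d) - M * 1\<^sup>2 / 2 * (norm d)\<^sup>2"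
    using der[of M] b by (intro DERIV_nonpos_imp_nonincreasing[OF zero_le_one]) (meson diff_le_0_iff_le)
  then show "f y \<le> f x + g x \<bullet> (y - x) + M * (norm (y - x))\<^sup>2 / 2" by (simp add: d_def)
qed

text \<open>The Baillon--Haddad argument, applied to the convex function \<open>f - m/2 |x|\<^sup>2\<close>.\<close>

lemma g_cocoercive: "0 \<le> (g y - g x - m *\<^sub>R (y - x)) \<bullet> (M *\<^sub>R (y - x) - (g y - g x))"
proof -
  define F where "F z = f z - m * (norm z)\<^sup>2 / 2" for z
  define G where "G z = g z - m *\<^sub>R z" for z
  define R where "R = G y - G x"
  have sq: "(norm w)\<^sup>2 = (norm z)\<^sup>2 + 2 * (z \<bullet> (w - z)) + (norm (w - z))\<^sup>2" for w z :: 'a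
    by (simp add: power2_norm_eq_inner inner_simps inner_commute)
  have F_diff: "F w - F z - G z \<bullet> (w - z) = f w - f z - g z \<bullet> (w - z) - m * (norm (w - z))\<^sup>2 / 2" for w z
    unfolding F_def G_def sq[of w z]
    by (simp add: inner_diff_left inner_diff_right algebra_simps power2_norm_eq_inner inner_commute
        add_divide_distrib diff_divide_distrib)
  have F_lower: "F z + G z \<bullet> (w - z) \<le> F w" for z w
    using f_quadratic_bounds(1)[of z w] F_diff[of w z] by linarith
  have F_upper: "F w \<le> F z + G z \<bullet> (w - z) + (M - m) * (norm (w - z))\<^sup>2 / 2" for z w
    using f_quadratic_bounds(2)[of w z] F_diff[of w z] left_diff_distrib[of M m "(norm (w - z))\<^sup>2"] by argo
  have key: "F x + G x \<bullet> (y - x) + (norm (G y - G x))\<^sup>2 / (2 * L) \<le> F y" if L: "0 < L" "M - m \<le> L" for L x y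
  proof -
    define R where "R = G y - G x"
    \<comment> \<open>A gradient step from y: it minimizes over w the quadratic upper bound of F at
      y minus the tangent of F at x, so comparing the two bounds at z loses least.\<close>
    define z where "z = y - (1 / L) *\<^sub>R R"
    have "F x + G x \<bullet> (z - x) \<le> F y + G y \<bullet> (z - y) + (M - m) * (norm (z - y))\<^sup>2 / 2"
      using F_lower[of x z] F_upper[of z y] by linarith
    also have "\<dots> \<le> F y + G y \<bullet> (z - y) + L * (norm (z - y))\<^sup>2 / 2"
      using L by (intro add_left_mono divide_right_mono mult_right_mono) auto
    also have "\<dots> = F y - (G y \<bullet> R) / L + (R \<bullet> R) / (2 * L)"
      using L by (simp add: z_def power_divide flip: power2_norm_eq_inner) (simp add: power2_eq_square field_simps)
    finally have "F x + G x \<bullet> (y - x) - (G x \<bullet> R) / L \<le> F y - (G y \<bullet> R) / L + (R \<bullet> R) / (2 * L)"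
      by (simp add: z_def inner_simps)
    moreover have "G y \<bullet> R = G x \<bullet> R + R \<bullet> R" by (simp add: R_def inner_simps)
    ultimately show ?thesis
      using L by (simp add: R_def[symmetric] power2_norm_eq_inner add_divide_distrib)
  qed
  have "R \<bullet> R \<le> L * (R \<bullet> (y - x))" if "0 < L" "M - m \<le> L" for L
  proof -
    have "(norm R)\<^sup>2 / (2 * L) + (norm R)\<^sup>2 / (2 * L) \<le> R \<bullet> (y - x)"
      using key[OF that, of x y] key[OF that, of y x]
      by (simp add: R_def inner_diff_left inner_diff_right norm_minus_commute)
    then show ?thesis using that by (simp add: power2_norm_eq_inner field_simps)
  qed
  \<comment> \<open>The argument divides by L, while the constant wanted is M - m, which is 0 when m
    = M. It is reached as the limit of larger L.\<close>
  then have "R \<bullet> R \<le> (M - m) * (R \<bullet> (y - x)) + e" if "0 < e" for e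
  proof -
    define t where "t = e / (\<bar>R \<bullet> (y - x)\<bar> + 1)"
    have t: "0 < t" "t * (R \<bullet> (y - x)) \<le> e"
    proof -
      show "0 < t" using that by (simp add: t_def add_nonneg_pos)
      have "t * (R \<bullet> (y - x)) \<le> t * (\<bar>R \<bullet> (y - x)\<bar> + 1)" using \<open>0 < t\<close> by (intro mult_left_mono) auto
      also have "\<dots> = e" by (simp add: t_def)
      finally show "t * (R \<bullet> (y - x)) \<le> e" .
    qed
    have "R \<bullet> R \<le> (M - m + t) * (R \<bullet> (y - x))"
      using t m_le_M by (intro \<open>\<And>L. 0 < L \<Longrightarrow> M - m \<le> L \<Longrightarrow> R \<bullet> R \<le> L * (R \<bullet> (y - x))\<close>) auto
    then show ?thesis using t by (simp add: algebra_simps)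
  qed
  then have "R \<bullet> R \<le> (M - m) * (R \<bullet> (y - x))" by (rule field_le_epsilon)
  moreover have "g y - g x - m *\<^sub>R (y - x) = R" "M *\<^sub>R (y - x) - (g y - g x) = (M - m) *\<^sub>R (y - x) - R"
    by (simp_all add: R_def G_def algebra_simps)
  ultimately show ?thesis by (simp add: inner_diff_right)
qed

text \<open>Bounds on a quadratic form alone do not control the norm of the linear map. Cocoercivity
  does: it makes g - m id Lipschitz with constant M - m, and the triangle inequality adds m
  back.\<close>

lemma g_lipschitz: "norm (g y - g x) \<le> M * norm (y - x)"
proof -
  define R where "R = g y - g x - m *\<^sub>R (y - x)"
  have "M *\<^sub>R (y - x) - (g y - g x) = (M - m) *\<^sub>R (y - x) - R"
    by (simp add: R_def algebra_simps)
  then have "R \<bullet> R \<le> (M - m) * (R \<bullet> (y - x))"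
    using g_cocoercive[of y x] by (simp add: R_def[symmetric] inner_diff_right)
  also have "\<dots> \<le> (M - m) * (norm R * norm (y - x))"
    using m_le_M by (intro mult_left_mono norm_cauchy_schwarz) auto
  finally have "norm R * norm R \<le> norm R * ((M - m) * norm (y - x))"
    by (simp add: dot_square_norm power2_eq_square mult_ac)
  then have "norm R \<le> (M - m) * norm (y - x)"
    using m_le_M by (cases "norm R = 0") (auto simp: mult_le_cancel_left)
  moreover have "norm (g y - g x) \<le> norm R + norm (m *\<^sub>R (y - x))"
    unfolding R_def by (metis add.commute diff_add_cancel norm_triangle_ineq)
  moreover have "norm (m *\<^sub>R (y - x)) = m * norm (y - x)" using m_pos by simp
  ultimately show ?thesis using left_diff_distrib[of M m "norm (y - x)"] by linarith
qed

lemma g_linear_growth: "norm (g x) \<le> norm (g 0) + M * norm x"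
  using g_lipschitz[of x 0] norm_triangle_ineq2[of "g x" "g 0"] by simp

section \<open>The trapezoidal rule along a segment\<close>

lemma abs_diff_half_le: "0 \<le> p \<Longrightarrow> p \<le> K / 2 \<Longrightarrow> 0 \<le> q \<Longrightarrow> q \<le> K \<Longrightarrow> \<bar>p - q / 2\<bar> \<le> K / 2"
  for p q K :: real
  by linarith

text \<open>The increment of f minus the trapezoidal value of the integral of g along the segment.
  It is the leading part of the energy error of a leapfrog step.\<close>

definition trapezoid_error :: "'a \<Rightarrow> 'a \<Rightarrow> real" where
  "trapezoid_error x d = f (x + d) - f x - (g x + g (x + d)) \<bullet> d / 2"

text \<open>The error is a difference of two quantities that both lie in [0, M |d|^2 / 2]: the
  Taylor remainder of f and half the increment of g along d. This uniform bound supplies the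
  domination; smallness comes from the next lemma.\<close>

lemma trapezoid_error_bound: "\<bar>trapezoid_error x d\<bar> \<le> M * (norm d)\<^sup>2 / 2"
proof -
  have "0 \<le> f (x + d) - f x - g x \<bullet> d" "f (x + d) - f x - g x \<bullet> d \<le> M * (norm d)\<^sup>2 / 2"
    using f_quadratic_bounds[where x=x and y="x + d"] m_pos by (auto intro: order_trans[rotated] simp: algebra_simps)
  moreover have "0 \<le> (g (x + d) - g x) \<bullet> d" "(g (x + d) - g x) \<bullet> d \<le> M * (norm d)\<^sup>2"
    using g_mono_line[where x=x and y="x + d"] m_pos by (auto intro: order_trans[rotated])
  ultimately show ?thesis
    using abs_diff_half_le[of "f (x + d) - f x - g x \<bullet> d" "M * (norm d)\<^sup>2" "(g (x + d) - g x) \<bullet> d"]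
    unfolding trapezoid_error_def by (simp add: inner_diff_left inner_add_left field_simps)
qed

text \<open>The Taylor remainder of f and half the increment of g along d both equal H d . d / 2 up
  to o(|d|^2). Differentiability of g at the single point x suffices, and \<delta> depends on
  x.\<close>

lemma trapezoid_error_small:
  assumes "0 < e"
  shows "\<exists>\<delta>>0. \<forall>d. norm d < \<delta> \<longrightarrow> \<bar>trapezoid_error x d\<bar> \<le> e * (norm d)\<^sup>2"
proof -
  obtain H where H: "(g has_derivative H) (at x)" using g_deriv by blast
  have lin: "linear H" using H has_derivative_linear by blast
  obtain \<delta> where \<delta>: "0 < \<delta>" "\<And>d. norm d < \<delta> \<Longrightarrow> norm (g (x + d) - g x - H d) \<le> e * norm d"
    using H[unfolded has_derivative_at_alt] assms by (metis add_diff_cancel_left')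
  have "\<bar>trapezoid_error x d\<bar> \<le> e * (norm d)\<^sup>2" if d: "norm d < \<delta>" for d
  proof -
    have b: "\<bar>(g (x + t *\<^sub>R d) - g x - t *\<^sub>R H d) \<bullet> d\<bar> \<le> e * (norm d)\<^sup>2 * t" if "0 \<le> t" "t \<le> 1" for t
    proof -
      have "norm (t *\<^sub>R d) < \<delta>" using that d mult_left_le_one_le[of "norm d" t] by simp
      then have "norm (g (x + t *\<^sub>R d) - g x - t *\<^sub>R H d) \<le> e * norm (t *\<^sub>R d)"
        using \<delta>(2)[of "t *\<^sub>R d"] lin by (simp add: linear_cmul)
      then have "norm (g (x + t *\<^sub>R d) - g x - t *\<^sub>R H d) * norm d \<le> e * norm (t *\<^sub>R d) * norm d"
        by (rule mult_right_mono) simp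
      then show ?thesis
        using Cauchy_Schwarz_ineq2[of "g (x + t *\<^sub>R d) - g x - t *\<^sub>R H d" d] that
        by (simp add: power2_eq_square mult_ac)
    qed
    have der: "((\<lambda>t. f (x + t *\<^sub>R d) - t * (g x \<bullet> d) - t\<^sup>2 / 2 * (H d \<bullet> d) + c * t\<^sup>2 / 2) has_real_derivative
      (g (x + t *\<^sub>R d) - g x - t *\<^sub>R H d) \<bullet> d + c * t) (at t)" for t c
      by (auto intro!: derivative_eq_intros f_deriv_line simp: inner_simps field_simps)
    let ?c = "e * (norm d)\<^sup>2"
    let ?F = "\<lambda>c t. f (x + t *\<^sub>R d) - t * (g x \<bullet> d) - t\<^sup>2 / 2 * (H d \<bullet> d) + c * t\<^sup>2 / 2"
    have 1: "?F ?c 0 \<le> ?F ?c 1"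
      using der[of ?c] b by (intro DERIV_nonneg_imp_nondecreasing[OF zero_le_one]) (smt (verit))
    have 2: "?F (-?c) 1 \<le> ?F (-?c) 0"
      using der[of "-?c"] b by (intro DERIV_nonpos_imp_nonincreasing[OF zero_le_one]) (smt (verit) mult_minus_left)
    define R where "R = f (x + d) - f x - g x \<bullet> d - (H d \<bullet> d) / 2"
    have "- (?c / 2) \<le> R" using 1 by (simp add: R_def algebra_simps)
    moreover have "R \<le> ?c / 2" using 2 by (simp add: R_def algebra_simps)
    ultimately have "\<bar>R\<bar> \<le> ?c / 2" by (simp only: abs_le_iff minus_le_iff)
    then show ?thesis
      using b[of 1] unfolding trapezoid_error_def R_def abs_le_iff by (simp add: inner_simps) argo
  qed
  then show ?thesis using \<delta>(1) by blast
qed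

end

section \<open>Gaussian measures\<close>

definition gaussian_density :: "'a::euclidean_space \<Rightarrow> real" where
  "gaussian_density x = (\<Prod>b\<in>Basis. std_normal_density (x \<bullet> b))"

text \<open>Kept over an arbitrary Euclidean space so that the same lemmas serve the scalar noise
  components, the velocity and \<open>std_gaussian\<close>.\<close>

definition gaussian :: "'a::euclidean_space measure" where
  "gaussian = density lborel (\<lambda>x. ennreal (gaussian_density x))"

lemma sets_gaussian [simp, measurable_cong]: "sets gaussian = sets borel"
  by (simp add: gaussian_def)

lemma space_gaussian [simp]: "space gaussian = UNIV"
  by (simp add: gaussian_def)

lemma borel_measurable_gaussian_density [measurable]: "gaussian_density \<in> borel_measurable borel"
  unfolding gaussian_density_def by measurable

lemma gaussian_density_eq:
  "gaussian_density (x::'a::euclidean_space) = (1 / sqrt (2 * pi)) ^ DIM('a) * exp (- (norm x)\<^sup>2 / 2)"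
proof -
  have "(norm x)\<^sup>2 = (\<Sum>b\<in>Basis. (x \<bullet> b)\<^sup>2)"
    unfolding power2_norm_eq_inner by (subst euclidean_inner) (simp add: power2_eq_square)
  then have "exp (- (norm x)\<^sup>2 / 2) = (\<Prod>b\<in>Basis. exp (- (x \<bullet> b)\<^sup>2 / 2))"
    by (simp add: exp_sum[symmetric] sum_divide_distrib sum_negf)
  then show ?thesis
    unfolding gaussian_density_def std_normal_density_def by (simp only: prod.distrib prod_constant)
qed

lemma gaussian_density_pos: "0 < gaussian_density x"
  by (auto simp: gaussian_density_def intro!: prod_pos normal_density_pos)

lemma gaussian_density_nonneg [simp]: "0 \<le> gaussian_density x"
  using gaussian_density_pos[of x] by simp

lemma gaussian_density_mult:
  fixes x y :: "'a::euclidean_space"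
  shows "gaussian_density x * gaussian_density y
    = ((1 / sqrt (2 * pi)) ^ DIM('a))\<^sup>2 * exp (- ((norm x)\<^sup>2 + (norm y)\<^sup>2) / 2)"
  unfolding gaussian_density_eq
  by (simp add: exp_add[symmetric] power2_eq_square add_divide_distrib diff_divide_distrib)

lemma gaussian_real: "gaussian = (std_normal_distribution :: real measure)"
  by (simp add: gaussian_def gaussian_density_def)

lemma nn_integral_gaussian:
  "F \<in> borel_measurable borel \<Longrightarrow> (\<integral>\<^sup>+x. F x \<partial>gaussian) = (\<integral>\<^sup>+x. ennreal (gaussian_density x) * F x \<partial>lborel)"
  unfolding gaussian_def by (rule nn_integral_density) auto

lemma nn_integral_gaussian_prod:
  fixes f :: "'a::euclidean_space \<Rightarrow> real \<Rightarrow> ennreal"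
  assumes [measurable]: "\<And>b. b \<in> Basis \<Longrightarrow> f b \<in> borel_measurable borel"
  shows "(\<integral>\<^sup>+x. (\<Prod>b\<in>Basis. f b (x \<bullet> b)) \<partial>gaussian) = (\<Prod>b\<in>Basis. \<integral>\<^sup>+x. f b x \<partial>gaussian)"
proof -
  have "(\<integral>\<^sup>+x. (\<Prod>b\<in>Basis. f b (x \<bullet> b)) \<partial>gaussian)
    = (\<integral>\<^sup>+x. ennreal (gaussian_density x) * (\<Prod>b\<in>Basis. f b (x \<bullet> b)) \<partial>lborel)"
    by (rule nn_integral_gaussian) (auto intro!: borel_measurable_prod_ennreal)
  also have "\<dots> = (\<integral>\<^sup>+x. (\<Prod>b\<in>Basis. ennreal (std_normal_density (x \<bullet> b)) * f b (x \<bullet> b)) \<partial>lborel)"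
    by (simp add: gaussian_density_def prod.distrib prod_ennreal)
  also have "\<dots> = (\<Prod>b\<in>Basis. \<integral>\<^sup>+x. ennreal (std_normal_density x) * f b x \<partial>lborel)"
    by (rule nn_integral_lborel_prod) auto
  also have "\<dots> = (\<Prod>b\<in>Basis. \<integral>\<^sup>+x. f b x \<partial>gaussian)"
    by (intro prod.cong refl) (simp add: gaussian_real nn_integral_density)
  finally show ?thesis .
qed

lemma prob_space_gaussian: "prob_space (gaussian :: 'a::euclidean_space measure)"
proof
  have "emeasure (gaussian :: 'a measure) UNIV = (\<integral>\<^sup>+(x::'a). (\<Prod>b\<in>(Basis::'a set). 1) \<partial>gaussian)"
    by simp
  also have "\<dots> = (\<Prod>b\<in>(Basis::'a set). \<integral>\<^sup>+x. 1 \<partial>(gaussian :: real measure))"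
    by (subst nn_integral_gaussian_prod[where f="\<lambda>_ _. 1"]) auto
  also have "\<dots> = 1"
    using prob_space.emeasure_space_1[OF prob_space_normal_density[of 1 0]] by (simp add: gaussian_real)
  finally show "emeasure (gaussian :: 'a measure) (space gaussian) = 1" by simp
qed

interpretation gaussian: prob_space "gaussian :: 'a::euclidean_space measure"
  by (rule prob_space_gaussian)

interpretation gaussian2: pair_prob_space "gaussian :: 'a::euclidean_space measure" "gaussian :: 'b::euclidean_space measure" ..

lemma nn_integral_gaussian_component:
  fixes b :: "'a::euclidean_space"
  assumes [measurable]: "F \<in> borel_measurable borel" and b: "b \<in> Basis"
  shows "(\<integral>\<^sup>+x. F (x \<bullet> b) \<partial>gaussian) = (\<integral>\<^sup>+x. F x \<partial>gaussian)"
proof -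
  have "(\<Prod>c\<in>Basis. (if c = b then F else (\<lambda>_. 1)) (x \<bullet> c)) = F (x \<bullet> b)" for x :: 'a
    using b by (subst prod.remove[OF finite_Basis b]) (simp add: prod.neutral)
  then have "(\<integral>\<^sup>+x. F (x \<bullet> b) \<partial>gaussian) = (\<Prod>c\<in>Basis. \<integral>\<^sup>+x. (if c = b then F else (\<lambda>_. 1)) x \<partial>gaussian)"
    by (subst nn_integral_gaussian_prod[symmetric]) auto
  also have "\<dots> = (\<integral>\<^sup>+x. F x \<partial>gaussian)"
    using b gaussian.emeasure_space_1[where 'a=real] by (subst prod.remove[OF finite_Basis b]) (simp add: prod.neutral)
  finally show ?thesis .
qed

lemma nn_integral_gaussian_real_even_moment:
  "(\<integral>\<^sup>+(x::real). ennreal (x ^ (2 * k)) \<partial>gaussian) = ennreal (fact (2 * k) / (2 ^ k * fact k))"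
proof -
  have "(\<integral>\<^sup>+(x::real). ennreal (x ^ (2 * k)) \<partial>gaussian) = (\<integral>\<^sup>+x. ennreal (std_normal_density x * x ^ (2 * k)) \<partial>lborel)"
    by (simp add: gaussian_real nn_integral_density ennreal_mult power_mult)
  also have "\<dots> = ennreal (fact (2 * k) / (2 ^ k * fact k))"
    using std_normal_moment_even[of k]
    by (subst nn_integral_eq_integral) (auto simp: has_bochner_integral_iff power_mult)
  finally show ?thesis .
qed

lemma norm_sq_Basis: "(norm (x::'a::euclidean_space))\<^sup>2 = (\<Sum>b\<in>Basis. (x \<bullet> b)\<^sup>2)"
  unfolding power2_norm_eq_inner by (subst euclidean_inner) (simp add: power2_eq_square)

lemma gaussian_second_moment:
  "(\<integral>\<^sup>+(x::'a::euclidean_space). ennreal ((norm x)\<^sup>2) \<partial>gaussian) = ennreal (DIM('a))"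
proof -
  have "(\<integral>\<^sup>+(x::'a). ennreal ((norm x)\<^sup>2) \<partial>gaussian) = (\<Sum>b\<in>(Basis::'a set). \<integral>\<^sup>+x. ennreal ((x \<bullet> b)\<^sup>2) \<partial>gaussian)"
    by (subst nn_integral_sum[symmetric]) (auto simp: norm_sq_Basis sum_ennreal)
  also have "\<dots> = (\<Sum>b\<in>(Basis::'a set). 1)"
    using nn_integral_gaussian_component[of "\<lambda>x. ennreal (x\<^sup>2)"] nn_integral_gaussian_real_even_moment[of 1]
    by (intro sum.cong refl) (simp add: fact_numeral)
  finally show ?thesis by (simp add: ennreal_of_nat_eq_real_of_nat)
qed

lemma gaussian_fourth_moment:
  "(\<integral>\<^sup>+(x::'a::euclidean_space). ennreal ((norm x)^4) \<partial>gaussian) < \<infinity>"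
proof -
  have le: "(norm x)^4 \<le> (\<Sum>b\<in>Basis. (x \<bullet> b)^4) * DIM('a)" for x :: 'a
  proof -
    have "(norm x)^4 = ((norm x)\<^sup>2)\<^sup>2" by simp
    also have "\<dots> \<le> (\<Sum>b\<in>Basis. ((x \<bullet> b)\<^sup>2)\<^sup>2) * DIM('a)"
      unfolding norm_sq_Basis by (rule sum_squared_le_sum_of_squares)
    finally show ?thesis by simp
  qed
  have "(\<integral>\<^sup>+(x::'a). ennreal ((norm x)^4) \<partial>gaussian) \<le> (\<integral>\<^sup>+(x::'a). (\<Sum>b\<in>Basis. ennreal ((x \<bullet> b)^4)) * ennreal (DIM('a)) \<partial>gaussian)"
    using le by (intro nn_integral_mono) (subst sum_ennreal, auto simp: ennreal_mult''[symmetric] sum_nonneg)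
  also have "\<dots> = (\<Sum>b\<in>(Basis::'a set). \<integral>\<^sup>+x. ennreal ((x \<bullet> b)^4) \<partial>gaussian) * ennreal (DIM('a))"
    by (subst nn_integral_multc) (auto simp: nn_integral_sum simp del: sum_ennreal)
  also have "\<dots> = (\<Sum>b\<in>(Basis::'a set). ennreal (fact 4 / (2 ^ 2 * fact 2))) * ennreal (DIM('a))"
    using nn_integral_gaussian_component[of "\<lambda>x. ennreal (x^4)"] nn_integral_gaussian_real_even_moment[of 2]
    by (intro arg_cong2[where f="(*)"] sum.cong refl) simp
  also have "\<dots> < \<infinity>" by (simp add: ennreal_mult_less_top of_nat_less_top)
  finally show ?thesis .
qed

section \<open>Invariance of Lebesgue and Gaussian integrals under shears and rotations\<close>

lemma nn_integral_lborel_shift: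
  fixes c :: "'a::euclidean_space"
  assumes [measurable]: "F \<in> borel_measurable borel"
  shows "(\<integral>\<^sup>+y. F (y + c) \<partial>lborel) = (\<integral>\<^sup>+y. F y \<partial>lborel)"
proof -
  have "(\<integral>\<^sup>+y. F y \<partial>lborel) = (\<integral>\<^sup>+y. F y \<partial>(distr lborel borel ((+) c)))"
    by (simp add: lborel_distr_plus)
  also have "\<dots> = (\<integral>\<^sup>+y. F (y + c) \<partial>lborel)"
    by (subst nn_integral_distr) (auto simp: add.commute)
  finally show ?thesis by simp
qed

lemma nn_integral_lborel_swap:
  fixes F :: "'a::euclidean_space \<Rightarrow> 'b::euclidean_space \<Rightarrow> ennreal"
  assumes "case_prod F \<in> borel_measurable (borel \<Otimes>\<^sub>M borel)"
  shows "(\<integral>\<^sup>+x. \<integral>\<^sup>+y. F x y \<partial>lborel \<partial>lborel) = (\<integral>\<^sup>+y. \<integral>\<^sup>+x. F x y \<partial>lborel \<partial>lborel)"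
  using assms by (intro lborel_pair.Fubini'[symmetric]) (simp cong: measurable_cong_sets)

text \<open>A plane rotation is a product of three shears, each of which preserves Lebesgue measure by Fubini
  and translation invariance.\<close>

lemma nn_integral_lborel_rotation:
  fixes F :: "'a::euclidean_space \<times> 'a \<Rightarrow> ennreal"
  assumes F [measurable]: "F \<in> borel_measurable (borel \<Otimes>\<^sub>M borel)" and cs: "c\<^sup>2 + s\<^sup>2 = 1" "s \<noteq> 0"
  shows "(\<integral>\<^sup>+x. \<integral>\<^sup>+y. F (c *\<^sub>R x + s *\<^sub>R y, c *\<^sub>R y - s *\<^sub>R x) \<partial>lborel \<partial>lborel) = (\<integral>\<^sup>+x. \<integral>\<^sup>+y. F (x, y) \<partial>lborel \<partial>lborel)"
proof -
  \<comment> \<open>The tangent of half the angle: a rotation is the shear by \<alpha>, then the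
    shear by -s in the other variable, then the shear by \<alpha> again.\<close>
  define \<alpha> where "\<alpha> = (1 - c) / s"
  have \<alpha>s: "\<alpha> * s = 1 - c" using cs by (simp add: \<alpha>_def)
  have \<alpha>c: "\<alpha> * (1 + c) = s" using cs by (simp add: \<alpha>_def field_simps power2_eq_square)
  have id: "c *\<^sub>R x + s *\<^sub>R y = (x + \<alpha> *\<^sub>R y) + \<alpha> *\<^sub>R (y + (- s) *\<^sub>R (x + \<alpha> *\<^sub>R y))"
    "c *\<^sub>R y - s *\<^sub>R x = y + (- s) *\<^sub>R (x + \<alpha> *\<^sub>R y)" for x y :: 'a
  proof -
    have 1: "y + (- s) *\<^sub>R (x + \<alpha> *\<^sub>R y) = (1 - \<alpha> * s) *\<^sub>R y - s *\<^sub>R x"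
      by (simp add: algebra_simps)
    then show 2: "c *\<^sub>R y - s *\<^sub>R x = y + (- s) *\<^sub>R (x + \<alpha> *\<^sub>R y)" by (simp add: \<alpha>s)
    have "(x + \<alpha> *\<^sub>R y) + \<alpha> *\<^sub>R (c *\<^sub>R y - s *\<^sub>R x) = (1 - \<alpha> * s) *\<^sub>R x + (\<alpha> * (1 + c)) *\<^sub>R y"
      by (simp add: algebra_simps)
    then show "c *\<^sub>R x + s *\<^sub>R y = (x + \<alpha> *\<^sub>R y) + \<alpha> *\<^sub>R (y + (- s) *\<^sub>R (x + \<alpha> *\<^sub>R y))"
      unfolding 2[symmetric] by (simp add: \<alpha>s \<alpha>c)
  qed
  have "(\<integral>\<^sup>+x. \<integral>\<^sup>+y. F (c *\<^sub>R x + s *\<^sub>R y, c *\<^sub>R y - s *\<^sub>R x) \<partial>lborel \<partial>lborel)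
    = (\<integral>\<^sup>+y. \<integral>\<^sup>+x. F ((x + \<alpha> *\<^sub>R y) + \<alpha> *\<^sub>R (y + (- s) *\<^sub>R (x + \<alpha> *\<^sub>R y)), y + (- s) *\<^sub>R (x + \<alpha> *\<^sub>R y)) \<partial>lborel \<partial>lborel)"
    unfolding id by (rule nn_integral_lborel_swap) measurable
  also have "\<dots> = (\<integral>\<^sup>+y. \<integral>\<^sup>+x. F (x + \<alpha> *\<^sub>R (y + (- s) *\<^sub>R x), y + (- s) *\<^sub>R x) \<partial>lborel \<partial>lborel)"
    by (rule nn_integral_cong, rule nn_integral_lborel_shift[where F="\<lambda>x. F (x + \<alpha> *\<^sub>R (y + (- s) *\<^sub>R x), y + (- s) *\<^sub>R x)" for y]) measurable
  also have "\<dots> = (\<integral>\<^sup>+x. \<integral>\<^sup>+y. F (x + \<alpha> *\<^sub>R (y + (- s) *\<^sub>R x), y + (- s) *\<^sub>R x) \<partial>lborel \<partial>lborel)"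
    by (rule nn_integral_lborel_swap) measurable
  also have "\<dots> = (\<integral>\<^sup>+x. \<integral>\<^sup>+y. F (x + \<alpha> *\<^sub>R y, y) \<partial>lborel \<partial>lborel)"
    by (rule nn_integral_cong, rule nn_integral_lborel_shift[where F="\<lambda>y. F (x + \<alpha> *\<^sub>R y, y)" for x]) measurable
  also have "\<dots> = (\<integral>\<^sup>+y. \<integral>\<^sup>+x. F (x + \<alpha> *\<^sub>R y, y) \<partial>lborel \<partial>lborel)"
    by (rule nn_integral_lborel_swap) measurable
  also have "\<dots> = (\<integral>\<^sup>+y. \<integral>\<^sup>+x. F (x, y) \<partial>lborel \<partial>lborel)"
    by (rule nn_integral_cong, rule nn_integral_lborel_shift[where F="\<lambda>x. F (x, y)" for y]) measurable
  also have "\<dots> = (\<integral>\<^sup>+x. \<integral>\<^sup>+y. F (x, y) \<partial>lborel \<partial>lborel)"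
    by (rule nn_integral_lborel_swap) measurable
  finally show ?thesis .
qed

lemma nn_integral_gaussian2:
  fixes F :: "'a::euclidean_space \<times> 'b::euclidean_space \<Rightarrow> ennreal"
  assumes [measurable]: "F \<in> borel_measurable (borel \<Otimes>\<^sub>M borel)"
  shows "(\<integral>\<^sup>+x. \<integral>\<^sup>+y. F (x, y) \<partial>gaussian \<partial>gaussian)
    = (\<integral>\<^sup>+x. \<integral>\<^sup>+y. ennreal (gaussian_density x * gaussian_density y) * F (x, y) \<partial>lborel \<partial>lborel)"
proof -
  have "(\<integral>\<^sup>+x. \<integral>\<^sup>+y. F (x, y) \<partial>gaussian \<partial>gaussian)
    = (\<integral>\<^sup>+x. ennreal (gaussian_density x) * (\<integral>\<^sup>+y. ennreal (gaussian_density y) * F (x, y) \<partial>lborel) \<partial>lborel)"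
    by (subst nn_integral_gaussian, measurable) (simp add: nn_integral_gaussian)
  also have "\<dots> = (\<integral>\<^sup>+x. \<integral>\<^sup>+y. ennreal (gaussian_density x * gaussian_density y) * F (x, y) \<partial>lborel \<partial>lborel)"
    by (subst nn_integral_cmult[symmetric]) (auto simp: ennreal_mult mult.assoc)
  finally show ?thesis .
qed

lemma nn_integral_gaussian_rotation:
  fixes F :: "'a::euclidean_space \<times> 'a \<Rightarrow> ennreal"
  assumes F [measurable]: "F \<in> borel_measurable (borel \<Otimes>\<^sub>M borel)" and cs: "c\<^sup>2 + s\<^sup>2 = 1"
  shows "(\<integral>\<^sup>+x. \<integral>\<^sup>+y. F (c *\<^sub>R x + s *\<^sub>R y, c *\<^sub>R y - s *\<^sub>R x) \<partial>gaussian \<partial>gaussian) = (\<integral>\<^sup>+x. \<integral>\<^sup>+y. F (x, y) \<partial>gaussian \<partial>gaussian)"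
proof -
  have *: "(\<integral>\<^sup>+x. \<integral>\<^sup>+y. F (c *\<^sub>R x + s *\<^sub>R y, c *\<^sub>R y - s *\<^sub>R x) \<partial>gaussian \<partial>gaussian) = (\<integral>\<^sup>+x. \<integral>\<^sup>+y. F (x, y) \<partial>gaussian \<partial>gaussian)"
    if cs: "c\<^sup>2 + s\<^sup>2 = 1" and s: "s \<noteq> 0" and [measurable]: "F \<in> borel_measurable (borel \<Otimes>\<^sub>M borel)"
    for c s and F :: "'a \<times> 'a \<Rightarrow> ennreal"
  proof -
    have "(norm (c *\<^sub>R x + s *\<^sub>R y))\<^sup>2 + (norm (c *\<^sub>R y - s *\<^sub>R x))\<^sup>2 = (c\<^sup>2 + s\<^sup>2) * ((norm x)\<^sup>2 + (norm y)\<^sup>2)" for x y :: 'a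
      unfolding power2_norm_eq_inner by (simp add: inner_simps inner_commute power2_eq_square algebra_simps)
    then have "gaussian_density (c *\<^sub>R x + s *\<^sub>R y) * gaussian_density (c *\<^sub>R y - s *\<^sub>R x) = gaussian_density x * gaussian_density y" for x y :: 'a
      unfolding gaussian_density_mult using cs by simp
    then show ?thesis
      using nn_integral_lborel_rotation[OF _ cs s, of "\<lambda>(x, y). ennreal (gaussian_density x * gaussian_density y) * F (x, y)"]
      by (simp add: nn_integral_gaussian2 nn_integral_gaussian2[of "\<lambda>(x, y). F (c *\<^sub>R x + s *\<^sub>R y, c *\<^sub>R y - s *\<^sub>R x)", simplified])
  qed
  show ?thesis
  proof (cases "s = 0")
    case False
    then show ?thesis using *[OF cs] F by simp
  next
    \<comment> \<open>The shears need division by s. For s = 0 and c = -1 the rotation is minus the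
      identity, that is, two quarter turns (c, s) = (0, 1).\<close>
    case True
    then have "c = 1 \<or> c = -1" using cs by (simp add: power2_eq_1_iff)
    then show ?thesis
      using *[of 0 1 F] *[of 0 1 "\<lambda>(x, y). F (y, -x)"] True F by auto
  qed
qed

text \<open>An LQ factorization: rotating the row (p, q) onto the first axis makes the coefficient
  matrix lower triangular, and the Gaussian does not see the rotation.\<close>

lemma nn_integral_gaussian_linear:
  fixes F :: "'a::euclidean_space \<times> 'a \<Rightarrow> ennreal"
  assumes F [measurable]: "F \<in> borel_measurable (borel \<Otimes>\<^sub>M borel)" and r: "0 < r" "r\<^sup>2 = p\<^sup>2 + q\<^sup>2"
  shows "(\<integral>\<^sup>+x. \<integral>\<^sup>+y. F (p *\<^sub>R x + q *\<^sub>R y, u *\<^sub>R x + t *\<^sub>R y) \<partial>gaussian \<partial>gaussian)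
    = (\<integral>\<^sup>+x. \<integral>\<^sup>+y. F (r *\<^sub>R x, ((p*u + q*t)/r) *\<^sub>R x + ((p*t - q*u)/r) *\<^sub>R y) \<partial>gaussian \<partial>gaussian)"
proof -
  define b \<delta> where "b = (p*u + q*t)/r" and "\<delta> = (p*t - q*u)/r"
  have cs: "(p/r)\<^sup>2 + (q/r)\<^sup>2 = 1"
    using r(1) by (simp add: power_divide add_divide_distrib[symmetric] r(2)[symmetric])
  have r2: "(p/r) * b - (q/r) * \<delta> = u" "(q/r) * b + (p/r) * \<delta> = t"
  proof -
    have "(p/r) * b - (q/r) * \<delta> = u * ((p/r)\<^sup>2 + (q/r)\<^sup>2)" "(q/r) * b + (p/r) * \<delta> = t * ((p/r)\<^sup>2 + (q/r)\<^sup>2)"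
      using r(1) by (simp_all add: b_def \<delta>_def power2_eq_square field_simps)
    then show "(p/r) * b - (q/r) * \<delta> = u" "(q/r) * b + (p/r) * \<delta> = t" unfolding cs by auto
  qed
  have 1: "u *\<^sub>R x + t *\<^sub>R y = b *\<^sub>R ((p/r) *\<^sub>R x + (q/r) *\<^sub>R y) + \<delta> *\<^sub>R ((p/r) *\<^sub>R y - (q/r) *\<^sub>R x)" for x y :: 'a
    unfolding r2[symmetric] by (simp only: scaleR_add_right scaleR_diff_right scaleR_add_left scaleR_diff_left scaleR_scaleR) (simp add: mult.commute)
  have 2: "p *\<^sub>R x + q *\<^sub>R y = r *\<^sub>R ((p/r) *\<^sub>R x + (q/r) *\<^sub>R y)" for x y :: 'a
    using r(1) by (simp add: scaleR_add_right)
  show ?thesis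
    using nn_integral_gaussian_rotation[OF _ cs, of "\<lambda>(x, y). F (r *\<^sub>R x, b *\<^sub>R x + \<delta> *\<^sub>R y)"]
    unfolding b_def[symmetric] \<delta>_def[symmetric] 1 2 prod.case by measurable
qed

lemma nn_integral_gaussian_add:
  fixes H :: "'a::euclidean_space \<Rightarrow> ennreal"
  assumes H [measurable]: "H \<in> borel_measurable borel" and r: "0 \<le> r" "r\<^sup>2 = p\<^sup>2 + q\<^sup>2"
  shows "(\<integral>\<^sup>+x. \<integral>\<^sup>+y. H (p *\<^sub>R x + q *\<^sub>R y) \<partial>gaussian \<partial>gaussian) = (\<integral>\<^sup>+x. H (r *\<^sub>R x) \<partial>gaussian)"
proof (cases "r = 0")
  case True
  then have "p = 0" "q = 0" using r by (auto simp: sum_power2_eq_zero_iff)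
  then show ?thesis using True gaussian.emeasure_space_1[where 'a='a] by simp
next
  case False
  then show ?thesis
    using nn_integral_gaussian_linear[of "\<lambda>(x, y). H x" r p q 0 0] r gaussian.emeasure_space_1[where 'a='a] by simp
qed

lemma nn_integral_gaussian_abs_scale:
  fixes H :: "'a::euclidean_space \<Rightarrow> ennreal"
  assumes H: "H \<in> borel_measurable borel" and r: "0 \<le> r" "r\<^sup>2 = p\<^sup>2"
  shows "(\<integral>\<^sup>+x. H (p *\<^sub>R x) \<partial>gaussian) = (\<integral>\<^sup>+x. H (r *\<^sub>R x) \<partial>gaussian)"
  using nn_integral_gaussian_add[OF H r(1), of p 0] r gaussian.emeasure_space_1[where 'a='a] by simp

text \<open>The parameters are the entries of the Cholesky factor of the covariance matrix.\<close>

definition gaussian_pair :: "real \<Rightarrow> real \<Rightarrow> real \<Rightarrow> ('a::euclidean_space \<times> 'a) measure" where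
  "gaussian_pair a b s = distr (gaussian \<Otimes>\<^sub>M gaussian) (borel \<Otimes>\<^sub>M borel) (\<lambda>(z, w). (a *\<^sub>R z, b *\<^sub>R z + s *\<^sub>R w))"

lemma sets_gaussian_pair [simp, measurable_cong]: "sets (gaussian_pair a b s) = sets (borel \<Otimes>\<^sub>M borel)"
  by (simp add: gaussian_pair_def)

lemma prob_space_gaussian_pair: "prob_space (gaussian_pair a b s)"
  unfolding gaussian_pair_def by (rule gaussian2.prob_space_distr) measurable

interpretation gaussian_pair: prob_space "gaussian_pair a b s"
  by (rule prob_space_gaussian_pair)

lemma nn_integral_gaussian_pair:
  assumes [measurable]: "F \<in> borel_measurable (borel \<Otimes>\<^sub>M borel)"
  shows "(\<integral>\<^sup>+n. F n \<partial>gaussian_pair a b s) = (\<integral>\<^sup>+z. \<integral>\<^sup>+w. F (a *\<^sub>R z, b *\<^sub>R z + s *\<^sub>R w) \<partial>gaussian \<partial>gaussian)"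
proof -
  have "(\<integral>\<^sup>+n. F n \<partial>gaussian_pair a b s)
    = (\<integral>\<^sup>+p. F (case p of (z, w) \<Rightarrow> (a *\<^sub>R z, b *\<^sub>R z + s *\<^sub>R w)) \<partial>(gaussian \<Otimes>\<^sub>M gaussian))"
    unfolding gaussian_pair_def by (rule nn_integral_distr) measurable
  also have "\<dots> = (\<integral>\<^sup>+z. \<integral>\<^sup>+w. F (case (z, w) of (z, w) \<Rightarrow> (a *\<^sub>R z, b *\<^sub>R z + s *\<^sub>R w)) \<partial>gaussian \<partial>gaussian)"
    by (rule gaussian.nn_integral_fst[symmetric]) measurable
  finally show ?thesis by simp
qed

lemma nn_integral_gaussian_swap:
  fixes F :: "'a::euclidean_space \<Rightarrow> 'b::euclidean_space \<Rightarrow> ennreal"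
  assumes "case_prod F \<in> borel_measurable (borel \<Otimes>\<^sub>M borel)"
  shows "(\<integral>\<^sup>+x. \<integral>\<^sup>+y. F x y \<partial>gaussian \<partial>gaussian) = (\<integral>\<^sup>+y. \<integral>\<^sup>+x. F x y \<partial>gaussian \<partial>gaussian)"
  using assms by (intro gaussian2.Fubini'[symmetric]) (simp cong: measurable_cong_sets)

text \<open>The hypotheses say that the covariance matrices add.\<close>

lemma nn_integral_gaussian_pair_add:
  fixes F :: "'a::euclidean_space \<times> 'a \<Rightarrow> ennreal"
  assumes F [measurable]: "F \<in> borel_measurable (borel \<Otimes>\<^sub>M borel)"
    and a: "0 < a" "a\<^sup>2 = a1\<^sup>2 + a2\<^sup>2" and b: "a * b = a1 * b1 + a2 * b2"
    and s: "0 \<le> s" "b\<^sup>2 + s\<^sup>2 = b1\<^sup>2 + s1\<^sup>2 + b2\<^sup>2 + s2\<^sup>2"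
  shows "(\<integral>\<^sup>+n. \<integral>\<^sup>+n'. F (fst n + fst n', snd n + snd n') \<partial>gaussian_pair a2 b2 s2 \<partial>gaussian_pair a1 b1 s1)
    = (\<integral>\<^sup>+n. F n \<partial>gaussian_pair a b s)"
proof -
  define \<sigma> where "\<sigma> = sqrt (s1\<^sup>2 + s2\<^sup>2)"
  have \<sigma>: "0 \<le> \<sigma>" "\<sigma>\<^sup>2 = s1\<^sup>2 + s2\<^sup>2" by (simp_all add: \<sigma>_def)
  \<comment> \<open>The component of (b1, b2) orthogonal to (a1, a2). After the two first variables
    are rotated, it multiplies the leftover variable, which then merges with the independent part
    \<sigma> into s.\<close>
  define \<delta> where "\<delta> = (a1 * b2 - a2 * b1) / a"
  have b': "(a1 * b1 + a2 * b2) / a = b" using a b by (simp add: field_simps)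
  have \<delta>: "b\<^sup>2 + \<delta>\<^sup>2 = b1\<^sup>2 + b2\<^sup>2"
  proof -
    have "(a1 * b1 + a2 * b2)\<^sup>2 + (a1 * b2 - a2 * b1)\<^sup>2 = (a1\<^sup>2 + a2\<^sup>2) * (b1\<^sup>2 + b2\<^sup>2)"
      by (simp add: power2_eq_square algebra_simps)
    then show ?thesis
      using a(1) unfolding b'[symmetric] \<delta>_def power_divide add_divide_distrib[symmetric] a(2)[symmetric] by simp
  qed
  let ?G = "gaussian :: 'a measure"
  have "(\<integral>\<^sup>+n. \<integral>\<^sup>+n'. F (fst n + fst n', snd n + snd n') \<partial>gaussian_pair a2 b2 s2 \<partial>gaussian_pair a1 b1 s1)
    = (\<integral>\<^sup>+z1. \<integral>\<^sup>+w1. \<integral>\<^sup>+z2. \<integral>\<^sup>+w2. F (a1 *\<^sub>R z1 + a2 *\<^sub>R z2, (b1 *\<^sub>R z1 + s1 *\<^sub>R w1) + (b2 *\<^sub>R z2 + s2 *\<^sub>R w2)) \<partial>?G \<partial>?G \<partial>?G \<partial>?G)"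
  proof -
    have "(\<integral>\<^sup>+n'. F (fst n + fst n', snd n + snd n') \<partial>gaussian_pair a2 b2 s2)
      = (\<integral>\<^sup>+z2. \<integral>\<^sup>+w2. F (fst n + a2 *\<^sub>R z2, snd n + (b2 *\<^sub>R z2 + s2 *\<^sub>R w2)) \<partial>?G \<partial>?G)" for n
      using nn_integral_gaussian_pair[of "\<lambda>n'. F (fst n + fst n', snd n + snd n')" a2 b2 s2] by simp
    then show ?thesis
      using nn_integral_gaussian_pair[of "\<lambda>n. \<integral>\<^sup>+z2. \<integral>\<^sup>+w2. F (fst n + a2 *\<^sub>R z2, snd n + (b2 *\<^sub>R z2 + s2 *\<^sub>R w2)) \<partial>?G \<partial>?G" a1 b1 s1]
      by simp
  qed
  also have "\<dots> = (\<integral>\<^sup>+z1. \<integral>\<^sup>+z2. \<integral>\<^sup>+w1. \<integral>\<^sup>+w2. F (a1 *\<^sub>R z1 + a2 *\<^sub>R z2, (b1 *\<^sub>R z1 + b2 *\<^sub>R z2) + (s1 *\<^sub>R w1 + s2 *\<^sub>R w2)) \<partial>?G \<partial>?G \<partial>?G \<partial>?G)"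
  proof (rule nn_integral_cong)
    fix z1 :: 'a
    show "(\<integral>\<^sup>+w1. \<integral>\<^sup>+z2. \<integral>\<^sup>+w2. F (a1 *\<^sub>R z1 + a2 *\<^sub>R z2, (b1 *\<^sub>R z1 + s1 *\<^sub>R w1) + (b2 *\<^sub>R z2 + s2 *\<^sub>R w2)) \<partial>?G \<partial>?G \<partial>?G)
      = (\<integral>\<^sup>+z2. \<integral>\<^sup>+w1. \<integral>\<^sup>+w2. F (a1 *\<^sub>R z1 + a2 *\<^sub>R z2, (b1 *\<^sub>R z1 + b2 *\<^sub>R z2) + (s1 *\<^sub>R w1 + s2 *\<^sub>R w2)) \<partial>?G \<partial>?G \<partial>?G)"
      by (subst nn_integral_gaussian_swap, measurable) (simp add: add_ac)
  qed
  also have "\<dots> = (\<integral>\<^sup>+z1. \<integral>\<^sup>+z2. \<integral>\<^sup>+w. F (a1 *\<^sub>R z1 + a2 *\<^sub>R z2, (b1 *\<^sub>R z1 + b2 *\<^sub>R z2) + \<sigma> *\<^sub>R w) \<partial>?G \<partial>?G \<partial>?G)"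
    by (rule nn_integral_cong, rule nn_integral_cong,
        rule nn_integral_gaussian_add[OF _ \<sigma>, where H="\<lambda>w. F (a1 *\<^sub>R z1 + a2 *\<^sub>R z2, (b1 *\<^sub>R z1 + b2 *\<^sub>R z2) + w)" for z1 z2]) measurable
  also have "\<dots> = (\<integral>\<^sup>+z. \<integral>\<^sup>+y. \<integral>\<^sup>+w. F (a *\<^sub>R z, (b *\<^sub>R z + \<delta> *\<^sub>R y) + \<sigma> *\<^sub>R w) \<partial>?G \<partial>?G \<partial>?G)"
    using nn_integral_gaussian_linear[OF _ a, of "\<lambda>(x, y). \<integral>\<^sup>+w. F (x, y + \<sigma> *\<^sub>R w) \<partial>?G" b1 b2]
    unfolding b' \<delta>_def[symmetric] prod.case by measurable
  also have "\<dots> = (\<integral>\<^sup>+z. \<integral>\<^sup>+y. \<integral>\<^sup>+w. F (a *\<^sub>R z, b *\<^sub>R z + (\<delta> *\<^sub>R y + \<sigma> *\<^sub>R w)) \<partial>?G \<partial>?G \<partial>?G)"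
    by (simp add: add.assoc)
  also have "\<dots> = (\<integral>\<^sup>+z. \<integral>\<^sup>+w. F (a *\<^sub>R z, b *\<^sub>R z + s *\<^sub>R w) \<partial>?G \<partial>?G)"
  proof (rule nn_integral_cong)
    fix z :: 'a
    show "(\<integral>\<^sup>+y. \<integral>\<^sup>+w. F (a *\<^sub>R z, b *\<^sub>R z + (\<delta> *\<^sub>R y + \<sigma> *\<^sub>R w)) \<partial>?G \<partial>?G) = (\<integral>\<^sup>+w. F (a *\<^sub>R z, b *\<^sub>R z + s *\<^sub>R w) \<partial>?G)"
      using s \<delta> \<sigma> by (intro nn_integral_gaussian_add[where H="\<lambda>w. F (a *\<^sub>R z, b *\<^sub>R z + w)"]) auto
  qed
  also have "\<dots> = (\<integral>\<^sup>+n. F n \<partial>gaussian_pair a b s)"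
    by (rule nn_integral_gaussian_pair[symmetric]) measurable
  finally show ?thesis .
qed

text \<open>Noise from an earlier step is transported by the linear flow with entries k, l before
  fresh noise is added. The transport sends the Cholesky column (a1, b1) to (k a1, b1 + l a1) and
  keeps s1, so only the addition of covariances remains.\<close>

lemma gaussian_pair_convolution:
  assumes a: "0 < a" "a\<^sup>2 = (k * a1)\<^sup>2 + a2\<^sup>2" and b: "a * b = (k * a1) * (b1 + l * a1) + a2 * b2"
    and s: "0 \<le> s" "b\<^sup>2 + s\<^sup>2 = (b1 + l * a1)\<^sup>2 + s1\<^sup>2 + b2\<^sup>2 + s2\<^sup>2"
  shows "distr (gaussian_pair a1 b1 s1 \<Otimes>\<^sub>M gaussian_pair a2 b2 s2) (borel \<Otimes>\<^sub>M borel)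
      (\<lambda>(n, n'). (k *\<^sub>R fst n + fst n', snd n + l *\<^sub>R fst n + snd n')) = (gaussian_pair a b s :: ('a::euclidean_space \<times> 'a) measure)"
proof (rule measure_eqI)
  fix A :: "('a \<times> 'a) set"
  assume "A \<in> sets (distr (gaussian_pair a1 b1 s1 \<Otimes>\<^sub>M gaussian_pair a2 b2 s2) (borel \<Otimes>\<^sub>M borel)
      (\<lambda>(n, n'). (k *\<^sub>R fst n + fst n', snd n + l *\<^sub>R fst n + snd n')))"
  then have A [measurable]: "A \<in> sets (borel \<Otimes>\<^sub>M borel)" by simp
  let ?F = "indicator A :: _ \<Rightarrow> ennreal"
  let ?T = "\<lambda>(n, n'). (k *\<^sub>R fst n + fst n', snd n + l *\<^sub>R fst n + snd n')"
  let ?P1 = "gaussian_pair a1 b1 s1 :: ('a \<times> 'a) measure" and ?P2 = "gaussian_pair a2 b2 s2 :: ('a \<times> 'a) measure"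
  have "emeasure (distr (?P1 \<Otimes>\<^sub>M ?P2) (borel \<Otimes>\<^sub>M borel) ?T) A = (\<integral>\<^sup>+p. ?F p \<partial>distr (?P1 \<Otimes>\<^sub>M ?P2) (borel \<Otimes>\<^sub>M borel) ?T)"
    by (rule nn_integral_indicator[symmetric]) simp
  also have "\<dots> = (\<integral>\<^sup>+p. ?F (?T p) \<partial>(?P1 \<Otimes>\<^sub>M ?P2))"
    by (rule nn_integral_distr) measurable
  also have "\<dots> = (\<integral>\<^sup>+n. \<integral>\<^sup>+n'. ?F (?T (n, n')) \<partial>?P2 \<partial>?P1)"
    by (rule gaussian_pair.nn_integral_fst[symmetric]) measurable
  also have "\<dots> = (\<integral>\<^sup>+n. \<integral>\<^sup>+n'. ?F (fst n + fst n', snd n + snd n') \<partial>?P2 \<partial>gaussian_pair (k * a1) (b1 + l * a1) s1)"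
  proof -
    have meas: "(\<lambda>n. \<integral>\<^sup>+n'. ?F (k *\<^sub>R fst n + fst n', snd n + l *\<^sub>R fst n + snd n') \<partial>?P2) \<in> borel_measurable (borel \<Otimes>\<^sub>M borel)"
      "(\<lambda>n. \<integral>\<^sup>+n'. ?F (fst n + fst n', snd n + snd n') \<partial>?P2) \<in> borel_measurable (borel \<Otimes>\<^sub>M borel)"
      by measurable
    show ?thesis
      unfolding prod.case nn_integral_gaussian_pair[OF meas(1)] nn_integral_gaussian_pair[OF meas(2)]
      by (simp add: algebra_simps)
  qed
  also have "\<dots> = (\<integral>\<^sup>+n. ?F n \<partial>gaussian_pair a b s)"
    by (rule nn_integral_gaussian_pair_add) (use a b s in auto)
  finally show "emeasure (distr (?P1 \<Otimes>\<^sub>M ?P2) (borel \<Otimes>\<^sub>M borel) ?T) A = emeasure (gaussian_pair a b s) A"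
    by simp
qed simp

section \<open>Coordinates of Gaussian vectors and laws of iid coordinate pairs\<close>

lemma gaussian_vec_nth_prod:
  fixes f :: "'n::finite \<Rightarrow> real \<Rightarrow> ennreal"
  assumes "\<And>i. f i \<in> borel_measurable borel"
  shows "(\<integral>\<^sup>+x. (\<Prod>i\<in>UNIV. f i (x $ i)) \<partial>(gaussian :: (real^'n) measure)) = (\<Prod>i\<in>UNIV. \<integral>\<^sup>+x. f i x \<partial>gaussian)"
proof -
  have B: "Basis = range (\<lambda>i. axis i 1 :: real^'n)" by (auto simp: Basis_vec_def)
  have inj: "inj (\<lambda>i. axis i 1 :: real^'n)" by (auto simp: inj_on_def axis_eq_axis)
  show ?thesis
    using nn_integral_gaussian_prod[of "\<lambda>b. f (inv (\<lambda>i. axis i 1 :: real^'n) b)"] assms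
    unfolding B by (simp add: prod.reindex[OF inj] inv_f_f[OF inj] inner_axis)
qed

text \<open>The law of B z depends on B only through B B^T, so the arbitrary factor supplied by
  \<open>is_gaussian\<close> may be exchanged for the Cholesky factor. Rotation fixes the last entry
  up to sign, and the symmetry of the Gaussian removes the sign.\<close>

lemma nn_integral_gaussian_real2_linear:
  fixes F :: "real \<times> real \<Rightarrow> ennreal"
  assumes [measurable]: "F \<in> borel_measurable (borel \<Otimes>\<^sub>M borel)"
    and a: "0 < a" "a\<^sup>2 = p\<^sup>2 + q\<^sup>2" and b: "a * b = p * u + q * t"
    and s: "0 \<le> s" "b\<^sup>2 + s\<^sup>2 = u\<^sup>2 + t\<^sup>2"
  shows "(\<integral>\<^sup>+x. \<integral>\<^sup>+y. F (p * x + q * y, u * x + t * y) \<partial>gaussian \<partial>gaussian)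
    = (\<integral>\<^sup>+x. \<integral>\<^sup>+y. F (a * x, b * x + s * y) \<partial>gaussian \<partial>gaussian)"
proof -
  define \<delta> where "\<delta> = (p * t - q * u) / a"
  have b': "(p * u + q * t) / a = b" using a b by (simp add: field_simps)
  have "(p * u + q * t)\<^sup>2 + (p * t - q * u)\<^sup>2 = (p\<^sup>2 + q\<^sup>2) * (u\<^sup>2 + t\<^sup>2)"
    by (simp add: power2_eq_square algebra_simps)
  then have "b\<^sup>2 + \<delta>\<^sup>2 = u\<^sup>2 + t\<^sup>2"
    using a(1) unfolding b'[symmetric] \<delta>_def power_divide add_divide_distrib[symmetric] a(2)[symmetric] by simp
  then have \<delta>: "s\<^sup>2 = \<delta>\<^sup>2" using s by simp
  have "(\<integral>\<^sup>+x. \<integral>\<^sup>+y. F (p * x + q * y, u * x + t * y) \<partial>gaussian \<partial>gaussian)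
    = (\<integral>\<^sup>+x. \<integral>\<^sup>+y. F (a * x, b * x + \<delta> * y) \<partial>gaussian \<partial>gaussian)"
    using nn_integral_gaussian_linear[of F a p q u t] a unfolding b' \<delta>_def[symmetric] by simp
  also have "\<dots> = (\<integral>\<^sup>+x. \<integral>\<^sup>+y. F (a * x, b * x + s * y) \<partial>gaussian \<partial>gaussian)"
  proof (rule nn_integral_cong)
    fix x :: real
    show "(\<integral>\<^sup>+y. F (a * x, b * x + \<delta> * y) \<partial>gaussian) = (\<integral>\<^sup>+y. F (a * x, b * x + s * y) \<partial>gaussian)"
      using nn_integral_gaussian_abs_scale[of "\<lambda>y. F (a * x, b * x + y)" s \<delta>] s(1) \<delta> by simp
  qed
  finally show ?thesis .
qed

lemma std_gaussian_eq_gaussian: "std_gaussian = (gaussian :: (real^'n) measure)"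
proof -
  have B: "Basis = range (\<lambda>i. axis i 1 :: real^'n)" by (auto simp: Basis_vec_def)
  have inj: "inj (\<lambda>i. axis i 1 :: real^'n)" by (auto simp: inj_on_def axis_eq_axis)
  show ?thesis
    unfolding std_gaussian_def gaussian_def gaussian_density_def B
    by (simp add: prod.reindex[OF inj] inner_axis)
qed

lemma borel_measurable_vec_nth_compose [measurable (raw)]:
  fixes f :: "'w \<Rightarrow> real^'n"
  assumes "f \<in> borel_measurable M"
  shows "(\<lambda>x. f x $ i) \<in> borel_measurable M"
  using assms by (rule measurable_compose) (intro borel_measurable_continuous_onI continuous_intros)

lemma borel_measurable_vec_lambda:
  fixes f :: "'n::finite \<Rightarrow> 'w \<Rightarrow> real"
  assumes [measurable]: "\<And>i. f i \<in> borel_measurable M"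
  shows "(\<lambda>x. \<chi> i. f i x) \<in> borel_measurable M"
  by (subst borel_measurable_euclidean_space) (auto simp: Basis_vec_def inner_axis)

lemma nn_integral_std_gaussian_2:
  fixes F :: "real^2 \<Rightarrow> ennreal"
  assumes [measurable]: "F \<in> borel_measurable borel"
  shows "(\<integral>\<^sup>+z. F z \<partial>std_gaussian) = (\<integral>\<^sup>+x. \<integral>\<^sup>+y. F (vector [x, y]) \<partial>gaussian \<partial>gaussian)"
proof -
  have vec_eq: "vector [x, y] = (\<chi> i::2. if i = 1 then x else y)" for x y :: real
    by (simp add: vec_eq_iff forall_2)
  have vec_meas [measurable]: "(\<lambda>p. vector [fst p, snd p] :: real^2) \<in> borel_measurable (gaussian \<Otimes>\<^sub>M gaussian)"
    unfolding vec_eq by (rule borel_measurable_vec_lambda) simp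
  interpret product_sigma_finite "\<lambda>_::2. gaussian :: real measure"
    ..
  have nth_meas: "(\<lambda>z::real^2. \<lambda>i\<in>UNIV. z $ i) \<in> borel \<rightarrow>\<^sub>M (\<Pi>\<^sub>M i\<in>UNIV. gaussian)"
    by (rule measurable_restrict) simp
  \<comment> \<open>The two measures on the plane are compared through their images on the product
    space of coordinates, where the values on boxes determine a measure; \<open>recover\<close>
    transports the equality back.\<close>
  have law: "distr N (\<Pi>\<^sub>M i\<in>UNIV. gaussian) (\<lambda>z. \<lambda>i\<in>UNIV. z $ i) = (\<Pi>\<^sub>M i\<in>(UNIV :: 2 set). (gaussian :: real measure))"
    if sN: "sets N = sets borel" and N: "\<And>A B. A \<in> sets borel \<Longrightarrow> B \<in> sets borel \<Longrightarrow>
      emeasure N {z. z $ 1 \<in> A \<and> z $ 2 \<in> B} = emeasure gaussian A * emeasure gaussian B" for N :: "(real^2) measure"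
  proof (rule PiM_eqI)
    fix A :: "2 \<Rightarrow> real set" assume A: "\<And>i. i \<in> UNIV \<Longrightarrow> A i \<in> sets gaussian"
    have "space N = UNIV" using sets_eq_imp_space_eq[OF sN] by simp
    then have "emeasure (distr N (\<Pi>\<^sub>M i\<in>UNIV. gaussian) (\<lambda>z. \<lambda>i\<in>UNIV. z $ i)) (Pi\<^sub>E UNIV A)
      = emeasure N {z. z $ 1 \<in> A 1 \<and> z $ 2 \<in> A 2}"
      using A nth_meas
      by (subst emeasure_distr) (auto simp: measurable_cong_sets[OF sN refl] PiE_iff forall_2 vimage_def intro!: sets_PiM_I_finite)
    also have "\<dots> = (\<Prod>i\<in>UNIV. emeasure gaussian (A i))" using N A by (simp add: prod_2 UNIV_2)
    finally show "emeasure (distr N (\<Pi>\<^sub>M i\<in>UNIV. gaussian) (\<lambda>z. \<lambda>i\<in>UNIV. z $ i)) (Pi\<^sub>E UNIV A) = (\<Prod>i\<in>UNIV. emeasure gaussian (A i))" .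
  qed auto
  have vec_meas': "(\<lambda>p. vector [fst p, snd p] :: real^2) \<in> borel_measurable (borel \<Otimes>\<^sub>M borel)"
    using vec_meas by (simp cong: measurable_cong_sets)
  let ?N = "distr (gaussian \<Otimes>\<^sub>M gaussian) borel (\<lambda>p. vector [fst p, snd p]) :: (real^2) measure"
  have 1: "distr ?N (\<Pi>\<^sub>M i\<in>UNIV. gaussian) (\<lambda>z. \<lambda>i\<in>UNIV. z $ i) = (\<Pi>\<^sub>M i\<in>(UNIV :: 2 set). (gaussian :: real measure))"
  proof (rule law)
    fix A B :: "real set" assume [measurable]: "A \<in> sets borel" "B \<in> sets borel"
    have "emeasure ?N {z. z $ 1 \<in> A \<and> z $ 2 \<in> B} = emeasure (gaussian \<Otimes>\<^sub>M gaussian) (A \<times> B)"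
      by (subst emeasure_distr) (auto intro!: arg_cong2[where f=emeasure] simp: space_pair_measure)
    also have "\<dots> = emeasure gaussian A * emeasure gaussian B"
      by (rule gaussian.emeasure_pair_measure_Times) auto
    finally show "emeasure ?N {z. z $ 1 \<in> A \<and> z $ 2 \<in> B} = emeasure gaussian A * emeasure gaussian B" .
  qed simp
  have 2: "distr (gaussian :: (real^2) measure) (\<Pi>\<^sub>M i\<in>UNIV. gaussian) (\<lambda>z. \<lambda>i\<in>UNIV. z $ i) = (\<Pi>\<^sub>M i\<in>(UNIV :: 2 set). (gaussian :: real measure))"
  proof (rule law)
    fix A B :: "real set" assume [measurable]: "A \<in> sets borel" "B \<in> sets borel"
    have "emeasure (gaussian :: (real^2) measure) {z. z $ 1 \<in> A \<and> z $ 2 \<in> B}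
      = (\<integral>\<^sup>+z. indicator {z. z $ 1 \<in> A \<and> z $ 2 \<in> B} z \<partial>(gaussian :: (real^2) measure))"
      by (rule nn_integral_indicator[symmetric]) simp
    also have "\<dots> = (\<integral>\<^sup>+z. (\<Prod>i\<in>UNIV. (if i = 1 then indicator A else indicator B) (z $ i)) \<partial>(gaussian :: (real^2) measure))"
      by (intro nn_integral_cong) (simp add: UNIV_2 indicator_def)
    also have "\<dots> = emeasure gaussian A * emeasure gaussian B"
      by (subst gaussian_vec_nth_prod) (simp_all add: UNIV_2)
    finally show "emeasure (gaussian :: (real^2) measure) {z. z $ 1 \<in> A \<and> z $ 2 \<in> B} = emeasure gaussian A * emeasure gaussian B" .
  qed simp
  have recover: "N = distr (distr N (\<Pi>\<^sub>M i\<in>UNIV. gaussian) (\<lambda>z. \<lambda>i\<in>UNIV. z $ i)) borel (\<lambda>f. \<chi> i. f i)"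
    if sN: "sets N = sets borel" for N :: "(real^2) measure"
  proof -
    have e: "vec_lambda (restrict (($) z) UNIV) = z" for z :: "real^2" by (simp add: vec_eq_iff)
    have "(\<lambda>f. \<chi> i. f i :: real^2) \<in> borel_measurable (\<Pi>\<^sub>M i\<in>UNIV. gaussian)"
      by (rule borel_measurable_vec_lambda) (simp add: measurable_component_singleton[where M="\<lambda>_. gaussian", simplified] cong: measurable_cong_sets)
    then have "distr (distr N (\<Pi>\<^sub>M i\<in>UNIV. gaussian) (\<lambda>z. \<lambda>i\<in>UNIV. z $ i)) borel (\<lambda>f. \<chi> i. f i) = distr N borel (\<lambda>z. z)"
      using nth_meas e by (subst distr_distr) (auto simp: measurable_cong_sets[OF sN refl] comp_def)
    then show ?thesis using distr_id2[OF sN[symmetric]] by simp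
  qed
  have "std_gaussian = ?N"
    using recover[of ?N] recover[of gaussian] unfolding 1 2 std_gaussian_eq_gaussian by simp
  then have "(\<integral>\<^sup>+z. F z \<partial>std_gaussian) = (\<integral>\<^sup>+z. F z \<partial>?N)" by simp
  also have "\<dots> = (\<integral>\<^sup>+p. F (vector [fst p, snd p]) \<partial>(gaussian \<Otimes>\<^sub>M gaussian))"
    by (rule nn_integral_distr) (use vec_meas in auto)
  also have "\<dots> = (\<integral>\<^sup>+x. \<integral>\<^sup>+y. F (vector [x, y]) \<partial>gaussian \<partial>gaussian)"
    using vec_meas' by (subst gaussian.nn_integral_fst[symmetric]) (auto cong: measurable_cong_sets)
  finally show ?thesis .
qed

text \<open>The hypotheses speak of independent planar vectors, one per coordinate, the conclusion
  of a pair of long vectors. Both \<open>P\<close> and the Gaussian reference space are mapped to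
  the family indexed by coordinates, where both laws are the same product measure, and
  \<open>T\<close> regroups that family.\<close>

lemma distr_iid_gaussian_pairs:
  fixes X Y :: "'w \<Rightarrow> real^'n" and S :: "real^2^2"
  assumes P: "prob_space P"
    and ind: "prob_space.indep_vars P (\<lambda>_. borel) (\<lambda>i \<omega>. vector [X \<omega> $ i, Y \<omega> $ i] :: real^2) UNIV"
    and G: "\<And>i. is_gaussian (distr P borel (\<lambda>\<omega>. vector [X \<omega> $ i, Y \<omega> $ i])) 0 S"
    and a: "0 < a" "a\<^sup>2 = S $ 1 $ 1" and b: "a * b = S $ 1 $ 2" and s: "0 \<le> s" "b\<^sup>2 + s\<^sup>2 = S $ 2 $ 2"
  shows "distr P (borel \<Otimes>\<^sub>M borel) (\<lambda>\<omega>. (X \<omega>, Y \<omega>)) = gaussian_pair a b s"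
proof -
  interpret P: prob_space P by (rule P)
  define Z where "Z i \<omega> = (vector [X \<omega> $ i, Y \<omega> $ i] :: real^2)" for i \<omega>
  define Z' where "Z' i p = (vector [a * fst p $ i, b * fst p $ i + s * snd p $ i] :: real^2)" for i and p :: "(real^'n) \<times> (real^'n)"
  let ?\<Omega> = "gaussian \<Otimes>\<^sub>M gaussian :: ((real^'n) \<times> (real^'n)) measure"
  have vec_eq: "vector [x, y] = (\<chi> i::2. if i = 1 then x else y)" for x y :: real
    by (simp add: vec_eq_iff forall_2)
  have vec_meas [measurable]: "(\<lambda>x. vector [g x, h x] :: real^2) \<in> borel_measurable N"
    if [measurable]: "g \<in> borel_measurable N" "h \<in> borel_measurable N" for g h and N :: "'x measure"
    unfolding vec_eq by (rule borel_measurable_vec_lambda) simp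
  have Z [measurable]: "Z i \<in> borel_measurable P" for i
    using ind unfolding P.indep_vars_def Z_def by auto
  have Z' [measurable]: "Z' i \<in> borel_measurable ?\<Omega>" for i
    unfolding Z'_def by measurable
  have marginal: "emeasure (distr P borel (Z i)) A
    = (\<integral>\<^sup>+x. \<integral>\<^sup>+y. indicator A (vector [a * x, b * x + s * y] :: real^2) \<partial>gaussian \<partial>gaussian)"
    if [measurable]: "A \<in> sets borel" for i A
  proof -
    obtain B :: "real^2^2" where B: "B ** transpose B = S"
      and law: "distr P borel (Z i) = distr std_gaussian borel (\<lambda>z. 0 + B *v z)"
      using G[of i] unfolding is_gaussian_def Z_def by blast
    have BS: "(B $ 1 $ 1)\<^sup>2 + (B $ 1 $ 2)\<^sup>2 = S $ 1 $ 1" "B $ 1 $ 1 * B $ 2 $ 1 + B $ 1 $ 2 * B $ 2 $ 2 = S $ 1 $ 2"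
      "(B $ 2 $ 1)\<^sup>2 + (B $ 2 $ 2)\<^sup>2 = S $ 2 $ 2"
      unfolding B[symmetric] by (simp_all add: matrix_matrix_mult_def transpose_def sum_2 power2_eq_square)
    have Bv: "B *v vector [x, y] = vector [B $ 1 $ 1 * x + B $ 1 $ 2 * y, B $ 2 $ 1 * x + B $ 2 $ 2 * y]" for x y :: real
      by (simp add: vec_eq_iff forall_2 matrix_vector_mult_def sum_2)
    have [measurable]: "(\<lambda>z. B *v z) \<in> borel_measurable borel"
      by (intro borel_measurable_continuous_onI matrix_vector_mult_linear_continuous_on)
    have "emeasure (distr P borel (Z i)) A = (\<integral>\<^sup>+z. indicator A z \<partial>distr std_gaussian borel (\<lambda>z. 0 + B *v z))"
      unfolding law by (rule nn_integral_indicator[symmetric]) simp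
    also have "\<dots> = (\<integral>\<^sup>+z. indicator A (B *v z) \<partial>std_gaussian)"
      by (subst nn_integral_distr) (auto simp: std_gaussian_eq_gaussian)
    also have "\<dots> = (\<integral>\<^sup>+x. \<integral>\<^sup>+y. indicator A (vector [B $ 1 $ 1 * x + B $ 1 $ 2 * y, B $ 2 $ 1 * x + B $ 2 $ 2 * y] :: real^2) \<partial>gaussian \<partial>gaussian)"
      by (subst nn_integral_std_gaussian_2) (simp_all add: Bv)
    also have "\<dots> = (\<integral>\<^sup>+x. \<integral>\<^sup>+y. indicator A (vector [a * x, b * x + s * y] :: real^2) \<partial>gaussian \<partial>gaussian)"
      using nn_integral_gaussian_real2_linear[of "\<lambda>p. indicator A (vector [fst p, snd p] :: real^2)" a "B $ 1 $ 1" "B $ 1 $ 2" b "B $ 2 $ 1" "B $ 2 $ 2" s]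
        a b s BS by simp
    finally show ?thesis .
  qed
  interpret L: product_prob_space "\<lambda>i. distr P borel (Z i)" UNIV
    by (intro product_prob_spaceI P.prob_space_distr Z)
  have meas: "(\<lambda>\<omega>. \<lambda>i\<in>UNIV. Z i \<omega>) \<in> P \<rightarrow>\<^sub>M (\<Pi>\<^sub>M i\<in>UNIV. borel)" "(\<lambda>p. \<lambda>i\<in>UNIV. Z' i p) \<in> ?\<Omega> \<rightarrow>\<^sub>M (\<Pi>\<^sub>M i\<in>UNIV. borel)"
    by (intro measurable_restrict Z Z')+
  have 1: "distr P (\<Pi>\<^sub>M i\<in>UNIV. borel) (\<lambda>\<omega>. \<lambda>i\<in>UNIV. Z i \<omega>) = (\<Pi>\<^sub>M i\<in>UNIV. distr P borel (Z i))"
    using ind P.indep_vars_iff_distr_eq_PiM[where I=UNIV and M'="\<lambda>_. borel" and X=Z] Z unfolding Z_def by auto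
  have 2: "distr ?\<Omega> (\<Pi>\<^sub>M i\<in>UNIV. borel) (\<lambda>p. \<lambda>i\<in>UNIV. Z' i p) = (\<Pi>\<^sub>M i\<in>UNIV. distr P borel (Z i))"
  proof (rule L.PiM_eqI)
    fix A :: "'n \<Rightarrow> (real^2) set" assume "\<And>i. i \<in> UNIV \<Longrightarrow> A i \<in> sets (distr P borel (Z i))"
    then have A [measurable]: "\<And>i. A i \<in> sets borel" by simp
    let ?I = "\<lambda>i x y. indicator (A i) (vector [a * x, b * x + s * y] :: real^2) :: ennreal"
    have "emeasure (distr ?\<Omega> (\<Pi>\<^sub>M i\<in>UNIV. borel) (\<lambda>p. \<lambda>i\<in>UNIV. Z' i p)) (Pi\<^sub>E UNIV A)
      = (\<integral>\<^sup>+f. indicator (Pi\<^sub>E UNIV A) f \<partial>distr ?\<Omega> (\<Pi>\<^sub>M i\<in>UNIV. borel) (\<lambda>p. \<lambda>i\<in>UNIV. Z' i p))"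
      by (rule nn_integral_indicator[symmetric]) (auto intro!: sets_PiM_I_finite)
    also have "\<dots> = (\<integral>\<^sup>+p. indicator (Pi\<^sub>E UNIV A) (\<lambda>i\<in>UNIV. Z' i p) \<partial>?\<Omega>)"
      by (rule nn_integral_distr[OF meas(2)]) (auto intro!: borel_measurable_indicator sets_PiM_I_finite)
    also have "\<dots> = (\<integral>\<^sup>+p. (\<Prod>i\<in>UNIV. ?I i (fst p $ i) (snd p $ i)) \<partial>?\<Omega>)"
      by (intro nn_integral_cong) (auto simp: Z'_def indicator_def PiE_iff)
    also have "\<dots> = (\<integral>\<^sup>+z. \<integral>\<^sup>+w. (\<Prod>i\<in>UNIV. ?I i (z $ i) (w $ i)) \<partial>gaussian \<partial>gaussian)"
      by (subst gaussian.nn_integral_fst[symmetric]) (auto intro!: borel_measurable_prod_ennreal)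
    also have "\<dots> = (\<integral>\<^sup>+z. (\<Prod>i\<in>UNIV. \<integral>\<^sup>+y. ?I i (z $ i) y \<partial>gaussian) \<partial>gaussian)"
      by (intro nn_integral_cong gaussian_vec_nth_prod) measurable
    also have "\<dots> = (\<Prod>i\<in>UNIV. \<integral>\<^sup>+x. \<integral>\<^sup>+y. ?I i x y \<partial>gaussian \<partial>gaussian)"
      by (rule gaussian_vec_nth_prod) measurable
    finally show "emeasure (distr ?\<Omega> (\<Pi>\<^sub>M i\<in>UNIV. borel) (\<lambda>p. \<lambda>i\<in>UNIV. Z' i p)) (Pi\<^sub>E UNIV A)
      = (\<Prod>i\<in>UNIV. emeasure (distr P borel (Z i)) (A i))"
      using marginal[OF A] by simp
  qed (auto intro!: sets_PiM_cong)
  define T where "T f = (\<chi> i. f i $ 1, \<chi> i. f i $ 2)" for f :: "'n \<Rightarrow> real^2"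
  have T [measurable]: "T \<in> (\<Pi>\<^sub>M i\<in>UNIV. borel) \<rightarrow>\<^sub>M (borel \<Otimes>\<^sub>M borel)"
    unfolding T_def
    by (intro measurable_Pair borel_measurable_vec_lambda measurable_compose[OF measurable_component_singleton]) auto
  have "distr P (borel \<Otimes>\<^sub>M borel) (\<lambda>\<omega>. (X \<omega>, Y \<omega>)) = distr (distr P (\<Pi>\<^sub>M i\<in>UNIV. borel) (\<lambda>\<omega>. \<lambda>i\<in>UNIV. Z i \<omega>)) (borel \<Otimes>\<^sub>M borel) T"
    using meas(1) by (subst distr_distr) (auto simp: comp_def T_def Z_def)
  also have "\<dots> = distr (distr ?\<Omega> (\<Pi>\<^sub>M i\<in>UNIV. borel) (\<lambda>p. \<lambda>i\<in>UNIV. Z' i p)) (borel \<Otimes>\<^sub>M borel) T"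
    unfolding 1 2 ..
  also have "\<dots> = gaussian_pair a b s"
    using meas(2) unfolding gaussian_pair_def
    by (subst distr_distr) (auto simp: comp_def T_def Z'_def vec_eq_iff intro!: distr_cong)
  finally show ?thesis .
qed

section \<open>The stationary chain\<close>

text \<open>A bound on the L2 norm with measurability built in. Because it is a predicate with an
  explicit real bound, scaling, domination and the triangle inequality apply without separate
  integrability arguments.\<close>

definition L2le :: "'w measure \<Rightarrow> ('w \<Rightarrow> 'a::euclidean_space) \<Rightarrow> real \<Rightarrow> bool" where
  "L2le M X c \<longleftrightarrow> X \<in> borel_measurable M \<and> 0 \<le> c \<and> (\<integral>\<^sup>+\<omega>. ennreal ((norm (X \<omega>))\<^sup>2) \<partial>M) \<le> ennreal (c\<^sup>2)"

lemma L2leI: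
  "X \<in> borel_measurable M \<Longrightarrow> 0 \<le> c \<Longrightarrow> (\<integral>\<^sup>+\<omega>. ennreal ((norm (X \<omega>))\<^sup>2) \<partial>M) \<le> ennreal (c\<^sup>2) \<Longrightarrow> L2le M X c"
  by (simp add: L2le_def)

lemma L2le_measurable: "L2le M X c \<Longrightarrow> X \<in> borel_measurable M"
  by (simp add: L2le_def)

lemma L2le_bound_nonneg: "L2le M X c \<Longrightarrow> 0 \<le> c"
  by (simp add: L2le_def)

lemma L2le_mono_bound: "L2le M X c \<Longrightarrow> c \<le> d \<Longrightarrow> L2le M X d"
  by (auto simp: L2le_def intro: order_trans ennreal_leI power_mono)

lemma L2le_dominated:
  fixes X :: "'w \<Rightarrow> 'a::euclidean_space" and Y :: "'w \<Rightarrow> 'b::euclidean_space"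
  assumes "L2le M Y c" "X \<in> borel_measurable M" "\<And>\<omega>. \<omega> \<in> space M \<Longrightarrow> norm (X \<omega>) \<le> norm (Y \<omega>)"
  shows "L2le M X c"
proof (rule L2leI)
  have "(\<integral>\<^sup>+\<omega>. ennreal ((norm (X \<omega>))\<^sup>2) \<partial>M) \<le> (\<integral>\<^sup>+\<omega>. ennreal ((norm (Y \<omega>))\<^sup>2) \<partial>M)"
    using assms(3) by (intro nn_integral_mono ennreal_leI power_mono) auto
  then show "(\<integral>\<^sup>+\<omega>. ennreal ((norm (X \<omega>))\<^sup>2) \<partial>M) \<le> ennreal (c\<^sup>2)"
    using assms(1) by (auto simp: L2le_def)
qed (use assms in \<open>auto simp: L2le_def\<close>)

lemma L2le_norm: "L2le M X c \<Longrightarrow> L2le M (\<lambda>\<omega>. norm (X \<omega>)) c"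
  by (frule L2le_measurable, erule L2le_dominated) auto

lemma L2le_zero: "L2le M (\<lambda>_. 0) 0"
  by (simp add: L2le_def)

lemma L2le_scaleR:
  assumes "L2le M X c"
  shows "L2le M (\<lambda>\<omega>. k *\<^sub>R X \<omega>) (\<bar>k\<bar> * c)"
proof (rule L2leI)
  have [measurable]: "X \<in> borel_measurable M" using assms by (rule L2le_measurable)
  have "(\<integral>\<^sup>+\<omega>. ennreal ((norm (k *\<^sub>R X \<omega>))\<^sup>2) \<partial>M) = ennreal (k\<^sup>2) * (\<integral>\<^sup>+\<omega>. ennreal ((norm (X \<omega>))\<^sup>2) \<partial>M)"
    by (subst nn_integral_cmult[symmetric]) (auto simp: ennreal_mult power_mult_distrib)
  also have "\<dots> \<le> ennreal (k\<^sup>2) * ennreal (c\<^sup>2)"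
    using assms by (intro mult_left_mono) (auto simp: L2le_def)
  finally show "(\<integral>\<^sup>+\<omega>. ennreal ((norm (k *\<^sub>R X \<omega>))\<^sup>2) \<partial>M) \<le> ennreal ((\<bar>k\<bar> * c)\<^sup>2)"
    by (simp add: ennreal_mult power_mult_distrib)
qed (use assms in \<open>auto simp: L2le_def\<close>)

lemma norm_add_sq_le:
  fixes x y :: "'a::real_inner"
  assumes "0 < t"
  shows "(norm (x + y))\<^sup>2 \<le> (1 + t) * (norm x)\<^sup>2 + (1 + 1 / t) * (norm y)\<^sup>2"
proof -
  have "0 \<le> (t * norm x - norm y)\<^sup>2 / t" using assms by simp
  then have "2 * norm x * norm y \<le> t * (norm x)\<^sup>2 + (norm y)\<^sup>2 / t"
    using assms by (simp add: power2_diff field_simps power2_eq_square)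
  moreover have "(norm (x + y))\<^sup>2 \<le> (norm x + norm y)\<^sup>2"
    by (intro power_mono norm_triangle_ineq) auto
  ultimately show ?thesis by (simp add: power2_sum algebra_simps)
qed

lemma L2le_zero_bound_imp_AE:
  assumes "L2le M X 0"
  shows "AE \<omega> in M. X \<omega> = 0"
proof -
  have [measurable]: "X \<in> borel_measurable M" using assms by (rule L2le_measurable)
  have "(\<integral>\<^sup>+\<omega>. ennreal ((norm (X \<omega>))\<^sup>2) \<partial>M) = 0" using assms by (simp add: L2le_def)
  then have "AE \<omega> in M. ennreal ((norm (X \<omega>))\<^sup>2) = 0" by (subst (asm) nn_integral_0_iff_AE) auto
  then show ?thesis by eventually_elim (simp add: ennreal_eq_0_iff)
qed

lemma L2le_add:
  assumes X: "L2le M X c" and Y: "L2le M Y d"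
  shows "L2le M (\<lambda>\<omega>. X \<omega> + Y \<omega>) (c + d)"
proof (rule L2leI)
  have [measurable]: "X \<in> borel_measurable M" "Y \<in> borel_measurable M" using X Y by (auto dest: L2le_measurable)
  have cd: "0 \<le> c" "0 \<le> d" using X Y by (auto dest: L2le_bound_nonneg)
  show "(\<integral>\<^sup>+\<omega>. ennreal ((norm (X \<omega> + Y \<omega>))\<^sup>2) \<partial>M) \<le> ennreal ((c + d)\<^sup>2)"
  proof (cases "c = 0 \<or> d = 0")
    case True
    then show ?thesis
    proof
      assume "c = 0"
      then have "AE \<omega> in M. X \<omega> = 0" using X L2le_zero_bound_imp_AE by blast
      then have "(\<integral>\<^sup>+\<omega>. ennreal ((norm (X \<omega> + Y \<omega>))\<^sup>2) \<partial>M) = (\<integral>\<^sup>+\<omega>. ennreal ((norm (Y \<omega>))\<^sup>2) \<partial>M)"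
        by (intro nn_integral_cong_AE) (auto elim: eventually_mono)
      then show ?thesis using Y \<open>c = 0\<close> by (simp add: L2le_def)
    next
      assume "d = 0"
      then have "AE \<omega> in M. Y \<omega> = 0" using Y L2le_zero_bound_imp_AE by blast
      then have "(\<integral>\<^sup>+\<omega>. ennreal ((norm (X \<omega> + Y \<omega>))\<^sup>2) \<partial>M) = (\<integral>\<^sup>+\<omega>. ennreal ((norm (X \<omega>))\<^sup>2) \<partial>M)"
        by (intro nn_integral_cong_AE) (auto elim: eventually_mono)
      then show ?thesis using X \<open>d = 0\<close> by (simp add: L2le_def)
    qed
  next
    case False
    then have pos: "0 < c" "0 < d" using cd by auto
    \<comment> \<open>The optimal weight in Young's inequality: it turns (1 + t) c^2 + (1 + 1/t) d^2
      into (c + d)^2. Zero bounds were split off because the weight is a ratio.\<close>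
    define t where "t = d / c"
    have t: "0 < t" using pos by (simp add: t_def)
    have "(\<integral>\<^sup>+\<omega>. ennreal ((norm (X \<omega> + Y \<omega>))\<^sup>2) \<partial>M)
      \<le> (\<integral>\<^sup>+\<omega>. ennreal (1 + t) * ennreal ((norm (X \<omega>))\<^sup>2) + ennreal (1 + 1 / t) * ennreal ((norm (Y \<omega>))\<^sup>2) \<partial>M)"
      using norm_add_sq_le[OF t] t
      by (intro nn_integral_mono) (simp add: ennreal_mult[symmetric] ennreal_plus[symmetric] ennreal_leI del: ennreal_plus)
    also have "\<dots> = ennreal (1 + t) * (\<integral>\<^sup>+\<omega>. ennreal ((norm (X \<omega>))\<^sup>2) \<partial>M) + ennreal (1 + 1 / t) * (\<integral>\<^sup>+\<omega>. ennreal ((norm (Y \<omega>))\<^sup>2) \<partial>M)"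
      by (subst nn_integral_add) (auto simp: nn_integral_cmult)
    also have "\<dots> \<le> ennreal (1 + t) * ennreal (c\<^sup>2) + ennreal (1 + 1 / t) * ennreal (d\<^sup>2)"
      using X Y by (intro add_mono mult_left_mono) (auto simp: L2le_def)
    also have "\<dots> = ennreal ((1 + t) * c\<^sup>2 + (1 + 1 / t) * d\<^sup>2)"
      using t by (simp add: ennreal_mult[symmetric] ennreal_plus[symmetric] del: ennreal_plus)
    also have "(1 + t) * c\<^sup>2 + (1 + 1 / t) * d\<^sup>2 = (c + d)\<^sup>2"
      using pos by (simp add: t_def field_simps power2_eq_square)
    finally show ?thesis .
  qed
qed (use L2le_measurable[OF X] L2le_measurable[OF Y] L2le_bound_nonneg[OF X] L2le_bound_nonneg[OF Y] in auto)

lemma L2le_minus: "L2le M X c \<Longrightarrow> L2le M (\<lambda>\<omega>. - X \<omega>) c"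
  by (frule L2le_measurable, erule L2le_dominated) auto

lemma L2le_diff: "L2le M X c \<Longrightarrow> L2le M Y d \<Longrightarrow> L2le M (\<lambda>\<omega>. X \<omega> - Y \<omega>) (c + d)"
  using L2le_add[of M X c "\<lambda>\<omega>. - Y \<omega>" d] L2le_minus[of M Y d] by simp

lemma L2le_Pair:
  assumes X: "L2le M X c" and Y: "L2le M Y d"
  shows "L2le M (\<lambda>\<omega>. (X \<omega>, Y \<omega>)) (sqrt (c\<^sup>2 + d\<^sup>2))"
proof (rule L2leI)
  have [measurable]: "X \<in> borel_measurable M" "Y \<in> borel_measurable M" using X Y by (auto dest: L2le_measurable)
  show "(\<lambda>\<omega>. (X \<omega>, Y \<omega>)) \<in> borel_measurable M" by (rule borel_measurable_Pair) auto
  have "(\<integral>\<^sup>+\<omega>. ennreal ((norm (X \<omega>, Y \<omega>))\<^sup>2) \<partial>M) = (\<integral>\<^sup>+\<omega>. ennreal ((norm (X \<omega>))\<^sup>2) + ennreal ((norm (Y \<omega>))\<^sup>2) \<partial>M)"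
    by (simp add: norm_prod_def)
  also have "\<dots> \<le> ennreal (c\<^sup>2) + ennreal (d\<^sup>2)"
    using X Y by (subst nn_integral_add) (auto simp: L2le_def intro: add_mono)
  finally show "(\<integral>\<^sup>+\<omega>. ennreal ((norm (X \<omega>, Y \<omega>))\<^sup>2) \<partial>M) \<le> ennreal ((sqrt (c\<^sup>2 + d\<^sup>2))\<^sup>2)"
    by simp
qed simp

lemma L2le_distr:
  assumes T: "T \<in> M \<rightarrow>\<^sub>M N" and X: "X \<in> borel_measurable N"
  shows "L2le (distr M N T) X c \<longleftrightarrow> L2le M (\<lambda>\<omega>. X (T \<omega>)) c"
  unfolding L2le_def using X T measurable_compose[OF T X]
  by (subst nn_integral_distr) auto

lemma L2le_pair_fst:
  assumes X: "L2le M X c" and N: "prob_space N" and M: "sigma_finite_measure M"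
  shows "L2le (M \<Otimes>\<^sub>M N) (\<lambda>z. X (fst z)) c"
proof (rule L2leI)
  interpret N: prob_space N by (rule N)
  have [measurable]: "X \<in> borel_measurable M" using X by (rule L2le_measurable)
  show "(\<lambda>z. X (fst z)) \<in> borel_measurable (M \<Otimes>\<^sub>M N)" by measurable
  have "(\<integral>\<^sup>+z. ennreal ((norm (X (fst z)))\<^sup>2) \<partial>(M \<Otimes>\<^sub>M N)) = (\<integral>\<^sup>+x. \<integral>\<^sup>+y. ennreal ((norm (X x))\<^sup>2) \<partial>N \<partial>M)"
    by (subst N.nn_integral_fst[symmetric]) auto
  then show "(\<integral>\<^sup>+z. ennreal ((norm (X (fst z)))\<^sup>2) \<partial>(M \<Otimes>\<^sub>M N)) \<le> ennreal (c\<^sup>2)"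
    using X by (simp add: N.emeasure_space_1 L2le_def)
qed (use X in \<open>auto dest: L2le_bound_nonneg\<close>)

lemma L2le_pair_snd:
  assumes Y: "L2le N Y c" and M: "prob_space M" and N: "sigma_finite_measure N"
  shows "L2le (M \<Otimes>\<^sub>M N) (\<lambda>z. Y (snd z)) c"
proof (rule L2leI)
  interpret M: prob_space M by (rule M)
  interpret N: sigma_finite_measure N by (rule N)
  have [measurable]: "Y \<in> borel_measurable N" using Y by (rule L2le_measurable)
  show "(\<lambda>z. Y (snd z)) \<in> borel_measurable (M \<Otimes>\<^sub>M N)" by measurable
  have "(\<integral>\<^sup>+z. ennreal ((norm (Y (snd z)))\<^sup>2) \<partial>(M \<Otimes>\<^sub>M N)) = (\<integral>\<^sup>+x. \<integral>\<^sup>+y. ennreal ((norm (Y y))\<^sup>2) \<partial>N \<partial>M)"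
    by (subst N.nn_integral_fst[symmetric]) auto
  then show "(\<integral>\<^sup>+z. ennreal ((norm (Y (snd z)))\<^sup>2) \<partial>(M \<Otimes>\<^sub>M N)) \<le> ennreal (c\<^sup>2)"
    using Y by (simp add: M.emeasure_space_1 L2le_def)
qed (use Y in \<open>auto dest: L2le_bound_nonneg\<close>)

lemma nn_integral_exp_norm_sq_finite:
  assumes c: "0 < c"
  shows "(\<integral>\<^sup>+x. ennreal (exp (- c * (norm x)\<^sup>2)) \<partial>(lborel :: 'a::euclidean_space measure)) < \<infinity>"
proof -
  define \<sigma> where "\<sigma> = sqrt (1 / (2 * c))"
  have \<sigma>: "0 < \<sigma>" "\<sigma>\<^sup>2 = 1 / (2 * c)" using c by (simp_all add: \<sigma>_def)
  have e: "exp (- c * t\<^sup>2) = sqrt (2 * pi * \<sigma>\<^sup>2) * normal_density 0 \<sigma> t" for t :: real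
    using c \<sigma> by (simp add: normal_density_def)
  have "(\<integral>\<^sup>+(t::real). ennreal (exp (- c * t\<^sup>2)) \<partial>lborel) = ennreal (sqrt (2 * pi * \<sigma>\<^sup>2)) * (\<integral>\<^sup>+t. ennreal (normal_density 0 \<sigma> t) \<partial>lborel)"
    unfolding e by (subst nn_integral_cmult[symmetric]) (auto simp: ennreal_mult)
  also have "(\<integral>\<^sup>+t. ennreal (normal_density 0 \<sigma> t) \<partial>lborel) = 1"
    using integral_normal_density[OF \<sigma>(1), of 0] \<sigma>(1)
    by (subst nn_integral_eq_integral) (auto simp: integrable_normal_density)
  finally have 1: "(\<integral>\<^sup>+(t::real). ennreal (exp (- c * t\<^sup>2)) \<partial>lborel) < \<infinity>" by simp
  have "(\<integral>\<^sup>+x. ennreal (exp (- c * (norm x)\<^sup>2)) \<partial>(lborel :: 'a measure))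
    = (\<integral>\<^sup>+x. (\<Prod>b\<in>Basis. ennreal (exp (- c * (x \<bullet> b)\<^sup>2))) \<partial>(lborel :: 'a measure))"
    by (simp add: norm_sq_Basis prod_ennreal exp_sum[symmetric] sum_negf sum_distrib_left)
  also have "\<dots> = (\<Prod>b\<in>(Basis::'a set). \<integral>\<^sup>+t. ennreal (exp (- c * t\<^sup>2)) \<partial>lborel)"
    by (rule nn_integral_lborel_prod) auto
  also have "\<dots> < \<infinity>" using 1 by (simp add: power_less_top_ennreal)
  finally show ?thesis .
qed

lemma nn_integral_lborel_uminus:
  fixes F :: "'a::euclidean_space \<Rightarrow> ennreal"
  assumes [measurable]: "F \<in> borel_measurable borel"
  shows "(\<integral>\<^sup>+y. F (- y) \<partial>lborel) = (\<integral>\<^sup>+y. F y \<partial>lborel)"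
proof -
  have "(\<integral>\<^sup>+y. F y \<partial>lborel) = (\<integral>\<^sup>+y. F y \<partial>(distr lborel borel (\<lambda>x. 0 + (-1) *\<^sub>R x)))"
    using lborel_affine[of "-1" "0::'a"] by (simp add: density_1)
  also have "\<dots> = (\<integral>\<^sup>+y. F (- y) \<partial>lborel)"
    by (subst nn_integral_distr) auto
  finally show ?thesis by simp
qed

definition unif :: "real measure" where "unif = uniform_measure lborel {0..1}"

lemma sets_unif [simp, measurable_cong]: "sets unif = sets borel"
  by (simp add: unif_def)

interpretation unif: prob_space unif
  unfolding unif_def by (rule prob_space_uniform_measure) auto

lemma nn_integral_unif_threshold:
  assumes "0 \<le> \<alpha>" "\<alpha> \<le> 1"
  shows "(\<integral>\<^sup>+u. (if u \<le> \<alpha> then A else B) \<partial>unif) = ennreal \<alpha> * A + ennreal (1 - \<alpha>) * B"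
proof -
  have "emeasure unif {..\<alpha>} = ennreal \<alpha>"
  proof -
    have "{0..1} \<inter> {..\<alpha>} = {0..\<alpha>}" using assms by auto
    then show ?thesis using assms unfolding unif_def by (subst emeasure_uniform_measure) (auto simp: divide_ennreal_def)
  qed
  moreover have "emeasure unif {\<alpha><..} = ennreal (1 - \<alpha>)"
  proof -
    have "{0..1} \<inter> {\<alpha><..} = {\<alpha><..1}" using assms by auto
    then show ?thesis using assms unfolding unif_def by (subst emeasure_uniform_measure) (auto simp: divide_ennreal_def)
  qed
  moreover have "(\<integral>\<^sup>+u. (if u \<le> \<alpha> then A else B) \<partial>unif) = (\<integral>\<^sup>+u. A * indicator {..\<alpha>} u + B * indicator {\<alpha><..} u \<partial>unif)"
    by (intro nn_integral_cong) (auto simp: indicator_def)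
  ultimately show ?thesis
    by (simp add: nn_integral_add nn_integral_cmult_indicator mult.commute)
qed

section \<open>The target measure: normalization and moments\<close>

context strongly_convex_smooth
begin

definition target :: "'a measure" where
  "target = density lborel (\<lambda>x. ennreal (exp (- f x)) / (\<integral>\<^sup>+y. ennreal (exp (- f y)) \<partial>lborel))"

lemma sets_target [simp, measurable_cong]: "sets target = sets borel"
  by (simp add: target_def)

lemma space_target [simp]: "space target = UNIV"
  by (simp add: target_def)

text \<open>Half of the quadratic growth m/2 absorbs the linear term, leaving m/4. This Gaussian
  tail gives the normalizing constant and the second moments.\<close>

lemma f_lower: "f 0 - (norm (g 0))\<^sup>2 / m + m / 4 * (norm x)\<^sup>2 \<le> f x"
proof -
  have "0 \<le> (norm (g 0) - m / 2 * norm x)\<^sup>2 / m" using m_pos by simp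
  then have "norm (g 0) * norm x \<le> (norm (g 0))\<^sup>2 / m + m / 4 * (norm x)\<^sup>2"
    using m_pos by (simp add: power2_diff field_simps power2_eq_square)
  moreover have "- (norm (g 0) * norm x) \<le> g 0 \<bullet> x"
    using Cauchy_Schwarz_ineq2[of "g 0" x] by (simp add: abs_le_iff)
  moreover have "f 0 + g 0 \<bullet> x + m * (norm x)\<^sup>2 / 2 \<le> f x"
    using f_quadratic_bounds(1)[of 0 x] by simp
  ultimately show ?thesis by (simp add: field_simps)
qed

lemma exp_neg_f_le: "exp (- f x) \<le> exp (- f 0 + (norm (g 0))\<^sup>2 / m) * exp (- (m / 4) * (norm x)\<^sup>2)"
  using f_lower[of x] by (simp add: exp_add[symmetric])

lemma normalizer_finite: "(\<integral>\<^sup>+y. ennreal (exp (- f y)) \<partial>lborel) < \<infinity>"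
proof -
  have "(\<integral>\<^sup>+y. ennreal (exp (- f y)) \<partial>lborel)
    \<le> (\<integral>\<^sup>+y. ennreal (exp (- f 0 + (norm (g 0))\<^sup>2 / m)) * ennreal (exp (- (m / 4) * (norm y)\<^sup>2)) \<partial>(lborel :: 'a measure))"
    using exp_neg_f_le by (intro nn_integral_mono) (simp add: ennreal_mult[symmetric] ennreal_leI)
  also have "\<dots> < \<infinity>"
    using nn_integral_exp_norm_sq_finite[where 'a='a, of "m / 4"] m_pos
    by (subst nn_integral_cmult) (auto simp: ennreal_mult_less_top)
  finally show ?thesis .
qed

lemma normalizer_pos: "0 < (\<integral>\<^sup>+y. ennreal (exp (- f y)) \<partial>lborel)"
proof -
  have "(\<integral>\<^sup>+y. ennreal (exp (- f y)) \<partial>lborel) \<noteq> 0"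
  proof
    assume "(\<integral>\<^sup>+y. ennreal (exp (- f y)) \<partial>lborel) = 0"
    then have "AE y in (lborel :: 'a measure). ennreal (exp (- f y)) = 0"
      by (subst (asm) nn_integral_0_iff_AE) auto
    then have "AE y in (lborel :: 'a measure). False" by (auto elim: eventually_mono simp: ennreal_eq_0_iff)
    then have "emeasure (lborel :: 'a measure) UNIV = 0" by (simp add: AE_iff_measurable[of UNIV])
    then show False by simp
  qed
  then show ?thesis by (simp add: zero_less_iff_neq_zero)
qed

lemma prob_space_target: "prob_space target"
proof
  let ?Z = "\<integral>\<^sup>+y. ennreal (exp (- f y)) \<partial>lborel"
  have "emeasure target UNIV = (\<integral>\<^sup>+x. ennreal (exp (- f x)) / ?Z \<partial>lborel)"
    unfolding target_def by (subst emeasure_density) auto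
  also have "\<dots> = ?Z / ?Z" by (rule nn_integral_divide) auto
  also have "\<dots> = 1" using normalizer_finite normalizer_pos by (intro ennreal_divide_self) auto
  finally show "emeasure target (space target) = 1" by simp
qed

sublocale target: prob_space target
  by (rule prob_space_target)

lemma emeasure_target_UNIV [simp]: "emeasure target UNIV = 1"
  using target.emeasure_space_1 by simp

lemma nn_integral_target:
  assumes [measurable]: "F \<in> borel_measurable borel"
  shows "(\<integral>\<^sup>+x. F x \<partial>target) = (\<integral>\<^sup>+x. ennreal (exp (- f x)) * F x \<partial>lborel) / (\<integral>\<^sup>+y. ennreal (exp (- f y)) \<partial>lborel)"
  unfolding target_def
  by (subst nn_integral_density) (auto simp: ennreal_times_divide mult.commute nn_integral_divide[symmetric] intro!: nn_integral_cong)

lemma target_second_moment: "(\<integral>\<^sup>+x. ennreal ((norm x)\<^sup>2) \<partial>target) < \<infinity>"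
proof -
  have b: "exp (- f x) * (norm x)\<^sup>2 \<le> exp (- f 0 + (norm (g 0))\<^sup>2 / m) * (8 / m) * exp (- (m / 8) * (norm x)\<^sup>2)" for x
  proof -
    \<comment> \<open>The factor |x|^2 is absorbed by half of the Gaussian decay m/4 through t <=
      exp t.\<close>
    have "(m / 8) * (norm x)\<^sup>2 \<le> exp ((m / 8) * (norm x)\<^sup>2)"
      using exp_ge_add_one_self[of "(m / 8) * (norm x)\<^sup>2"] by linarith
    then have "(norm x)\<^sup>2 \<le> (8 / m) * exp ((m / 8) * (norm x)\<^sup>2)"
      using m_pos by (simp add: field_simps)
    then have "exp (- f x) * (norm x)\<^sup>2 \<le>
      (exp (- f 0 + (norm (g 0))\<^sup>2 / m) * exp (- (m / 4) * (norm x)\<^sup>2)) * ((8 / m) * exp ((m / 8) * (norm x)\<^sup>2))"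
      using exp_neg_f_le[of x] by (intro mult_mono) auto
    also have "\<dots> = exp (- f 0 + (norm (g 0))\<^sup>2 / m) * (8 / m) * (exp (- (m / 4) * (norm x)\<^sup>2) * exp ((m / 8) * (norm x)\<^sup>2))"
      by (simp add: mult_ac)
    also have "exp (- (m / 4) * (norm x)\<^sup>2) * exp ((m / 8) * (norm x)\<^sup>2) = exp (- (m / 8) * (norm x)\<^sup>2)"
      unfolding exp_add[symmetric] by (simp add: field_simps)
    finally show ?thesis .
  qed
  have "(\<integral>\<^sup>+x. ennreal (exp (- f x)) * ennreal ((norm x)\<^sup>2) \<partial>lborel)
    \<le> (\<integral>\<^sup>+x. ennreal (exp (- f 0 + (norm (g 0))\<^sup>2 / m) * (8 / m)) * ennreal (exp (- (m / 8) * (norm x)\<^sup>2)) \<partial>(lborel :: 'a measure))"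
    using b m_pos by (intro nn_integral_mono) (simp add: ennreal_mult[symmetric] ennreal_leI)
  also have "\<dots> < \<infinity>"
    using nn_integral_exp_norm_sq_finite[where 'a='a, of "m / 8"] m_pos
    by (subst nn_integral_cmult) (auto simp: ennreal_mult_less_top)
  finally show ?thesis
    using normalizer_pos by (subst nn_integral_target) (auto simp: less_top[symmetric] ennreal_divide_eq_top_iff)
qed

lemma target_gradient_second_moment: "(\<integral>\<^sup>+x. ennreal ((norm (g x))\<^sup>2) \<partial>target) < \<infinity>"
proof -
  have b: "(norm (g x))\<^sup>2 \<le> 2 * (norm (g 0))\<^sup>2 + 2 * M\<^sup>2 * (norm x)\<^sup>2" for x
  proof -
    have "(norm (g x))\<^sup>2 \<le> (norm (g 0) + M * norm x)\<^sup>2"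
      using g_linear_growth by (intro power_mono) auto
    also have "\<dots> \<le> 2 * (norm (g 0))\<^sup>2 + 2 * M\<^sup>2 * (norm x)\<^sup>2"
      using sum_squares_bound[of "norm (g 0)" "M * norm x"] by (simp add: power2_sum power_mult_distrib)
    finally show ?thesis .
  qed
  have "(\<integral>\<^sup>+x. ennreal ((norm (g x))\<^sup>2) \<partial>target)
    \<le> (\<integral>\<^sup>+x. ennreal (2 * (norm (g 0))\<^sup>2) + ennreal (2 * M\<^sup>2) * ennreal ((norm x)\<^sup>2) \<partial>target)"
    using b by (intro nn_integral_mono)
      (simp add: ennreal_mult[symmetric] ennreal_plus[symmetric] ennreal_leI del: ennreal_plus)
  also have "\<dots> < \<infinity>"
    using target_second_moment
    by (subst nn_integral_add) (auto simp: nn_integral_cmult target.emeasure_space_1 ennreal_mult_less_top)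
  finally show ?thesis .
qed

section \<open>The Metropolis-adjusted leapfrog step and its invariant law\<close>

definition stationary :: "('a \<times> 'a) measure" where
  "stationary = gaussian \<Otimes>\<^sub>M target"

lemma sets_stationary [simp, measurable_cong]: "sets stationary = sets (borel \<Otimes>\<^sub>M borel)"
  unfolding stationary_def by (rule sets_pair_measure_cong) auto

sublocale stationary: prob_space stationary
  unfolding stationary_def by (intro prob_space_pair gaussian.prob_space_axioms target.prob_space_axioms)

lemma nn_integral_stationary:
  assumes [measurable]: "F \<in> borel_measurable (borel \<Otimes>\<^sub>M borel)"
  shows "(\<integral>\<^sup>+z. F z \<partial>stationary) = (\<integral>\<^sup>+v. \<integral>\<^sup>+x. F (v, x) \<partial>target \<partial>gaussian)"
  unfolding stationary_def by (subst target.nn_integral_fst[symmetric]) (auto cong: measurable_cong_sets)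

definition energy :: "'a \<times> 'a \<Rightarrow> real" where
  "energy z = (norm (fst z))\<^sup>2 / 2 + f (snd z)"

lemma borel_measurable_energy [measurable]: "energy \<in> borel_measurable (borel \<Otimes>\<^sub>M borel)"
  unfolding energy_def by measurable

text \<open>A single K, the product of the normalizing constants, serves all F. Invariance can
  therefore be checked against the unnormalized density exp (- \<open>energy\<close>).\<close>

lemma nn_integral_stationary_density:
  "\<exists>K. \<forall>F \<in> borel_measurable (borel \<Otimes>\<^sub>M borel).
    (\<integral>\<^sup>+z. F z \<partial>stationary) = K * (\<integral>\<^sup>+v. \<integral>\<^sup>+x. ennreal (exp (- energy (v, x))) * F (v, x) \<partial>lborel \<partial>lborel)"
proof (intro exI ballI)
  fix F :: "'a \<times> 'a \<Rightarrow> ennreal" assume F [measurable]: "F \<in> borel_measurable (borel \<Otimes>\<^sub>M borel)"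
  let ?Z = "\<integral>\<^sup>+y. ennreal (exp (- f y)) \<partial>lborel"
  let ?c = "(1 / sqrt (2 * pi)) ^ DIM('a)"
  have "(\<integral>\<^sup>+z. F z \<partial>stationary)
    = (\<integral>\<^sup>+v. ennreal (gaussian_density v) * ((\<integral>\<^sup>+x. ennreal (exp (- f x)) * F (v, x) \<partial>lborel) * inverse ?Z) \<partial>lborel)"
    by (simp add: nn_integral_stationary nn_integral_target nn_integral_gaussian divide_ennreal_def)
  also have "\<dots> = (\<integral>\<^sup>+v. (ennreal ?c * inverse ?Z) * (\<integral>\<^sup>+x. ennreal (exp (- (norm v)\<^sup>2 / 2)) * (ennreal (exp (- f x)) * F (v, x)) \<partial>lborel) \<partial>lborel)"
    by (intro nn_integral_cong, subst nn_integral_cmult) (auto simp: gaussian_density_eq ennreal_mult mult_ac)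
  also have "\<dots> = (ennreal ?c * inverse ?Z) * (\<integral>\<^sup>+v. \<integral>\<^sup>+x. ennreal (exp (- (norm v)\<^sup>2 / 2)) * (ennreal (exp (- f x)) * F (v, x)) \<partial>lborel \<partial>lborel)"
    by (rule nn_integral_cmult) measurable
  also have "(\<integral>\<^sup>+v. \<integral>\<^sup>+x. ennreal (exp (- (norm v)\<^sup>2 / 2)) * (ennreal (exp (- f x)) * F (v, x)) \<partial>lborel \<partial>lborel)
     = (\<integral>\<^sup>+v. \<integral>\<^sup>+x. ennreal (exp (- energy (v, x))) * F (v, x) \<partial>lborel \<partial>lborel)"
    by (simp add: energy_def mult.assoc[symmetric] ennreal_mult[symmetric] exp_add[symmetric])
  finally show "(\<integral>\<^sup>+z. F z \<partial>stationary)
    = (ennreal ?c * inverse ?Z) * (\<integral>\<^sup>+v. \<integral>\<^sup>+x. ennreal (exp (- energy (v, x))) * F (v, x) \<partial>lborel \<partial>lborel)" .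
qed

text \<open>The kick-drift-kick (Stoermer-Verlet) integrator of the Hamiltonian
  \<open>energy\<close>.\<close>

definition leapfrog :: "real \<Rightarrow> 'a \<times> 'a \<Rightarrow> 'a \<times> 'a" where
  "leapfrog \<epsilon> z = (let w = fst z - (\<epsilon> / 2) *\<^sub>R g (snd z); y = snd z + \<epsilon> *\<^sub>R w in (w - (\<epsilon> / 2) *\<^sub>R g y, y))"

definition flip :: "'a \<times> 'a \<Rightarrow> 'a \<times> 'a" where
  "flip z = (- fst z, snd z)"

lemma borel_measurable_g_compose [measurable (raw)]:
  "h \<in> borel_measurable N \<Longrightarrow> (\<lambda>x. g (h x)) \<in> borel_measurable N"
  by (rule measurable_compose[OF _ borel_measurable_g])

lemma measurable_leapfrog [measurable]: "leapfrog \<epsilon> \<in> borel \<Otimes>\<^sub>M borel \<rightarrow>\<^sub>M borel \<Otimes>\<^sub>M borel"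
  unfolding leapfrog_def Let_def by measurable

lemma measurable_flip [measurable]: "flip \<in> borel \<Otimes>\<^sub>M borel \<rightarrow>\<^sub>M borel \<Otimes>\<^sub>M borel"
  unfolding flip_def by measurable

lemma flip_flip [simp]: "flip (flip z) = z"
  by (simp add: flip_def)

lemma energy_flip [simp]: "energy (flip z) = energy z"
  by (simp add: energy_def flip_def)

text \<open>Reversing the velocity turns the integrator into its inverse, so \<open>flip\<close>
  after \<open>leapfrog\<close> is an involution, the form of proposal that the Metropolis argument
  uses.\<close>

lemma leapfrog_reversible [simp]: "flip (leapfrog \<epsilon> (flip (leapfrog \<epsilon> z))) = z"
  by (cases z) (simp add: leapfrog_def flip_def Let_def algebra_simps)

text \<open>Each kick and each drift is a translation in one variable with the other held fixed, and
  the flip is a reflection, so Fubini applies factor by factor.\<close>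

lemma nn_integral_lborel_flip_leapfrog:
  assumes [measurable]: "F \<in> borel_measurable (borel \<Otimes>\<^sub>M borel)"
  shows "(\<integral>\<^sup>+v. \<integral>\<^sup>+x. F (flip (leapfrog \<epsilon> (v, x))) \<partial>lborel \<partial>lborel) = (\<integral>\<^sup>+v. \<integral>\<^sup>+x. F (v, x) \<partial>lborel \<partial>lborel)"
proof -
  let ?H = "\<lambda>w x. F (- (w - (\<epsilon> / 2) *\<^sub>R g (x + \<epsilon> *\<^sub>R w)), x + \<epsilon> *\<^sub>R w)"
  have "(\<integral>\<^sup>+v. \<integral>\<^sup>+x. F (flip (leapfrog \<epsilon> (v, x))) \<partial>lborel \<partial>lborel)
    = (\<integral>\<^sup>+x. \<integral>\<^sup>+v. F (flip (leapfrog \<epsilon> (v, x))) \<partial>lborel \<partial>lborel)"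
    by (rule nn_integral_lborel_swap) measurable
  also have "\<dots> = (\<integral>\<^sup>+x. \<integral>\<^sup>+v. ?H (v + - ((\<epsilon> / 2) *\<^sub>R g x)) x \<partial>lborel \<partial>lborel)"
    by (simp add: leapfrog_def flip_def Let_def)
  also have "\<dots> = (\<integral>\<^sup>+x. \<integral>\<^sup>+w. ?H w x \<partial>lborel \<partial>lborel)"
    by (rule nn_integral_cong, rule nn_integral_lborel_shift[where F="\<lambda>w. ?H w x" for x]) measurable
  also have "\<dots> = (\<integral>\<^sup>+w. \<integral>\<^sup>+x. ?H w x \<partial>lborel \<partial>lborel)"
    by (rule nn_integral_lborel_swap) measurable
  also have "\<dots> = (\<integral>\<^sup>+w. \<integral>\<^sup>+y. F (- (w - (\<epsilon> / 2) *\<^sub>R g y), y) \<partial>lborel \<partial>lborel)"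
    by (rule nn_integral_cong, rule nn_integral_lborel_shift[where F="\<lambda>y. F (- (w - (\<epsilon> / 2) *\<^sub>R g y), y)" for w]) measurable
  also have "\<dots> = (\<integral>\<^sup>+y. \<integral>\<^sup>+w. F (- (w + - ((\<epsilon> / 2) *\<^sub>R g y)), y) \<partial>lborel \<partial>lborel)"
    unfolding diff_conv_add_uminus by (rule nn_integral_lborel_swap) measurable
  also have "\<dots> = (\<integral>\<^sup>+y. \<integral>\<^sup>+w. F (- w, y) \<partial>lborel \<partial>lborel)"
    by (rule nn_integral_cong, rule nn_integral_lborel_shift[where F="\<lambda>w. F (- w, y)" for y]) measurable
  also have "\<dots> = (\<integral>\<^sup>+y. \<integral>\<^sup>+w. F (w, y) \<partial>lborel \<partial>lborel)"
    by (rule nn_integral_cong, rule nn_integral_lborel_uminus[where F="\<lambda>w. F (w, y)" for y]) measurable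
  also have "\<dots> = (\<integral>\<^sup>+v. \<integral>\<^sup>+x. F (v, x) \<partial>lborel \<partial>lborel)"
    by (rule nn_integral_lborel_swap) measurable
  finally show ?thesis .
qed

definition accept_prob :: "real \<Rightarrow> 'a \<times> 'a \<Rightarrow> real" where
  "accept_prob \<epsilon> z = min 1 (exp (energy z - energy (leapfrog \<epsilon> z)))"

lemma borel_measurable_accept_prob [measurable]: "accept_prob \<epsilon> \<in> borel_measurable (borel \<Otimes>\<^sub>M borel)"
  unfolding accept_prob_def by measurable

lemma accept_prob_bounds: "0 \<le> accept_prob \<epsilon> z" "accept_prob \<epsilon> z \<le> 1"
  by (auto simp: accept_prob_def)

text \<open>A Metropolis step whose proposal is the involution \<open>flip\<close> after
  \<open>leapfrog\<close>, followed by another \<open>flip\<close>. Acceptance then ends in the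
  leapfrog image, and a rejected state leaves with its velocity reversed.\<close>

definition metropolis :: "real \<Rightarrow> real \<Rightarrow> 'a \<times> 'a \<Rightarrow> 'a \<times> 'a" where
  "metropolis \<epsilon> u z = (if u \<le> accept_prob \<epsilon> z then leapfrog \<epsilon> z else flip z)"

lemma measurable_metropolis [measurable (raw)]:
  assumes [measurable]: "U \<in> borel_measurable N" "Z \<in> N \<rightarrow>\<^sub>M borel \<Otimes>\<^sub>M borel"
  shows "(\<lambda>x. metropolis \<epsilon> (U x) (Z x)) \<in> N \<rightarrow>\<^sub>M borel \<Otimes>\<^sub>M borel"
  unfolding metropolis_def by measurable

text \<open>Detailed balance: the density times the acceptance probability is q, the smaller of the
  densities at z and \<Psi> z, hence symmetric under \<Psi>. As \<Psi> preserves Lebesgue measure,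
  the accepted mass can be moved back to z, where it completes the rejected mass to the full
  density. The final flip preserves the law because \<open>energy\<close> is even in the
  velocity.\<close>

lemma nn_integral_metropolis:
  assumes F [measurable]: "F \<in> borel_measurable (borel \<Otimes>\<^sub>M borel)"
  shows "(\<integral>\<^sup>+z. \<integral>\<^sup>+u. F (metropolis \<epsilon> u z) \<partial>unif \<partial>stationary) = (\<integral>\<^sup>+z. F z \<partial>stationary)"
proof -
  obtain K where K: "\<And>F. F \<in> borel_measurable (borel \<Otimes>\<^sub>M borel) \<Longrightarrow>
    (\<integral>\<^sup>+z. F z \<partial>stationary) = K * (\<integral>\<^sup>+v. \<integral>\<^sup>+x. ennreal (exp (- energy (v, x))) * F (v, x) \<partial>lborel \<partial>lborel)"
    using nn_integral_stationary_density by blast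
  define \<Psi> where "\<Psi> z = flip (leapfrog \<epsilon> z)" for z
  have [measurable]: "\<Psi> \<in> borel \<Otimes>\<^sub>M borel \<rightarrow>\<^sub>M borel \<Otimes>\<^sub>M borel" unfolding \<Psi>_def by measurable
  have \<Psi>\<Psi>: "\<Psi> (\<Psi> z) = z" for z by (simp add: \<Psi>_def)
  define G where "G z = F (flip z)" for z
  have [measurable]: "G \<in> borel_measurable (borel \<Otimes>\<^sub>M borel)" unfolding G_def by measurable
  define q where "q z = min (exp (- energy z)) (exp (- energy (\<Psi> z)))" for z
  have [measurable]: "q \<in> borel_measurable (borel \<Otimes>\<^sub>M borel)" unfolding q_def by measurable
  have q_sym: "q (\<Psi> z) = q z" for z by (simp add: q_def \<Psi>\<Psi> min.commute)
  have q_pos: "0 \<le> q z" "q z \<le> exp (- energy z)" for z by (auto simp: q_def)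
  have q_eq: "exp (- energy z) * accept_prob \<epsilon> z = q z" for z
    by (auto simp: q_def accept_prob_def \<Psi>_def min_def exp_diff exp_minus field_simps)
  have inner: "(\<integral>\<^sup>+u. F (metropolis \<epsilon> u z) \<partial>unif)
    = ennreal (accept_prob \<epsilon> z) * G (\<Psi> z) + ennreal (1 - accept_prob \<epsilon> z) * G z" for z
  proof -
    have "F (metropolis \<epsilon> u z) = (if u \<le> accept_prob \<epsilon> z then G (\<Psi> z) else G z)" for u
      by (simp add: metropolis_def G_def \<Psi>_def)
    then show ?thesis using nn_integral_unif_threshold[OF accept_prob_bounds] by simp
  qed
  have split: "ennreal (exp (- energy z)) * (\<integral>\<^sup>+u. F (metropolis \<epsilon> u z) \<partial>unif)
    = ennreal (q z) * G (\<Psi> z) + ennreal (exp (- energy z) - q z) * G z" for z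
    unfolding inner
    using accept_prob_bounds[of \<epsilon> z]
    by (simp add: distrib_left mult.assoc[symmetric] ennreal_mult[symmetric] q_eq right_diff_distrib)
  have "(\<integral>\<^sup>+z. \<integral>\<^sup>+u. F (metropolis \<epsilon> u z) \<partial>unif \<partial>stationary)
    = K * (\<integral>\<^sup>+v. \<integral>\<^sup>+x. ennreal (q (v, x)) * G (\<Psi> (v, x)) + ennreal (exp (- energy (v, x)) - q (v, x)) * G (v, x) \<partial>lborel \<partial>lborel)"
    by (subst K, measurable) (simp only: split)
  also have "(\<integral>\<^sup>+v. \<integral>\<^sup>+x. ennreal (q (v, x)) * G (\<Psi> (v, x)) + ennreal (exp (- energy (v, x)) - q (v, x)) * G (v, x) \<partial>lborel \<partial>lborel)
    = (\<integral>\<^sup>+v. \<integral>\<^sup>+x. ennreal (q (v, x)) * G (\<Psi> (v, x)) \<partial>lborel \<partial>lborel)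
      + (\<integral>\<^sup>+v. \<integral>\<^sup>+x. ennreal (exp (- energy (v, x)) - q (v, x)) * G (v, x) \<partial>lborel \<partial>lborel)"
    by (simp add: nn_integral_add)
  also have "(\<integral>\<^sup>+v. \<integral>\<^sup>+x. ennreal (q (v, x)) * G (\<Psi> (v, x)) \<partial>lborel \<partial>lborel)
    = (\<integral>\<^sup>+v. \<integral>\<^sup>+x. ennreal (q (v, x)) * G (v, x) \<partial>lborel \<partial>lborel)"
    using nn_integral_lborel_flip_leapfrog[of "\<lambda>z. ennreal (q z) * G z" \<epsilon>] by (simp add: q_sym flip: \<Psi>_def)
  also have "(\<integral>\<^sup>+v. \<integral>\<^sup>+x. ennreal (q (v, x)) * G (v, x) \<partial>lborel \<partial>lborel)
      + (\<integral>\<^sup>+v. \<integral>\<^sup>+x. ennreal (exp (- energy (v, x)) - q (v, x)) * G (v, x) \<partial>lborel \<partial>lborel)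
    = (\<integral>\<^sup>+v. \<integral>\<^sup>+x. ennreal (q (v, x)) * G (v, x) + ennreal (exp (- energy (v, x)) - q (v, x)) * G (v, x) \<partial>lborel \<partial>lborel)"
    by (simp add: nn_integral_add)
  also have "\<dots> = (\<integral>\<^sup>+v. \<integral>\<^sup>+x. ennreal (exp (- energy (v, x))) * G (v, x) \<partial>lborel \<partial>lborel)"
    using q_pos by (simp add: distrib_right[symmetric] ennreal_plus[symmetric] del: ennreal_plus)
  also have "\<dots> = (\<integral>\<^sup>+x. \<integral>\<^sup>+v. ennreal (exp (- energy (v, x))) * G (v, x) \<partial>lborel \<partial>lborel)"
    by (rule nn_integral_lborel_swap) measurable
  also have "\<dots> = (\<integral>\<^sup>+x. \<integral>\<^sup>+v. ennreal (exp (- energy (v, x))) * F (v, x) \<partial>lborel \<partial>lborel)"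
  proof (rule nn_integral_cong)
    fix x
    show "(\<integral>\<^sup>+v. ennreal (exp (- energy (v, x))) * G (v, x) \<partial>lborel) = (\<integral>\<^sup>+v. ennreal (exp (- energy (v, x))) * F (v, x) \<partial>lborel)"
      using nn_integral_lborel_uminus[of "\<lambda>v. ennreal (exp (- energy (v, x))) * F (v, x)"]
      by (simp add: G_def flip_def energy_def)
  qed
  also have "\<dots> = (\<integral>\<^sup>+v. \<integral>\<^sup>+x. ennreal (exp (- energy (v, x))) * F (v, x) \<partial>lborel \<partial>lborel)"
    by (rule nn_integral_lborel_swap) measurable
  finally show ?thesis using K[OF F] by simp
qed

end

section \<open>Gaussian noise of the kinetic step\<close>

lemma nonneg_if_deriv_nonneg:
  fixes F :: "real \<Rightarrow> real"
  assumes "0 \<le> t" "F 0 = 0" "\<And>x. 0 \<le> x \<Longrightarrow> (F has_real_derivative F' x) (at x)" "\<And>x. 0 \<le> x \<Longrightarrow> 0 \<le> F' x"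
  shows "0 \<le> F t"
proof -
  have "F 0 \<le> F t"
    using assms(3,4) by (intro DERIV_nonneg_imp_nondecreasing[OF assms(1)]) blast
  then show ?thesis using assms(2) by simp
qed

locale kinetic = strongly_convex_smooth f g m M
  for f :: "'a::euclidean_space \<Rightarrow> real" and g :: "'a \<Rightarrow> 'a" and m M :: real +
  fixes \<gamma> :: real
  assumes \<gamma>_pos: "0 < \<gamma>"
begin

text \<open>Closed forms of \<open>\<psi>\<^sub>0, \<psi>\<^sub>1, \<psi>\<^sub>2\<close> and of the entries of the covariance matrix \<open>C\<close> for step size \<open>t\<close>.\<close>

definition "p0 t = exp (- \<gamma> * t)"
definition "p1 t = (1 - p0 t) / \<gamma>"
definition "p2 t = (t - p1 t) / \<gamma>"
definition "c11 t = (1 - (p0 t)\<^sup>2) / (2 * \<gamma>)"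
definition "c12 t = (p1 t)\<^sup>2 / 2"
definition "c22 t = (t - 2 * p1 t + c11 t) / \<gamma>\<^sup>2"

lemma p0_pos: "0 < p0 t" and p0_0: "p0 0 = 1" and p0_le_1: "0 \<le> t \<Longrightarrow> p0 t \<le> 1"
  and p0_add: "p0 (s + t) = p0 s * p0 t"
  using \<gamma>_pos by (auto simp: p0_def exp_add[symmetric] algebra_simps)

lemma zero_simps [simp]: "p0 0 = 1" "p1 0 = 0" "p2 0 = 0" "c11 0 = 0" "c12 0 = 0" "c22 0 = 0"
  by (simp_all add: p0_0 p1_def p2_def c11_def c12_def c22_def)

lemma deriv_p0: "(p0 has_real_derivative - \<gamma> * p0 t) (at t)"
  unfolding p0_def by (auto intro!: derivative_eq_intros)

lemma deriv_p1: "(p1 has_real_derivative p0 t) (at t)"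
  unfolding p1_def
  by (rule DERIV_cong[OF DERIV_cdivide[OF DERIV_diff[OF DERIV_const deriv_p0]]]) (use \<gamma>_pos in simp)

lemma deriv_p2: "(p2 has_real_derivative p1 t) (at t)"
  unfolding p2_def
  by (rule DERIV_cong[OF DERIV_cdivide[OF DERIV_diff[OF DERIV_ident deriv_p1]]]) (simp add: p1_def)

lemma deriv_c11: "(c11 has_real_derivative (p0 t)\<^sup>2) (at t)"
  unfolding c11_def using \<gamma>_pos by (auto intro!: derivative_eq_intros deriv_p0 simp: power2_eq_square)

lemma deriv_c12: "(c12 has_real_derivative p0 t * p1 t) (at t)"
  unfolding c12_def using \<gamma>_pos by (auto intro!: derivative_eq_intros deriv_p1)

lemma deriv_c22: "(c22 has_real_derivative (p1 t)\<^sup>2) (at t)"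
  unfolding c22_def
  by (rule DERIV_cong[OF DERIV_cdivide[OF DERIV_add[OF DERIV_diff[OF DERIV_ident DERIV_cmult[OF deriv_p1]] deriv_c11]]])
    (simp add: p1_def power_divide power2_diff)

text \<open>This and the following \<open>_add\<close> rules are the flow property of v' = -
  \<gamma> v, x' = v and the matching propagation of the covariance. The rule for \<open>p1\<close>
  has two arrangements, one for the velocity and one for the position when steps are
  composed.\<close>

lemma p1_add: "p1 (s + t) = p0 t * p1 s + p1 t"
  using \<gamma>_pos by (simp add: p1_def p0_add field_simps)

lemma p1_add': "p1 (s + t) = p1 s + p1 t * p0 s"
  using \<gamma>_pos by (simp add: p1_def p0_add field_simps)

lemma p2_add: "p2 (s + t) = p2 s + p1 t * p1 s + p2 t"
  using \<gamma>_pos by (simp add: p2_def p1_def p0_add field_simps)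

lemma c11_add: "c11 (s + t) = (p0 t)\<^sup>2 * c11 s + c11 t"
  using \<gamma>_pos by (simp add: c11_def p0_add field_simps)

lemma c12_add: "c12 (s + t) = p0 t * (c12 s + p1 t * c11 s) + c12 t"
  using \<gamma>_pos by (simp add: c12_def c11_def p1_def p0_add field_simps power2_eq_square)

lemma c22_add: "c22 (s + t) = c22 s + 2 * p1 t * c12 s + (p1 t)\<^sup>2 * c11 s + c22 t"
  using \<gamma>_pos by (simp add: c22_def c12_def c11_def p1_def p0_add field_simps power2_eq_square)

text \<open>Friction conserves v + \<gamma> x; these identities are that conservation, for the
  coefficients of the velocity and of the gradient.\<close>

lemma p0_p1: "p0 t + \<gamma> * p1 t = 1" and p1_p2: "p1 t + \<gamma> * p2 t = t"
  using \<gamma>_pos by (auto simp: p1_def p2_def)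

lemma p1_bounds: "0 \<le> t \<Longrightarrow> 0 \<le> p1 t" "0 \<le> t \<Longrightarrow> p1 t \<le> t" "0 \<le> t \<Longrightarrow> t * p0 t \<le> p1 t"
proof -
  assume t: "0 \<le> t"
  show "0 \<le> p1 t" using \<gamma>_pos p0_le_1[OF t] by (simp add: p1_def)
  have "1 - \<gamma> * t \<le> p0 t" unfolding p0_def using exp_ge_add_one_self[of "- \<gamma> * t"] by simp
  then show "p1 t \<le> t" using \<gamma>_pos by (simp add: p1_def field_simps)
  have "0 \<le> (\<lambda>t. p1 t - t * p0 t) t"
    by (rule nonneg_if_deriv_nonneg[OF t, where F'="\<lambda>t. \<gamma> * t * p0 t"])
      (use \<gamma>_pos less_imp_le[OF p0_pos] in \<open>auto intro!: derivative_eq_intros deriv_p1 deriv_p0\<close>)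
  then show "t * p0 t \<le> p1 t" by simp
qed

lemma p0_lower: "1 - \<gamma> * t \<le> p0 t"
  unfolding p0_def using exp_ge_add_one_self[of "- \<gamma> * t"] by simp

lemma p2_bounds: "0 \<le> t \<Longrightarrow> 0 \<le> p2 t" "0 \<le> t \<Longrightarrow> p2 t \<le> t\<^sup>2 / 2"
proof -
  assume t: "0 \<le> t"
  show "0 \<le> p2 t" using \<gamma>_pos p1_bounds(2)[OF t] by (simp add: p2_def)
  have "0 \<le> (\<lambda>t. t\<^sup>2 / 2 - p2 t) t"
    by (rule nonneg_if_deriv_nonneg[OF t, where F'="\<lambda>t. t - p1 t"])
      (auto intro!: derivative_eq_intros deriv_p2 simp: p1_bounds)
  then show "p2 t \<le> t\<^sup>2 / 2" by simp
qed

lemma c11_pos: "0 < t \<Longrightarrow> 0 < c11 t"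
proof -
  assume "0 < t"
  then have "p0 t < 1" using \<gamma>_pos by (simp add: p0_def)
  then have "(p0 t)\<^sup>2 < 1" using p0_pos[of t] by (simp add: power_less_one_iff)
  then show ?thesis using \<gamma>_pos by (simp add: c11_def)
qed

text \<open>The cubic bound makes the position noise of a fine step O(\<epsilon>^(3/2)) in L2, hence
  negligible against \<epsilon>.\<close>

lemma c22_bounds: "0 \<le> t \<Longrightarrow> 0 \<le> c22 t" "0 \<le> t \<Longrightarrow> c22 t \<le> t ^ 3"
proof -
  assume t: "0 \<le> t"
  show "0 \<le> c22 t"
    by (rule nonneg_if_deriv_nonneg[OF t, where F'="\<lambda>t. (p1 t)\<^sup>2"]) (auto intro: deriv_c22)
  have "0 \<le> (\<lambda>t. t ^ 3 - c22 t) t"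
  proof (rule nonneg_if_deriv_nonneg[OF t, where F'="\<lambda>t. 3 * t\<^sup>2 - (p1 t)\<^sup>2"])
    fix x :: real assume x: "0 \<le> x"
    have "(p1 x)\<^sup>2 \<le> x\<^sup>2" using p1_bounds[OF x] by (intro power_mono) auto
    then show "0 \<le> 3 * x\<^sup>2 - (p1 x)\<^sup>2" by (smt (verit) zero_le_power2)
  qed (auto intro!: derivative_eq_intros deriv_c22)
  then show "c22 t \<le> t ^ 3" by simp
qed

text \<open>Cauchy-Schwarz for the integrals of \<open>p0\<close> and \<open>p1\<close>: the
  combination with weight l is the integral of (p1 - l p0)^2, hence nonnegative, and the chosen l
  minimizes it at time t.\<close>

lemma c12_sq_le: "0 \<le> t \<Longrightarrow> (c12 t)\<^sup>2 \<le> c11 t * c22 t"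
proof (cases "t = 0")
  case False
  assume "0 \<le> t"
  then have t: "0 < t" using False by simp
  define l where "l = c12 t / c11 t"
  have "0 \<le> (\<lambda>s. c22 s - 2 * l * c12 s + l\<^sup>2 * c11 s) t"
  proof (rule nonneg_if_deriv_nonneg[OF \<open>0 \<le> t\<close>, where F'="\<lambda>s. (p1 s - l * p0 s)\<^sup>2"])
    show "((\<lambda>s. c22 s - 2 * l * c12 s + l\<^sup>2 * c11 s) has_real_derivative (p1 x - l * p0 x)\<^sup>2) (at x)" for x
      by (auto intro!: derivative_eq_intros deriv_c22 deriv_c12 deriv_c11 simp: power2_eq_square algebra_simps)
  qed auto
  also have "c22 t - 2 * l * c12 t + l\<^sup>2 * c11 t = c22 t - (c12 t)\<^sup>2 / c11 t"
    using c11_pos[OF t] by (simp add: l_def power2_eq_square field_simps)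
  finally show ?thesis using c11_pos[OF t] by (simp add: field_simps)
qed simp

section \<open>The noise law of a step and its composition\<close>

definition "n\<alpha> t = sqrt (c11 t)"
text \<open>At t = 0 the division by zero yields 0. So \<open>noise 0\<close> is the point mass at
  the origin, and the induction over fine steps can start there.\<close>

definition "n\<beta> t = c12 t / n\<alpha> t"
definition "n\<sigma> t = sqrt (c22 t - (n\<beta> t)\<^sup>2)"

lemma noise_coeffs:
  assumes t: "0 \<le> t"
  shows "(n\<alpha> t)\<^sup>2 = c11 t" "n\<alpha> t * n\<beta> t = c12 t" "0 \<le> n\<sigma> t" "(n\<beta> t)\<^sup>2 + (n\<sigma> t)\<^sup>2 = c22 t"
    "0 < t \<Longrightarrow> 0 < n\<alpha> t"
proof -
  have c11: "0 \<le> c11 t" using c11_pos[of t] t by (cases "t = 0") auto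
  then show 1: "(n\<alpha> t)\<^sup>2 = c11 t" by (simp add: n\<alpha>_def)
  show pos: "0 < n\<alpha> t" if "0 < t" using c11_pos[OF that] by (simp add: n\<alpha>_def)
  show "n\<alpha> t * n\<beta> t = c12 t" using pos t by (cases "t = 0") (auto simp: n\<beta>_def)
  have "(n\<beta> t)\<^sup>2 \<le> c22 t"
  proof (cases "t = 0")
    case False
    then have "0 < c11 t" using c11_pos t by simp
    then show ?thesis using c12_sq_le[OF t] 1 by (simp add: n\<beta>_def power_divide field_simps)
  qed (simp add: n\<beta>_def)
  then show "0 \<le> n\<sigma> t" "(n\<beta> t)\<^sup>2 + (n\<sigma> t)\<^sup>2 = c22 t" by (simp_all add: n\<sigma>_def)
qed

definition noise :: "real \<Rightarrow> ('a \<times> 'a) measure" where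
  "noise t = gaussian_pair (n\<alpha> t) (n\<beta> t) (n\<sigma> t)"

lemma sets_noise [simp, measurable_cong]: "sets (noise t) = sets (borel \<Otimes>\<^sub>M borel)"
  by (simp add: noise_def)

sublocale noise: prob_space "noise t" for t
  unfolding noise_def by (rule prob_space_gaussian_pair)

lemma noise_convolution:
  assumes "0 \<le> s" "0 < t"
  shows "distr (noise s \<Otimes>\<^sub>M noise t) (borel \<Otimes>\<^sub>M borel)
      (\<lambda>(n, n'). (p0 t *\<^sub>R fst n + fst n', snd n + p1 t *\<^sub>R fst n + snd n')) = noise (s + t)"
  unfolding noise_def
proof (rule gaussian_pair_convolution)
  have t: "0 \<le> t" "0 \<le> s + t" "0 < s + t" using assms by auto
  note cs = noise_coeffs[OF assms(1)] noise_coeffs[OF t(1)] noise_coeffs[OF t(2)]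
  show "0 < n\<alpha> (s + t)" using cs t by simp
  show "(n\<alpha> (s + t))\<^sup>2 = (p0 t * n\<alpha> s)\<^sup>2 + (n\<alpha> t)\<^sup>2"
    by (simp add: power_mult_distrib cs c11_add)
  have "p0 t * n\<alpha> s * (n\<beta> s + p1 t * n\<alpha> s) + n\<alpha> t * n\<beta> t = p0 t * (n\<alpha> s * n\<beta> s + p1 t * (n\<alpha> s)\<^sup>2) + n\<alpha> t * n\<beta> t"
    by (simp add: algebra_simps power2_eq_square)
  also have "\<dots> = n\<alpha> (s + t) * n\<beta> (s + t)"
    by (simp only: cs c12_add)
  finally show "n\<alpha> (s + t) * n\<beta> (s + t) = p0 t * n\<alpha> s * (n\<beta> s + p1 t * n\<alpha> s) + n\<alpha> t * n\<beta> t"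
    by (rule sym)
  show "0 \<le> n\<sigma> (s + t)" using cs by simp
  have "(n\<beta> s + p1 t * n\<alpha> s)\<^sup>2 + (n\<sigma> s)\<^sup>2 + (n\<beta> t)\<^sup>2 + (n\<sigma> t)\<^sup>2
    = ((n\<beta> s)\<^sup>2 + (n\<sigma> s)\<^sup>2) + 2 * p1 t * (n\<alpha> s * n\<beta> s) + (p1 t)\<^sup>2 * (n\<alpha> s)\<^sup>2 + ((n\<beta> t)\<^sup>2 + (n\<sigma> t)\<^sup>2)"
    by (simp add: algebra_simps power2_eq_square)
  also have "\<dots> = (n\<beta> (s + t))\<^sup>2 + (n\<sigma> (s + t))\<^sup>2"
    by (simp only: cs c22_add)
  finally show "(n\<beta> (s + t))\<^sup>2 + (n\<sigma> (s + t))\<^sup>2 = (n\<beta> s + p1 t * n\<alpha> s)\<^sup>2 + (n\<sigma> s)\<^sup>2 + (n\<beta> t)\<^sup>2 + (n\<sigma> t)\<^sup>2"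
    by (rule sym)
qed

lemma L2le_noise_snd:
  assumes t: "0 \<le> t"
  shows "L2le (noise t) snd (sqrt (DIM('a) * c22 t))"
proof (rule L2leI)
  have "(\<integral>\<^sup>+n. ennreal ((norm (snd n))\<^sup>2) \<partial>noise t)
    = (\<integral>\<^sup>+(z::'a). \<integral>\<^sup>+(w::'a). ennreal ((norm (n\<beta> t *\<^sub>R z + n\<sigma> t *\<^sub>R w))\<^sup>2) \<partial>gaussian \<partial>gaussian)"
    unfolding noise_def by (subst nn_integral_gaussian_pair) auto
  also have "\<dots> = (\<integral>\<^sup>+(z::'a). ennreal ((norm (sqrt (c22 t) *\<^sub>R z))\<^sup>2) \<partial>gaussian)"
    using noise_coeffs(4)[OF t] c22_bounds(1)[OF t]
    by (intro nn_integral_gaussian_add[where H="\<lambda>z. ennreal ((norm z)\<^sup>2)"]) auto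
  also have "\<dots> = ennreal (c22 t) * (\<integral>\<^sup>+(z::'a). ennreal ((norm z)\<^sup>2) \<partial>gaussian)"
    using c22_bounds(1)[OF t] by (subst nn_integral_cmult[symmetric]) (auto simp: power_mult_distrib ennreal_mult)
  finally show "(\<integral>\<^sup>+n. ennreal ((norm (snd n))\<^sup>2) \<partial>noise t) \<le> ennreal ((sqrt (DIM('a) * c22 t))\<^sup>2)"
    using c22_bounds(1)[OF t] by (simp add: gaussian_second_moment ennreal_mult[symmetric] mult.commute)
qed (auto simp: c22_bounds[OF t])

text \<open>States are pairs \<open>(v, \<theta>)\<close>; the gradient \<open>G\<close> is a separate argument so that it can be frozen.\<close>

definition kstep :: "real \<Rightarrow> 'a \<Rightarrow> 'a \<times> 'a \<Rightarrow> 'a \<times> 'a \<Rightarrow> 'a \<times> 'a" where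
  "kstep t G x n = (p0 t *\<^sub>R fst x - p1 t *\<^sub>R G + sqrt (2 * \<gamma>) *\<^sub>R fst n,
    snd x + p1 t *\<^sub>R fst x - p2 t *\<^sub>R G + sqrt (2 * \<gamma>) *\<^sub>R snd n)"

text \<open>With the gradient frozen the steps form a flow. Together with
  \<open>noise_convolution\<close> this makes N fine steps equal in law to one step of the
  algorithm.\<close>

lemma kstep_kstep:
  "kstep t G (kstep s G x n) n' = kstep (s + t) G x (p0 t *\<^sub>R fst n + fst n', snd n + p1 t *\<^sub>R fst n + snd n')"
proof (rule prod_eqI)
  show "fst (kstep t G (kstep s G x n) n') = fst (kstep (s + t) G x (p0 t *\<^sub>R fst n + fst n', snd n + p1 t *\<^sub>R fst n + snd n'))"
    by (simp add: kstep_def p0_add p1_add algebra_simps)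
  show "snd (kstep t G (kstep s G x n) n') = snd (kstep (s + t) G x (p0 t *\<^sub>R fst n + fst n', snd n + p1 t *\<^sub>R fst n + snd n'))"
    by (simp add: kstep_def p1_add' p2_add algebra_simps)
qed

text \<open>The refreshment reads the velocity part of the same noise that drives
  \<open>kstep\<close>, which is the synchronous coupling. The position part has no counterpart here
  and is charged to the residual.\<close>

definition ystep :: "real \<Rightarrow> real \<Rightarrow> 'a \<times> 'a \<Rightarrow> 'a \<times> 'a \<Rightarrow> 'a \<times> 'a" where
  "ystep \<epsilon> u n z = (p0 \<epsilon> *\<^sub>R fst (metropolis \<epsilon> u z) + sqrt (2 * \<gamma>) *\<^sub>R fst n, snd (metropolis \<epsilon> u z))"

lemma measurable_kstep [measurable (raw)]:
  assumes [measurable]: "G \<in> borel_measurable N" "X \<in> N \<rightarrow>\<^sub>M borel \<Otimes>\<^sub>M borel" "n \<in> N \<rightarrow>\<^sub>M borel \<Otimes>\<^sub>M borel"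
  shows "(\<lambda>\<omega>. kstep t (G \<omega>) (X \<omega>) (n \<omega>)) \<in> N \<rightarrow>\<^sub>M borel \<Otimes>\<^sub>M borel"
  unfolding kstep_def by measurable

lemma measurable_ystep [measurable (raw)]:
  assumes [measurable]: "U \<in> borel_measurable N" "n \<in> N \<rightarrow>\<^sub>M borel \<Otimes>\<^sub>M borel" "Z \<in> N \<rightarrow>\<^sub>M borel \<Otimes>\<^sub>M borel"
  shows "(\<lambda>\<omega>. ystep \<epsilon> (U \<omega>) (n \<omega>) (Z \<omega>)) \<in> N \<rightarrow>\<^sub>M borel \<Otimes>\<^sub>M borel"
  unfolding ystep_def by measurable

text \<open>The variances balance: (p0 t)^2 + 2 \<gamma> c11 t = 1, so the refreshed velocity is
  again standard normal and independent of the position.\<close>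

lemma nn_integral_ou_step:
  assumes t: "0 \<le> t" and F [measurable]: "F \<in> borel_measurable (borel \<Otimes>\<^sub>M borel)"
  shows "(\<integral>\<^sup>+z. \<integral>\<^sup>+n. F (p0 t *\<^sub>R fst z + sqrt (2 * \<gamma>) *\<^sub>R fst n, snd z) \<partial>noise t \<partial>stationary) = (\<integral>\<^sup>+z. F z \<partial>stationary)"
proof -
  have noise: "(\<integral>\<^sup>+n. H (fst n) \<partial>noise t) = (\<integral>\<^sup>+z. H (n\<alpha> t *\<^sub>R z) \<partial>gaussian)"
    if [measurable]: "H \<in> borel_measurable borel" for H :: "'a \<Rightarrow> ennreal"
    unfolding noise_def by (subst nn_integral_gaussian_pair) (auto simp: gaussian.emeasure_space_1[simplified])
  have c: "(1::real)\<^sup>2 = (p0 t)\<^sup>2 + (sqrt (2 * \<gamma>) * n\<alpha> t)\<^sup>2"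
    using \<gamma>_pos noise_coeffs(1)[OF t] by (simp add: power_mult_distrib c11_def)
  have "(\<integral>\<^sup>+z. \<integral>\<^sup>+n. F (p0 t *\<^sub>R fst z + sqrt (2 * \<gamma>) *\<^sub>R fst n, snd z) \<partial>noise t \<partial>stationary)
    = (\<integral>\<^sup>+z. \<integral>\<^sup>+w. F (p0 t *\<^sub>R fst z + (sqrt (2 * \<gamma>) * n\<alpha> t) *\<^sub>R w, snd z) \<partial>gaussian \<partial>stationary)"
    by (rule nn_integral_cong, subst noise[of "\<lambda>n. F (p0 t *\<^sub>R fst z + sqrt (2 * \<gamma>) *\<^sub>R n, snd z)" for z]) auto
  also have "\<dots> = (\<integral>\<^sup>+v. \<integral>\<^sup>+x. \<integral>\<^sup>+w. F (p0 t *\<^sub>R v + (sqrt (2 * \<gamma>) * n\<alpha> t) *\<^sub>R w, x) \<partial>gaussian \<partial>target \<partial>gaussian)"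
    by (subst nn_integral_stationary) auto
  also have "\<dots> = (\<integral>\<^sup>+x. \<integral>\<^sup>+v. \<integral>\<^sup>+w. F (p0 t *\<^sub>R v + (sqrt (2 * \<gamma>) * n\<alpha> t) *\<^sub>R w, x) \<partial>gaussian \<partial>gaussian \<partial>target)"
  proof -
    interpret pair_sigma_finite "gaussian :: 'a measure" target ..
    show ?thesis by (rule Fubini'[symmetric]) measurable
  qed
  also have "\<dots> = (\<integral>\<^sup>+x. \<integral>\<^sup>+v. F (v, x) \<partial>gaussian \<partial>target)"
  proof (rule nn_integral_cong)
    fix x
    show "(\<integral>\<^sup>+v. \<integral>\<^sup>+w. F (p0 t *\<^sub>R v + (sqrt (2 * \<gamma>) * n\<alpha> t) *\<^sub>R w, x) \<partial>gaussian \<partial>gaussian) = (\<integral>\<^sup>+v. F (v, x) \<partial>gaussian)"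
      using nn_integral_gaussian_add[of "\<lambda>v. F (v, x)" 1, OF _ _ c] by simp
  qed
  also have "\<dots> = (\<integral>\<^sup>+v. \<integral>\<^sup>+x. F (v, x) \<partial>target \<partial>gaussian)"
  proof -
    interpret pair_sigma_finite "gaussian :: 'a measure" target ..
    show ?thesis by (rule Fubini') measurable
  qed
  also have "\<dots> = (\<integral>\<^sup>+z. F z \<partial>stationary)" by (rule nn_integral_stationary[symmetric]) measurable
  finally show ?thesis .
qed

lemma nn_integral_ystep:
  assumes t: "0 \<le> \<epsilon>" and F [measurable]: "F \<in> borel_measurable (borel \<Otimes>\<^sub>M borel)"
  shows "(\<integral>\<^sup>+z. \<integral>\<^sup>+u. \<integral>\<^sup>+n. F (ystep \<epsilon> u n z) \<partial>noise \<epsilon> \<partial>unif \<partial>stationary) = (\<integral>\<^sup>+z. F z \<partial>stationary)"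
  unfolding ystep_def
  using nn_integral_metropolis[of "\<lambda>z. \<integral>\<^sup>+n. F (p0 \<epsilon> *\<^sub>R fst z + sqrt (2 * \<gamma>) *\<^sub>R fst n, snd z) \<partial>noise \<epsilon>" \<epsilon>]
    nn_integral_ou_step[OF t F] by simp

end

section \<open>Local error of the stationary chain\<close>

context strongly_convex_smooth
begin

text \<open>The kinetic energy changes by minus the trapezoidal value of the increment of f, up to
  the \<epsilon>^2/8 term. What remains is the trapezoid error and a difference of squared gradients
  that tends to 0 with the displacement; both are o(\<epsilon>^2) at a fixed state.\<close>

lemma energy_leapfrog:
  fixes v x :: 'a and \<epsilon> :: real
  defines "d \<equiv> \<epsilon> *\<^sub>R (v - (\<epsilon> / 2) *\<^sub>R g x)"
  shows "energy (leapfrog \<epsilon> (v, x)) - energy (v, x)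
    = trapezoid_error x d + \<epsilon>\<^sup>2 / 8 * ((norm (g (x + d)))\<^sup>2 - (norm (g x))\<^sup>2)"
proof -
  define w where "w = v - (\<epsilon> / 2) *\<^sub>R g x"
  define y where "y = g (x + d)"
  have d: "d = \<epsilon> *\<^sub>R w" by (simp add: d_def w_def)
  have v: "v = w + (\<epsilon> / 2) *\<^sub>R g x" by (simp add: w_def)
  have "energy (leapfrog \<epsilon> (v, x)) = (norm (w - (\<epsilon> / 2) *\<^sub>R y))\<^sup>2 / 2 + f (x + d)"
    by (simp add: energy_def leapfrog_def Let_def y_def d w_def)
  moreover have "(norm (w - (\<epsilon> / 2) *\<^sub>R y))\<^sup>2 - (norm v)\<^sup>2
    = - ((g x + y) \<bullet> d) + \<epsilon>\<^sup>2 / 4 * ((norm y)\<^sup>2 - (norm (g x))\<^sup>2)"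
    unfolding v d power2_norm_eq_inner
    by (simp add: inner_simps inner_commute power2_eq_square field_simps)
  ultimately show ?thesis
    unfolding energy_def trapezoid_error_def y_def[symmetric] by (simp add: field_simps)
qed

lemma displacement_bound:
  assumes "0 \<le> \<epsilon>" "\<epsilon> \<le> 1"
  shows "norm (\<epsilon> *\<^sub>R (v - (\<epsilon> / 2) *\<^sub>R g x)) \<le> \<epsilon> * (norm v + norm (g x))"
proof -
  have "norm (v - (\<epsilon> / 2) *\<^sub>R g x) \<le> norm v + norm ((\<epsilon> / 2) *\<^sub>R g x)" by (rule norm_triangle_ineq4)
  also have "\<dots> \<le> norm v + 1 * norm (g x)" using assms mult_right_mono[of "\<epsilon> / 2" 1 "norm (g x)"] by simp
  finally show ?thesis using assms by (simp add: mult_left_mono)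
qed

lemma energy_leapfrog_bound:
  assumes \<epsilon>: "0 \<le> \<epsilon>" "\<epsilon> \<le> 1"
  shows "\<bar>energy (leapfrog \<epsilon> (v, x)) - energy (v, x)\<bar> \<le> (M + M\<^sup>2) * \<epsilon>\<^sup>2 * (norm v + norm (g x))\<^sup>2"
proof -
  define d where "d = \<epsilon> *\<^sub>R (v - (\<epsilon> / 2) *\<^sub>R g x)"
  define s where "s = norm v + norm (g x)"
  have s0: "0 \<le> s" by (simp add: s_def)
  have M0: "0 \<le> M" using M_pos by simp
  have d: "norm d \<le> \<epsilon> * s" unfolding d_def s_def by (rule displacement_bound[OF \<epsilon>])
  then have d': "norm d \<le> s" using \<epsilon> s0 mult_right_mono[of \<epsilon> 1 s] by simp
  have d2: "(norm d)\<^sup>2 \<le> \<epsilon>\<^sup>2 * s\<^sup>2" using d by (metis norm_ge_zero power_mono power_mult_distrib)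
  have "\<bar>trapezoid_error x d\<bar> \<le> M / 2 * (\<epsilon>\<^sup>2 * s\<^sup>2)"
    using trapezoid_error_bound[of x d] mult_left_mono[OF d2, of "M / 2"] M0 by simp
  moreover have "\<bar>(norm (g (x + d)))\<^sup>2 - (norm (g x))\<^sup>2\<bar> \<le> M * s * ((2 + M) * s)"
  proof -
    have diff: "\<bar>norm (g (x + d)) - norm (g x)\<bar> \<le> M * s"
      using norm_triangle_ineq3[of "g (x + d)" "g x"] g_lipschitz[of "x + d" x] mult_left_mono[OF d' M0] by simp
    have "norm (g x) \<le> s" by (simp add: s_def)
    then have "norm (g (x + d)) + norm (g x) \<le> (2 + M) * s" using diff by (simp add: algebra_simps)
    then have "\<bar>norm (g (x + d)) - norm (g x)\<bar> * (norm (g (x + d)) + norm (g x)) \<le> M * s * ((2 + M) * s)"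
      using diff s0 M0 by (intro mult_mono) auto
    moreover have "(norm (g (x + d)))\<^sup>2 - (norm (g x))\<^sup>2 = (norm (g (x + d)) - norm (g x)) * (norm (g (x + d)) + norm (g x))"
      by (simp add: power2_eq_square algebra_simps)
    ultimately show ?thesis by (simp add: abs_mult)
  qed
  then have "\<epsilon>\<^sup>2 / 8 * \<bar>(norm (g (x + d)))\<^sup>2 - (norm (g x))\<^sup>2\<bar> \<le> \<epsilon>\<^sup>2 / 8 * (M * s * ((2 + M) * s))"
    by (rule mult_left_mono) simp
  ultimately have "\<bar>energy (leapfrog \<epsilon> (v, x)) - energy (v, x)\<bar> \<le> M / 2 * (\<epsilon>\<^sup>2 * s\<^sup>2) + \<epsilon>\<^sup>2 / 8 * (M * s * ((2 + M) * s))"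
    unfolding energy_leapfrog d_def[symmetric]
    using abs_triangle_ineq[of "trapezoid_error x d" "\<epsilon>\<^sup>2 / 8 * ((norm (g (x + d)))\<^sup>2 - (norm (g x))\<^sup>2)"]
    by (simp only: abs_mult abs_divide abs_power2 abs_numeral)
  also have "\<dots> = (3/4 * M + 1/8 * M\<^sup>2) * (\<epsilon>\<^sup>2 * s\<^sup>2)" by (simp add: field_simps power2_eq_square)
  also have "\<dots> \<le> (M + M\<^sup>2) * (\<epsilon>\<^sup>2 * s\<^sup>2)" using M0 zero_le_power2[of M] by (intro mult_right_mono) (linarith, simp)
  finally show ?thesis by (simp add: s_def mult.assoc)
qed

lemma energy_leapfrog_small:
  assumes e: "0 < e"
  shows "\<exists>\<delta>>0. \<forall>\<epsilon>. 0 \<le> \<epsilon> \<and> \<epsilon> < \<delta> \<longrightarrow> \<bar>energy (leapfrog \<epsilon> (v, x)) - energy (v, x)\<bar> \<le> e * \<epsilon>\<^sup>2"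
proof -
  define s where "s = norm v + norm (g x)"
  have s0: "0 \<le> s" by (simp add: s_def)
  \<comment> \<open>The displacement is at most \<epsilon> s, so tolerance e1 for the trapezoid
    error costs e1 s^2 \<epsilon>^2. Adding 1 to s^2 covers s = 0.\<close>
  define e1 where "e1 = e / (2 * (s\<^sup>2 + 1))"
  have e1: "0 < e1" "e1 * s\<^sup>2 \<le> e / 2"
  proof -
    show "0 < e1" using e by (simp add: e1_def add_nonneg_pos)
    have "s\<^sup>2 / (s\<^sup>2 + 1) \<le> 1" by (simp add: divide_le_eq_1 add_nonneg_pos)
    then have "e / 2 * (s\<^sup>2 / (s\<^sup>2 + 1)) \<le> e / 2 * 1" using e by (intro mult_left_mono) auto
    then show "e1 * s\<^sup>2 \<le> e / 2" by (simp add: e1_def)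
  qed
  obtain \<delta>1 where \<delta>1: "0 < \<delta>1" "\<And>d. norm d < \<delta>1 \<Longrightarrow> \<bar>trapezoid_error x d\<bar> \<le> e1 * (norm d)\<^sup>2"
    using trapezoid_error_small[OF e1(1)] by blast
  have "((\<lambda>d. (norm (g (x + d)))\<^sup>2) \<longlongrightarrow> (norm (g (x + 0)))\<^sup>2) (at 0)"
    using g_continuous by (intro tendsto_intros continuous_on_tendsto_compose[OF g_continuous]) auto
  then have "\<forall>\<^sub>F d in at 0. dist ((norm (g (x + d)))\<^sup>2) ((norm (g x))\<^sup>2) < e"
    using e by (auto simp: tendsto_iff)
  then obtain \<delta>2 where \<delta>2: "0 < \<delta>2" "\<And>d. d \<noteq> 0 \<Longrightarrow> norm d < \<delta>2 \<Longrightarrow> \<bar>(norm (g (x + d)))\<^sup>2 - (norm (g x))\<^sup>2\<bar> < e"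
    by (auto simp: eventually_at dist_real_def)
  define \<delta> where "\<delta> = min 1 (min \<delta>1 \<delta>2 / (s + 1))"
  have "0 < \<delta>" using \<delta>1 \<delta>2 s0 by (simp add: \<delta>_def)
  moreover have "\<bar>energy (leapfrog \<epsilon> (v, x)) - energy (v, x)\<bar> \<le> e * \<epsilon>\<^sup>2" if \<epsilon>: "0 \<le> \<epsilon>" "\<epsilon> < \<delta>" for \<epsilon>
  proof -
    define d where "d = \<epsilon> *\<^sub>R (v - (\<epsilon> / 2) *\<^sub>R g x)"
    have \<epsilon>1: "\<epsilon> \<le> 1" using \<epsilon> by (simp add: \<delta>_def)
    have d: "norm d \<le> \<epsilon> * s" unfolding d_def s_def by (rule displacement_bound[OF \<epsilon>(1) \<epsilon>1])
    have "\<epsilon> * (s + 1) < min \<delta>1 \<delta>2" using \<epsilon> s0 by (auto simp: \<delta>_def pos_less_divide_eq)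
    then have dl: "norm d < \<delta>1" "norm d < \<delta>2" using d \<epsilon>(1) by (auto simp: algebra_simps)
    have d2: "(norm d)\<^sup>2 \<le> \<epsilon>\<^sup>2 * s\<^sup>2" using d by (metis norm_ge_zero power_mono power_mult_distrib)
    have "\<bar>trapezoid_error x d\<bar> \<le> e1 * (\<epsilon>\<^sup>2 * s\<^sup>2)"
      by (rule order_trans[OF \<delta>1(2)[OF dl(1)] mult_left_mono[OF d2 less_imp_le[OF e1(1)]]])
    also have "\<dots> \<le> e / 2 * \<epsilon>\<^sup>2" using mult_right_mono[OF e1(2), of "\<epsilon>\<^sup>2"] by (simp add: mult_ac)
    finally have 1: "\<bar>trapezoid_error x d\<bar> \<le> e / 2 * \<epsilon>\<^sup>2" .
    have "\<bar>(norm (g (x + d)))\<^sup>2 - (norm (g x))\<^sup>2\<bar> \<le> e"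
      using \<delta>2(2)[OF _ dl(2)] e by (cases "d = 0") auto
    then have "\<epsilon>\<^sup>2 / 8 * \<bar>(norm (g (x + d)))\<^sup>2 - (norm (g x))\<^sup>2\<bar> \<le> \<epsilon>\<^sup>2 / 8 * e" by (rule mult_left_mono) simp
    also have "\<dots> \<le> e / 2 * \<epsilon>\<^sup>2" using e by simp
    finally show ?thesis
      using 1 abs_triangle_ineq[of "trapezoid_error x d" "\<epsilon>\<^sup>2 / 8 * ((norm (g (x + d)))\<^sup>2 - (norm (g x))\<^sup>2)"]
      unfolding energy_leapfrog d_def[symmetric] abs_mult abs_divide abs_power2 abs_numeral by linarith
  qed
  ultimately show ?thesis by blast
qed

lemma one_minus_accept_prob_le: "1 - accept_prob \<epsilon> z \<le> \<bar>energy (leapfrog \<epsilon> z) - energy z\<bar>"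
  using exp_ge_add_one_self[of "energy z - energy (leapfrog \<epsilon> z)"] unfolding accept_prob_def by linarith

text \<open>The damage of a rejection, compared with a kinetic step: the reversed velocity costs
  2|v|, the gradient kick that did not happen costs \<epsilon>|g|.\<close>

definition rejection_size :: "real \<Rightarrow> 'a \<times> 'a \<Rightarrow> real" where
  "rejection_size \<epsilon> z = 2 * norm (fst z) + \<epsilon> * norm (g (snd z))"

lemma borel_measurable_rejection_size [measurable]: "rejection_size \<epsilon> \<in> borel_measurable (borel \<Otimes>\<^sub>M borel)"
  unfolding rejection_size_def by measurable

text \<open>The velocity part of the jump is divided by \<epsilon>^2 and relies on the
  O(\<epsilon>^2) bound for the rejection probability; for the gradient part probability at most 1
  is enough. The resulting bound does not depend on \<epsilon> and is integrable because the
  velocity has a fourth moment.\<close>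

lemma rejection_dominated:
  assumes \<epsilon>: "0 < \<epsilon>" "\<epsilon> \<le> 1"
  shows "(1 - accept_prob \<epsilon> z) * (rejection_size \<epsilon> z / \<epsilon>)\<^sup>2
    \<le> 8 * (M + M\<^sup>2) * (norm (fst z) + norm (g (snd z)))\<^sup>2 * (norm (fst z))\<^sup>2 + 2 * (norm (g (snd z)))\<^sup>2"
proof -
  obtain v x where z: "z = (v, x)" by (cases z)
  define s where "s = norm v + norm (g x)"
  define q where "q = 1 - accept_prob \<epsilon> z"
  have q: "0 \<le> q" "q \<le> 1" using accept_prob_bounds[of \<epsilon> z] by (auto simp: q_def)
  have q': "q \<le> (M + M\<^sup>2) * \<epsilon>\<^sup>2 * s\<^sup>2"
    using one_minus_accept_prob_le[of \<epsilon> z] energy_leapfrog_bound[of \<epsilon> v x] \<epsilon> by (simp add: q_def z s_def)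
  have "rejection_size \<epsilon> z / \<epsilon> = 2 * norm v / \<epsilon> + norm (g x)"
    using \<epsilon> by (simp add: rejection_size_def z field_simps)
  moreover have "(2 * norm v / \<epsilon> + norm (g x))\<^sup>2 \<le> 2 * (2 * norm v / \<epsilon>)\<^sup>2 + 2 * (norm (g x))\<^sup>2"
    using sum_squares_bound[of "2 * norm v / \<epsilon>" "norm (g x)"] by (simp add: power2_sum)
  ultimately have "q * (rejection_size \<epsilon> z / \<epsilon>)\<^sup>2 \<le> q * (2 * (2 * norm v / \<epsilon>)\<^sup>2 + 2 * (norm (g x))\<^sup>2)"
    using q by (simp add: mult_left_mono)
  also have "\<dots> = q * (8 * (norm v)\<^sup>2 / \<epsilon>\<^sup>2) + q * (2 * (norm (g x))\<^sup>2)"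
    by (simp add: power_divide power_mult_distrib algebra_simps)
  also have "\<dots> \<le> (M + M\<^sup>2) * \<epsilon>\<^sup>2 * s\<^sup>2 * (8 * (norm v)\<^sup>2 / \<epsilon>\<^sup>2) + 1 * (2 * (norm (g x))\<^sup>2)"
    using q q' by (intro add_mono mult_right_mono) auto
  also have "\<dots> = 8 * (M + M\<^sup>2) * s\<^sup>2 * (norm v)\<^sup>2 + 2 * (norm (g x))\<^sup>2"
    using \<epsilon> by (simp add: field_simps)
  finally show ?thesis by (simp add: q_def s_def z)
qed

lemma stationary_velocity_second_moment: "L2le stationary fst (sqrt DIM('a))"
proof (rule L2leI)
  have "(\<integral>\<^sup>+z. ennreal ((norm (fst z))\<^sup>2) \<partial>stationary) = (\<integral>\<^sup>+(v::'a). ennreal ((norm v)\<^sup>2) \<partial>gaussian)"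
    by (subst nn_integral_stationary) auto
  then show "(\<integral>\<^sup>+z. ennreal ((norm (fst z))\<^sup>2) \<partial>stationary) \<le> ennreal ((sqrt DIM('a))\<^sup>2)"
    by (simp add: gaussian_second_moment)
qed auto

lemma stationary_gradient_second_moment: "\<exists>c. L2le stationary (\<lambda>z. g (snd z)) c"
proof -
  obtain b where b: "0 \<le> b" "(\<integral>\<^sup>+x. ennreal ((norm (g x))\<^sup>2) \<partial>target) = ennreal b"
    using target_gradient_second_moment by (cases "\<integral>\<^sup>+x. ennreal ((norm (g x))\<^sup>2) \<partial>target") auto
  have "(\<integral>\<^sup>+z. ennreal ((norm (g (snd z)))\<^sup>2) \<partial>stationary) = (\<integral>\<^sup>+x. ennreal ((norm (g x))\<^sup>2) \<partial>target)"
    by (subst nn_integral_stationary) (auto simp: gaussian.emeasure_space_1[simplified])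
  then have "L2le stationary (\<lambda>z. g (snd z)) (sqrt b)"
    using b by (intro L2leI) auto
  then show ?thesis by blast
qed

lemma rejection_dominated_integrable:
  "(\<integral>\<^sup>+z. ennreal (8 * (M + M\<^sup>2) * (norm (fst z) + norm (g (snd z)))\<^sup>2 * (norm (fst z))\<^sup>2 + 2 * (norm (g (snd z)))\<^sup>2) \<partial>stationary) < \<infinity>"
proof -
  define K where "K = 16 * (M + M\<^sup>2)"
  have K: "0 \<le> K" using M_pos by (simp add: K_def)
  have b: "8 * (M + M\<^sup>2) * (norm v + norm (g x))\<^sup>2 * (norm v)\<^sup>2 + 2 * (norm (g x))\<^sup>2
    \<le> K * (norm v) ^ 4 + (K * (norm v)\<^sup>2 + 2) * (norm (g x))\<^sup>2" for v x :: 'a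
  proof -
    have "(norm v + norm (g x))\<^sup>2 \<le> 2 * (norm v)\<^sup>2 + 2 * (norm (g x))\<^sup>2"
      using sum_squares_bound[of "norm v" "norm (g x)"] by (simp add: power2_sum)
    then have "8 * (M + M\<^sup>2) * (norm v)\<^sup>2 * (norm v + norm (g x))\<^sup>2 \<le> 8 * (M + M\<^sup>2) * (norm v)\<^sup>2 * (2 * (norm v)\<^sup>2 + 2 * (norm (g x))\<^sup>2)"
      using M_pos by (intro mult_left_mono) auto
    then show ?thesis by (simp add: K_def power4_eq_xxxx power2_eq_square algebra_simps)
  qed
  have "(\<integral>\<^sup>+z. ennreal (8 * (M + M\<^sup>2) * (norm (fst z) + norm (g (snd z)))\<^sup>2 * (norm (fst z))\<^sup>2 + 2 * (norm (g (snd z)))\<^sup>2) \<partial>stationary)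
    = (\<integral>\<^sup>+(v::'a). \<integral>\<^sup>+x. ennreal (8 * (M + M\<^sup>2) * (norm v + norm (g x))\<^sup>2 * (norm v)\<^sup>2 + 2 * (norm (g x))\<^sup>2) \<partial>target \<partial>gaussian)"
    by (subst nn_integral_stationary) auto
  also have "\<dots> \<le> (\<integral>\<^sup>+(v::'a). \<integral>\<^sup>+x. ennreal K * ennreal ((norm v) ^ 4) + (ennreal K * ennreal ((norm v)\<^sup>2) + 2) * ennreal ((norm (g x))\<^sup>2) \<partial>target \<partial>gaussian)"
  proof (intro nn_integral_mono)
    fix v x :: 'a
    have "ennreal K * ennreal ((norm v) ^ 4) + (ennreal K * ennreal ((norm v)\<^sup>2) + 2) * ennreal ((norm (g x))\<^sup>2)
      = ennreal (K * (norm v) ^ 4 + (K * (norm v)\<^sup>2 + 2) * (norm (g x))\<^sup>2)"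
      using K by (simp add: ennreal_mult ennreal_plus)
    then show "ennreal (8 * (M + M\<^sup>2) * (norm v + norm (g x))\<^sup>2 * (norm v)\<^sup>2 + 2 * (norm (g x))\<^sup>2)
      \<le> ennreal K * ennreal ((norm v) ^ 4) + (ennreal K * ennreal ((norm v)\<^sup>2) + 2) * ennreal ((norm (g x))\<^sup>2)"
      using b by (simp add: ennreal_leI)
  qed
  also have "\<dots> = ennreal K * (\<integral>\<^sup>+(v::'a). ennreal ((norm v) ^ 4) \<partial>gaussian)
    + (ennreal K * (\<integral>\<^sup>+(v::'a). ennreal ((norm v)\<^sup>2) \<partial>gaussian) + 2) * (\<integral>\<^sup>+x. ennreal ((norm (g x))\<^sup>2) \<partial>target)"
    by (simp add: nn_integral_add nn_integral_cmult nn_integral_multc gaussian.emeasure_space_1[simplified])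
  also have "\<dots> < \<infinity>"
    using gaussian_fourth_moment[where 'a='a] target_gradient_second_moment
    by (simp add: gaussian_second_moment ennreal_mult_less_top of_nat_less_top)
  finally show ?thesis .
qed

text \<open>The trapezoidal rule makes the energy error, hence the rejection probability, \<open>o(\<epsilon>\<^sup>2)\<close> pointwise;
  dominated convergence turns this into an \<open>o(\<epsilon>)\<close> bound in \<open>L\<^sup>2\<close> for the jump caused by a rejection.\<close>

lemma rejection_tendsto_0:
  assumes \<epsilon>: "\<And>N. 0 < \<epsilon> N" "\<And>N. \<epsilon> N \<le> 1" and \<epsilon>0: "\<epsilon> \<longlonglongrightarrow> 0"
  shows "(\<lambda>N. \<integral>\<^sup>+z. ennreal ((1 - accept_prob (\<epsilon> N) z) * (rejection_size (\<epsilon> N) z / \<epsilon> N)\<^sup>2) \<partial>stationary) \<longlonglongrightarrow> 0"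
proof -
  let ?u = "\<lambda>N z. (1 - accept_prob (\<epsilon> N) z) * (rejection_size (\<epsilon> N) z / \<epsilon> N)\<^sup>2"
  let ?w = "\<lambda>z. 8 * (M + M\<^sup>2) * (norm (fst z) + norm (g (snd z)))\<^sup>2 * (norm (fst z))\<^sup>2 + 2 * (norm (g (snd z)))\<^sup>2"
  have pt: "(\<lambda>N. ?u N z) \<longlonglongrightarrow> 0" for z
  proof -
    obtain v x where z: "z = (v, x)" by (cases z)
    define B where "B = (2 * norm v + norm (g x))\<^sup>2"
    have B: "0 \<le> B" by (simp add: B_def)
    have u0: "0 \<le> ?u N z" for N using accept_prob_bounds[of "\<epsilon> N" z] by simp
    have ub: "?u N z \<le> (1 - accept_prob (\<epsilon> N) z) / (\<epsilon> N)\<^sup>2 * B" for N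
    proof -
      have "rejection_size (\<epsilon> N) z \<le> 2 * norm v + 1 * norm (g x)"
        unfolding rejection_size_def z using \<epsilon>(2)[of N] mult_right_mono[of "\<epsilon> N" 1 "norm (g x)"] by simp
      moreover have "0 \<le> rejection_size (\<epsilon> N) z" using \<epsilon>(1)[of N] \<epsilon>(2)[of N] by (simp add: rejection_size_def)
      ultimately have "(rejection_size (\<epsilon> N) z)\<^sup>2 \<le> B" unfolding B_def by (intro power_mono) auto
      then have "(1 - accept_prob (\<epsilon> N) z) / (\<epsilon> N)\<^sup>2 * (rejection_size (\<epsilon> N) z)\<^sup>2 \<le> (1 - accept_prob (\<epsilon> N) z) / (\<epsilon> N)\<^sup>2 * B"
        using accept_prob_bounds[of "\<epsilon> N" z] by (intro mult_left_mono) auto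
      then show ?thesis by (simp add: power_divide)
    qed
    show ?thesis
    proof (rule LIMSEQ_I)
      fix e :: real assume e: "0 < e"
      define e' where "e' = e / (2 * (B + 1))"
      have e': "0 < e'" "e' * B < e"
      proof -
        show "0 < e'" using e B by (simp add: e'_def)
        have "e' * B \<le> e' * (B + 1)" using \<open>0 < e'\<close> by simp
        also have "\<dots> = e / 2" using B by (simp add: e'_def field_simps)
        finally show "e' * B < e" using e by simp
      qed
      obtain \<delta> where \<delta>: "0 < \<delta>" "\<And>\<epsilon>. 0 \<le> \<epsilon> \<Longrightarrow> \<epsilon> < \<delta> \<Longrightarrow> \<bar>energy (leapfrog \<epsilon> (v, x)) - energy (v, x)\<bar> \<le> e' * \<epsilon>\<^sup>2"
        using energy_leapfrog_small[OF e'(1), of v x] by blast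
      obtain N0 where N0: "\<And>N. N \<ge> N0 \<Longrightarrow> \<epsilon> N < \<delta>"
        using LIMSEQ_D[OF \<epsilon>0 \<delta>(1)] \<epsilon> by (metis abs_of_pos diff_zero real_norm_def)
      have "norm (?u N z - 0) < e" if "N \<ge> N0" for N
      proof -
        have "1 - accept_prob (\<epsilon> N) z \<le> e' * (\<epsilon> N)\<^sup>2"
          using one_minus_accept_prob_le[of "\<epsilon> N" z] \<delta>(2)[of "\<epsilon> N"] N0[OF that] \<epsilon>(1)[of N] by (simp add: z)
        then have "(1 - accept_prob (\<epsilon> N) z) / (\<epsilon> N)\<^sup>2 \<le> e'" using \<epsilon>(1)[of N] \<epsilon>(2)[of N] by (simp add: pos_divide_le_eq)
        then have "?u N z \<le> e' * B" using ub[of N] mult_right_mono[OF _ B] by (meson order_trans)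
        then show ?thesis using e'(2) u0[of N] by simp
      qed
      then show "\<exists>no. \<forall>n\<ge>no. norm (?u n z - 0) < e" by blast
    qed
  qed
  have "(\<lambda>N. \<integral>\<^sup>+z. ennreal (?u N z) \<partial>stationary) \<longlonglongrightarrow> (\<integral>\<^sup>+z. 0 \<partial>stationary)"
  proof (rule nn_integral_dominated_convergence[where w="\<lambda>z. ennreal (?w z)"])
    show "(\<integral>\<^sup>+z. ennreal (?w z) \<partial>stationary) < \<infinity>" by (rule rejection_dominated_integrable)
    show "AE z in stationary. ennreal (?u N z) \<le> ennreal (?w z)" for N
      using rejection_dominated[OF \<epsilon>] by (intro AE_I2 ennreal_leI)
    show "AE z in stationary. (\<lambda>N. ennreal (?u N z)) \<longlonglongrightarrow> 0"
      using pt tendsto_ennrealI[OF pt] by (intro AE_I2) simp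
  qed measurable
  then show ?thesis by simp
qed

end

section \<open>The one-step residual of the stationary chain\<close>

context kinetic
begin

definition local_space :: "real \<Rightarrow> (('a \<times> 'a) \<times> real \<times> ('a \<times> 'a)) measure" where
  "local_space \<epsilon> = stationary \<Otimes>\<^sub>M (unif \<Otimes>\<^sub>M noise \<epsilon>)"

lemma sets_local_space [simp, measurable_cong]:
  "sets (local_space \<epsilon>) = sets ((borel \<Otimes>\<^sub>M borel) \<Otimes>\<^sub>M (borel \<Otimes>\<^sub>M (borel \<Otimes>\<^sub>M borel)))"
  unfolding local_space_def by (intro sets_pair_measure_cong) auto

lemma prob_space_noise_pair: "prob_space (unif \<Otimes>\<^sub>M noise \<epsilon>)"
  by (intro prob_space_pair unif.prob_space_axioms noise.prob_space_axioms)

text \<open>The local defect of the stationary chain against a kinetic step with the same noise and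
  with the gradient at its own current position.\<close>

definition residual :: "real \<Rightarrow> ('a \<times> 'a) \<times> real \<times> ('a \<times> 'a) \<Rightarrow> 'a \<times> 'a" where
  "residual \<epsilon> \<omega> = ystep \<epsilon> (fst (snd \<omega>)) (snd (snd \<omega>)) (fst \<omega>) - kstep \<epsilon> (g (snd (fst \<omega>))) (fst \<omega>) (snd (snd \<omega>))"

definition rejection_jump :: "real \<Rightarrow> ('a \<times> 'a) \<times> real \<times> ('a \<times> 'a) \<Rightarrow> real" where
  "rejection_jump \<epsilon> \<omega> = (if fst (snd \<omega>) \<le> accept_prob \<epsilon> (fst \<omega>) then 0 else rejection_size \<epsilon> (fst \<omega>))"

lemma measurable_residual [measurable]:
  "(\<lambda>\<omega>. fst (residual \<epsilon> \<omega>)) \<in> borel_measurable (local_space \<epsilon>)" "(\<lambda>\<omega>. snd (residual \<epsilon> \<omega>)) \<in> borel_measurable (local_space \<epsilon>)"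
  unfolding residual_def kstep_def ystep_def by simp_all

lemma measurable_rejection_jump [measurable]: "rejection_jump \<epsilon> \<in> borel_measurable (local_space \<epsilon>)"
  unfolding rejection_jump_def by measurable

lemma nn_integral_local_space:
  assumes [measurable]: "F \<in> borel_measurable ((borel \<Otimes>\<^sub>M borel) \<Otimes>\<^sub>M (borel \<Otimes>\<^sub>M (borel \<Otimes>\<^sub>M borel)))"
  shows "(\<integral>\<^sup>+\<omega>. F \<omega> \<partial>local_space \<epsilon>) = (\<integral>\<^sup>+z. \<integral>\<^sup>+u. \<integral>\<^sup>+n. F (z, u, n) \<partial>noise \<epsilon> \<partial>unif \<partial>stationary)"
proof -
  interpret N: prob_space "unif \<Otimes>\<^sub>M noise \<epsilon>" by (rule prob_space_noise_pair)
  have "(\<integral>\<^sup>+\<omega>. F \<omega> \<partial>local_space \<epsilon>) = (\<integral>\<^sup>+z. \<integral>\<^sup>+p. F (z, p) \<partial>(unif \<Otimes>\<^sub>M noise \<epsilon>) \<partial>stationary)"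
    unfolding local_space_def by (rule N.nn_integral_fst[symmetric]) measurable
  also have "\<dots> = (\<integral>\<^sup>+z. \<integral>\<^sup>+u. \<integral>\<^sup>+n. F (z, u, n) \<partial>noise \<epsilon> \<partial>unif \<partial>stationary)"
  proof (rule nn_integral_cong)
    fix z :: "'a \<times> 'a"
    have "(\<lambda>p. F (z, p)) \<in> borel_measurable (borel \<Otimes>\<^sub>M (borel \<Otimes>\<^sub>M borel))"
      by (rule measurable_compose[OF measurable_Pair1' assms]) (simp add: space_pair_measure)
    then have "(\<lambda>p. F (z, p)) \<in> borel_measurable (unif \<Otimes>\<^sub>M noise \<epsilon>)"
      by (simp cong: measurable_cong_sets)
    then show "(\<integral>\<^sup>+p. F (z, p) \<partial>(unif \<Otimes>\<^sub>M noise \<epsilon>)) = (\<integral>\<^sup>+u. \<integral>\<^sup>+n. F (z, u, n) \<partial>noise \<epsilon> \<partial>unif)"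
      by (rule noise.nn_integral_fst[symmetric])
  qed
  finally show ?thesis .
qed

lemma L2le_rejection_jump:
  assumes \<epsilon>: "0 < \<epsilon>" and e: "0 \<le> e"
    and le: "(\<integral>\<^sup>+z. ennreal ((1 - accept_prob \<epsilon> z) * (rejection_size \<epsilon> z / \<epsilon>)\<^sup>2) \<partial>stationary) \<le> ennreal (e\<^sup>2)"
  shows "L2le (local_space \<epsilon>) (rejection_jump \<epsilon>) (\<epsilon> * e)"
proof (rule L2leI)
  have "(\<integral>\<^sup>+\<omega>. ennreal ((norm (rejection_jump \<epsilon> \<omega>))\<^sup>2) \<partial>local_space \<epsilon>)
    = (\<integral>\<^sup>+z. \<integral>\<^sup>+u. (if u \<le> accept_prob \<epsilon> z then 0 else ennreal ((rejection_size \<epsilon> z)\<^sup>2)) \<partial>unif \<partial>stationary)"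
    by (subst nn_integral_local_space)
      (auto simp: rejection_jump_def noise.emeasure_space_1 intro!: nn_integral_cong)
  also have "\<dots> = (\<integral>\<^sup>+z. ennreal (\<epsilon>\<^sup>2) * ennreal ((1 - accept_prob \<epsilon> z) * (rejection_size \<epsilon> z / \<epsilon>)\<^sup>2) \<partial>stationary)"
    using \<epsilon> accept_prob_bounds
    by (intro nn_integral_cong) (simp add: nn_integral_unif_threshold ennreal_mult[symmetric] power_divide)
  also have "\<dots> = ennreal (\<epsilon>\<^sup>2) * (\<integral>\<^sup>+z. ennreal ((1 - accept_prob \<epsilon> z) * (rejection_size \<epsilon> z / \<epsilon>)\<^sup>2) \<partial>stationary)"
    by (rule nn_integral_cmult) measurable
  also have "\<dots> \<le> ennreal (\<epsilon>\<^sup>2) * ennreal (e\<^sup>2)" using le by (rule mult_left_mono) simp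
  finally show "(\<integral>\<^sup>+\<omega>. ennreal ((norm (rejection_jump \<epsilon> \<omega>))\<^sup>2) \<partial>local_space \<epsilon>) \<le> ennreal ((\<epsilon> * e)\<^sup>2)"
    by (simp add: ennreal_mult power_mult_distrib)
qed (use \<epsilon> e in auto)

text \<open>On acceptance the two steps agree to first order in \<epsilon> apart from the position
  noise: the velocity noise cancels, and what is left are second-order errors of \<open>p0\<close>,
  \<open>p1\<close>, \<open>p2\<close> and the change of g over one leapfrog step. On rejection
  \<open>rejection_size\<close> covers the whole difference.\<close>

lemma residual_bounds:
  fixes \<epsilon> :: real
  assumes \<epsilon>: "0 < \<epsilon>" "\<epsilon> \<le> 1"
  defines "s \<equiv> \<lambda>\<omega>. norm (fst (fst \<omega>)) + norm (g (snd (fst \<omega>)))"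
  shows "norm (fst (residual \<epsilon> \<omega>)) \<le> (\<gamma> + M + 1) * \<epsilon>\<^sup>2 * s \<omega> + rejection_jump \<epsilon> \<omega>"
    "norm (snd (residual \<epsilon> \<omega>)) \<le> (\<gamma> + M + 1) * \<epsilon>\<^sup>2 * s \<omega> + rejection_jump \<epsilon> \<omega> + sqrt (2 * \<gamma>) * norm (snd (snd (snd \<omega>)))"
proof -
  obtain v x u n where \<omega>: "\<omega> = ((v, x), u, n)" by (metis prod.exhaust)
  define G where "G = g x"
  have s: "s \<omega> = norm v + norm G" "0 \<le> s \<omega>" by (simp_all add: s_def \<omega> G_def)
  have M0: "0 < M" by (rule M_pos)
  have e0: "0 \<le> \<epsilon>" using \<epsilon> by simp
  have p0b: "0 \<le> p0 \<epsilon>" "p0 \<epsilon> \<le> 1" "1 - p0 \<epsilon> \<le> \<gamma> * \<epsilon>" using p0_pos[of \<epsilon>] p0_le_1[OF e0] p0_lower[of \<epsilon>] by auto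
  note p1b = p1_bounds[OF e0] and p2b = p2_bounds[OF e0]
  have \<epsilon>2: "\<epsilon>\<^sup>2 \<le> \<epsilon>" using \<epsilon> by (simp add: power2_eq_square mult_left_le_one_le)
  have Cs: "k * \<epsilon>\<^sup>2 * norm v + l * \<epsilon>\<^sup>2 * norm G \<le> (\<gamma> + M + 1) * \<epsilon>\<^sup>2 * s \<omega>" if "k \<le> \<gamma> + M + 1" "l \<le> \<gamma> + M + 1" for k l
    unfolding s distrib_left using that by (intro add_mono mult_right_mono) auto
  show "norm (fst (residual \<epsilon> \<omega>)) \<le> (\<gamma> + M + 1) * \<epsilon>\<^sup>2 * s \<omega> + rejection_jump \<epsilon> \<omega>"
  proof (cases "u \<le> accept_prob \<epsilon> (v, x)")
    case True
    define d where "d = \<epsilon> *\<^sub>R (v - (\<epsilon> / 2) *\<^sub>R G)"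
    define y where "y = g (x + d)"
    have d: "norm d \<le> \<epsilon> * (norm v + norm G)" unfolding d_def G_def by (rule displacement_bound[OF e0 \<epsilon>(2)])
    have "norm (y - G) \<le> M * norm d" using g_lipschitz[of "x + d" x] by (simp add: y_def G_def)
    also have "\<dots> \<le> M * (\<epsilon> * (norm v + norm G))" using d M0 by simp
    finally have y: "norm (y - G) \<le> M * (\<epsilon> * (norm v + norm G))" .
    have "fst (residual \<epsilon> \<omega>) = (p1 \<epsilon> - \<epsilon> * p0 \<epsilon>) *\<^sub>R G - (p0 \<epsilon> * (\<epsilon> / 2)) *\<^sub>R (y - G)"
      using True by (simp add: residual_def \<omega> ystep_def kstep_def metropolis_def leapfrog_def Let_def y_def d_def G_def algebra_simps)
        (simp add: scaleR_add_left[symmetric])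
    also have "norm \<dots> \<le> norm ((p1 \<epsilon> - \<epsilon> * p0 \<epsilon>) *\<^sub>R G) + norm ((p0 \<epsilon> * (\<epsilon> / 2)) *\<^sub>R (y - G))"
      by (rule norm_triangle_ineq4)
    also have "\<dots> \<le> (\<gamma> * \<epsilon>\<^sup>2) * norm G + (1 * (\<epsilon> / 2)) * (M * (\<epsilon> * (norm v + norm G)))"
    proof -
      have "p1 \<epsilon> - \<epsilon> * p0 \<epsilon> \<le> \<epsilon> * (1 - p0 \<epsilon>)" using p1b by (simp add: algebra_simps)
      also have "\<dots> \<le> \<epsilon> * (\<gamma> * \<epsilon>)" using p0b e0 by (intro mult_left_mono) auto
      finally have "\<bar>p1 \<epsilon> - \<epsilon> * p0 \<epsilon>\<bar> \<le> \<gamma> * \<epsilon>\<^sup>2" using p1b by (simp add: power2_eq_square mult_ac)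
      moreover have "\<bar>p0 \<epsilon> * (\<epsilon> / 2)\<bar> \<le> 1 * (\<epsilon> / 2)" using p0b e0 by (simp add: abs_mult mult_left_le_one_le)
      ultimately show ?thesis unfolding norm_scaleR using y e0 by (intro add_mono mult_mono) auto
    qed
    also have "\<dots> = (M / 2) * \<epsilon>\<^sup>2 * norm v + (\<gamma> + M / 2) * \<epsilon>\<^sup>2 * norm G"
      by (simp add: power2_eq_square field_simps)
    also have "\<dots> \<le> (\<gamma> + M + 1) * \<epsilon>\<^sup>2 * s \<omega>" using M0 \<gamma>_pos by (intro Cs) auto
    finally show ?thesis using True by (simp add: rejection_jump_def \<omega>)
  next
    case False
    have "fst (residual \<epsilon> \<omega>) = p1 \<epsilon> *\<^sub>R G - (2 * p0 \<epsilon>) *\<^sub>R v"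
      using False by (simp add: residual_def \<omega> ystep_def kstep_def metropolis_def flip_def G_def algebra_simps)
        (simp add: scaleR_add_left[symmetric])
    also have "norm \<dots> \<le> norm (p1 \<epsilon> *\<^sub>R G) + norm ((2 * p0 \<epsilon>) *\<^sub>R v)" by (rule norm_triangle_ineq4)
    also have "\<dots> \<le> \<epsilon> * norm G + 2 * norm v"
      unfolding norm_scaleR using p1b p0b by (intro add_mono mult_right_mono) auto
    also have "\<dots> = rejection_jump \<epsilon> \<omega>" using False by (simp add: rejection_jump_def rejection_size_def \<omega> G_def)
    also have "\<dots> \<le> (\<gamma> + M + 1) * \<epsilon>\<^sup>2 * s \<omega> + rejection_jump \<epsilon> \<omega>" using s M0 \<gamma>_pos by simp
    finally show ?thesis .
  qed
  have n: "norm (sqrt (2 * \<gamma>) *\<^sub>R snd n) = sqrt (2 * \<gamma>) * norm (snd (snd (snd \<omega>)))"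
    using \<gamma>_pos by (simp add: \<omega>)
  \<comment> \<open>The residual contains minus the position noise, since only \<open>kstep\<close>
    uses it. Adding it back isolates the part controlled by the state.\<close>
  have "norm (snd (residual \<epsilon> \<omega>) + sqrt (2 * \<gamma>) *\<^sub>R snd n) \<le> (\<gamma> + M + 1) * \<epsilon>\<^sup>2 * s \<omega> + rejection_jump \<epsilon> \<omega>"
  proof (cases "u \<le> accept_prob \<epsilon> (v, x)")
    case True
    have "snd (residual \<epsilon> \<omega>) + sqrt (2 * \<gamma>) *\<^sub>R snd n = (\<epsilon> - p1 \<epsilon>) *\<^sub>R v + (p2 \<epsilon> - \<epsilon>\<^sup>2 / 2) *\<^sub>R G"
      using True by (simp add: residual_def \<omega> ystep_def kstep_def metropolis_def leapfrog_def Let_def G_def power2_eq_square algebra_simps)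
    also have "norm \<dots> \<le> norm ((\<epsilon> - p1 \<epsilon>) *\<^sub>R v) + norm ((p2 \<epsilon> - \<epsilon>\<^sup>2 / 2) *\<^sub>R G)" by (rule norm_triangle_ineq)
    also have "\<dots> \<le> \<gamma> * \<epsilon>\<^sup>2 * norm v + 1 * \<epsilon>\<^sup>2 * norm G"
    proof -
      have "\<epsilon> - p1 \<epsilon> = \<gamma> * p2 \<epsilon>" using p1_p2[of \<epsilon>] by simp
      also have "\<dots> \<le> \<gamma> * \<epsilon>\<^sup>2" using p2b \<gamma>_pos by (intro mult_left_mono) auto
      finally have "\<bar>\<epsilon> - p1 \<epsilon>\<bar> \<le> \<gamma> * \<epsilon>\<^sup>2" using p1b by simp
      moreover have "\<bar>p2 \<epsilon> - \<epsilon>\<^sup>2 / 2\<bar> \<le> 1 * \<epsilon>\<^sup>2" using p2b by simp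
      ultimately show ?thesis unfolding norm_scaleR by (intro add_mono mult_right_mono) auto
    qed
    also have "\<dots> \<le> (\<gamma> + M + 1) * \<epsilon>\<^sup>2 * s \<omega>" using M0 \<gamma>_pos by (intro Cs) auto
    finally show ?thesis using True by (simp add: rejection_jump_def \<omega>)
  next
    case False
    have "snd (residual \<epsilon> \<omega>) + sqrt (2 * \<gamma>) *\<^sub>R snd n = p2 \<epsilon> *\<^sub>R G - p1 \<epsilon> *\<^sub>R v"
      using False by (simp add: residual_def \<omega> ystep_def kstep_def metropolis_def flip_def G_def algebra_simps)
    also have "norm \<dots> \<le> norm (p2 \<epsilon> *\<^sub>R G) + norm (p1 \<epsilon> *\<^sub>R v)" by (rule norm_triangle_ineq4)
    also have "\<dots> \<le> \<epsilon> * norm G + 2 * norm v"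
    proof -
      have "\<bar>p2 \<epsilon>\<bar> \<le> \<epsilon>" "\<bar>p1 \<epsilon>\<bar> \<le> 2" using p2b p1b \<epsilon> \<epsilon>2 by (simp_all add: field_simps)
      then show ?thesis unfolding norm_scaleR by (intro add_mono mult_right_mono) auto
    qed
    also have "\<dots> = rejection_jump \<epsilon> \<omega>" using False by (simp add: rejection_jump_def rejection_size_def \<omega> G_def)
    also have "\<dots> \<le> (\<gamma> + M + 1) * \<epsilon>\<^sup>2 * s \<omega> + rejection_jump \<epsilon> \<omega>" using s M0 \<gamma>_pos by simp
    finally show ?thesis .
  qed
  then show "norm (snd (residual \<epsilon> \<omega>)) \<le> (\<gamma> + M + 1) * \<epsilon>\<^sup>2 * s \<omega> + rejection_jump \<epsilon> \<omega> + sqrt (2 * \<gamma>) * norm (snd (snd (snd \<omega>)))"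
    using norm_triangle_ineq4[of "snd (residual \<epsilon> \<omega>) + sqrt (2 * \<gamma>) *\<^sub>R snd n" "sqrt (2 * \<gamma>) *\<^sub>R snd n"] n by simp
qed

end

section \<open>Coupling of the chains\<close>

context kinetic
begin

lemma L2le_local_space_state:
  "L2le stationary X c \<Longrightarrow> L2le (local_space \<epsilon>) (\<lambda>\<omega>. X (fst \<omega>)) c"
  unfolding local_space_def
  by (rule L2le_pair_fst[OF _ prob_space_noise_pair stationary.sigma_finite_measure_axioms])

lemma L2le_local_space_noise:
  assumes "0 \<le> \<epsilon>"
  shows "L2le (local_space \<epsilon>) (\<lambda>\<omega>. snd (snd (snd \<omega>))) (sqrt (DIM('a) * c22 \<epsilon>))"
proof -
  interpret N: prob_space "unif \<Otimes>\<^sub>M noise \<epsilon>" by (rule prob_space_noise_pair)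
  have "L2le (unif \<Otimes>\<^sub>M noise \<epsilon>) (\<lambda>r. snd (snd r)) (sqrt (DIM('a) * c22 \<epsilon>))"
    by (rule L2le_pair_snd[OF L2le_noise_snd[OF assms] unif.prob_space_axioms noise.sigma_finite_measure_axioms])
  then show ?thesis
    unfolding local_space_def
    by (rule L2le_pair_snd[OF _ stationary.prob_space_axioms N.sigma_finite_measure_axioms, where Y="\<lambda>r. snd (snd r)"])
qed

text \<open>The residual is o(\<epsilon>) in L2, so after N = h/\<epsilon> steps its total is at
  most h e with e arbitrarily small. The displacement per step is about \<epsilon> |v|, of L2 size
  \<epsilon> sqrt p by stationarity; this term survives in the final bound.\<close>

lemma local_error:
  assumes h: "0 < h" and e: "0 < e"
  shows "\<exists>\<epsilon> N. 0 < N \<and> 0 < \<epsilon> \<and> real N * \<epsilon> = h \<and>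
    L2le (local_space \<epsilon>) (\<lambda>\<omega>. fst (residual \<epsilon> \<omega>)) (\<epsilon> * e) \<and>
    L2le (local_space \<epsilon>) (\<lambda>\<omega>. fst (residual \<epsilon> \<omega>) + \<gamma> *\<^sub>R snd (residual \<epsilon> \<omega>)) (\<epsilon> * e) \<and>
    L2le (local_space \<epsilon>) (\<lambda>\<omega>. snd (metropolis \<epsilon> (fst (snd \<omega>)) (fst \<omega>)) - snd (fst \<omega>)) (\<epsilon> * (sqrt DIM('a) + e))"
proof -
  \<comment> \<open>The shift of the index keeps all step sizes at most 1, as the residual estimates
    require.\<close>
  define N1 where "N1 = nat \<lceil>h\<rceil> + 1"
  define E where "E N = h / real (N + N1)" for N
  have N1: "h \<le> real N1" by (simp add: N1_def) linarith
  have E: "0 < E N" "E N \<le> 1" for N using h N1 by (auto simp: E_def field_simps)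
  have E0: "E \<longlonglongrightarrow> 0"
    unfolding E_def by (rule LIMSEQ_ignore_initial_segment[OF lim_const_over_n])
  obtain cg where cg: "L2le stationary (\<lambda>z. g (snd z)) cg" using stationary_gradient_second_moment by blast
  have cg0: "0 \<le> cg" using cg by (rule L2le_bound_nonneg)
  define p where "p = sqrt (real DIM('a))"
  have p0': "0 \<le> p" by (simp add: p_def)
  define C where "C = \<gamma> + M + 1"
  have C0: "0 \<le> C" using \<gamma>_pos M_pos by (simp add: C_def)
  \<comment> \<open>The non-rejection errors divided by \<epsilon>: second-order terms, position
    noise of order \<epsilon>^(3/2), and the gradient part of the displacement. They receive one
    half of the tolerance e; the rejections receive the other half through e1.\<close>
  define \<Phi> where "\<Phi> t = (1 + \<gamma>) * (C * t * (p + cg)) + \<gamma> * (sqrt (2 * \<gamma>) * (p * sqrt t)) + t / 2 * cg" for t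
  define e1 where "e1 = e / (2 * (1 + \<gamma>))"
  have e1: "0 < e1" "(1 + \<gamma>) * e1 = e / 2" using e \<gamma>_pos by (auto simp: e1_def field_simps)
  have "(\<lambda>N. \<Phi> (E N)) \<longlonglongrightarrow> (1 + \<gamma>) * (C * 0 * (p + cg)) + \<gamma> * (sqrt (2 * \<gamma>) * (p * sqrt 0)) + 0 / 2 * cg"
    unfolding \<Phi>_def by (intro tendsto_intros E0) simp
  then have "\<forall>\<^sub>F N in sequentially. \<Phi> (E N) < e / 2" using e by (intro order_tendstoD(2)) auto
  moreover have "\<forall>\<^sub>F N in sequentially.
    (\<integral>\<^sup>+z. ennreal ((1 - accept_prob (E N) z) * (rejection_size (E N) z / E N)\<^sup>2) \<partial>stationary) < ennreal (e1\<^sup>2)"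
    using rejection_tendsto_0[OF E E0] e1 by (intro order_tendstoD(2)) auto
  ultimately have "\<forall>\<^sub>F N in sequentially. \<Phi> (E N) < e / 2 \<and>
    (\<integral>\<^sup>+z. ennreal ((1 - accept_prob (E N) z) * (rejection_size (E N) z / E N)\<^sup>2) \<partial>stationary) < ennreal (e1\<^sup>2)"
    by (rule eventually_conj)
  then obtain N where N: "\<Phi> (E N) < e / 2"
    "(\<integral>\<^sup>+z. ennreal ((1 - accept_prob (E N) z) * (rejection_size (E N) z / E N)\<^sup>2) \<partial>stationary) < ennreal (e1\<^sup>2)"
    using eventually_happens'[OF sequentially_bot] by blast
  define \<epsilon> where "\<epsilon> = E N"
  have \<epsilon>: "0 < \<epsilon>" "\<epsilon> \<le> 1" "0 \<le> \<epsilon>" using E(1)[of N] E(2)[of N] by (auto simp: \<epsilon>_def)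
  have rej: "L2le (local_space \<epsilon>) (rejection_jump \<epsilon>) (\<epsilon> * e1)"
    using N(2) e1 \<epsilon> by (intro L2le_rejection_jump) (auto simp: \<epsilon>_def)
  let ?L = "local_space \<epsilon>"
  define s where "s \<omega> = norm (fst (fst \<omega>)) + norm (g (snd (fst \<omega>)))" for \<omega> :: "('a \<times> 'a) \<times> real \<times> ('a \<times> 'a)"
  have v: "L2le ?L (\<lambda>\<omega>. fst (fst \<omega>)) p"
    unfolding p_def by (rule L2le_local_space_state[OF stationary_velocity_second_moment])
  have G: "L2le ?L (\<lambda>\<omega>. g (snd (fst \<omega>))) cg" by (rule L2le_local_space_state[OF cg])
  have s: "L2le ?L s (p + cg)" unfolding s_def by (intro L2le_add L2le_norm v G)
  have Y1: "L2le ?L (\<lambda>\<omega>. C * \<epsilon>\<^sup>2 * s \<omega> + rejection_jump \<epsilon> \<omega>) (C * \<epsilon>\<^sup>2 * (p + cg) + \<epsilon> * e1)"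
    using L2le_add[OF L2le_scaleR[OF s, of "C * \<epsilon>\<^sup>2"] rej] C0 by simp
  have n: "L2le ?L (\<lambda>\<omega>. sqrt (2 * \<gamma>) * norm (snd (snd (snd \<omega>)))) (sqrt (2 * \<gamma>) * (p * \<epsilon> * sqrt \<epsilon>))"
  proof -
    have "sqrt (DIM('a) * c22 \<epsilon>) \<le> sqrt (DIM('a) * \<epsilon> ^ 3)"
      using c22_bounds(2)[OF \<epsilon>(3)] by (intro real_sqrt_le_mono mult_left_mono) auto
    also have "\<dots> = p * \<epsilon> * sqrt \<epsilon>"
      using \<epsilon> by (simp add: p_def real_sqrt_mult power3_eq_cube)
    finally have "L2le ?L (\<lambda>\<omega>. snd (snd (snd \<omega>))) (p * \<epsilon> * sqrt \<epsilon>)"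
      using L2le_mono_bound[OF L2le_local_space_noise[OF \<epsilon>(3)]] by blast
    from L2le_scaleR[OF L2le_norm[OF this], of "sqrt (2 * \<gamma>)"] show ?thesis using \<gamma>_pos by simp
  qed
  have R1: "L2le ?L (\<lambda>\<omega>. fst (residual \<epsilon> \<omega>)) (C * \<epsilon>\<^sup>2 * (p + cg) + \<epsilon> * e1)"
    by (rule L2le_dominated[OF Y1])
      (use residual_bounds(1)[OF \<epsilon>(1,2)] in \<open>auto simp: C_def s_def intro: order_trans[OF _ abs_ge_self]\<close>)
  have R2: "L2le ?L (\<lambda>\<omega>. snd (residual \<epsilon> \<omega>)) (C * \<epsilon>\<^sup>2 * (p + cg) + \<epsilon> * e1 + sqrt (2 * \<gamma>) * (p * \<epsilon> * sqrt \<epsilon>))"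
    by (rule L2le_dominated[OF L2le_add[OF Y1 n]])
      (use residual_bounds(2)[OF \<epsilon>(1,2)] in \<open>auto simp: C_def s_def intro: order_trans[OF _ abs_ge_self]\<close>)
  have R3: "L2le ?L (\<lambda>\<omega>. fst (residual \<epsilon> \<omega>) + \<gamma> *\<^sub>R snd (residual \<epsilon> \<omega>))
    ((C * \<epsilon>\<^sup>2 * (p + cg) + \<epsilon> * e1) + \<gamma> * (C * \<epsilon>\<^sup>2 * (p + cg) + \<epsilon> * e1 + sqrt (2 * \<gamma>) * (p * \<epsilon> * sqrt \<epsilon>)))"
    using L2le_add[OF R1 L2le_scaleR[OF R2, of \<gamma>]] \<gamma>_pos by simp
  have Phi: "\<Phi> \<epsilon> < e / 2" using N(1) by (simp add: \<epsilon>_def)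
  have nn: "0 \<le> (1 + \<gamma>) * (C * \<epsilon> * (p + cg))" "0 \<le> \<gamma> * (sqrt (2 * \<gamma>) * (p * sqrt \<epsilon>))" "0 \<le> \<epsilon> / 2 * cg" "0 \<le> \<gamma> * (C * \<epsilon> * (p + cg))" "0 \<le> \<gamma> * e1"
    using \<gamma>_pos C0 \<epsilon> p0' cg0 e1 by auto
  have b1: "C * \<epsilon>\<^sup>2 * (p + cg) + \<epsilon> * e1 \<le> \<epsilon> * e"
  proof -
    have "C * \<epsilon> * (p + cg) + e1 \<le> e"
      using Phi nn e1(2) e unfolding \<Phi>_def by (simp add: distrib_right)
    then have "\<epsilon> * (C * \<epsilon> * (p + cg) + e1) \<le> \<epsilon> * e" using \<epsilon> by (intro mult_left_mono) auto
    then show ?thesis by (simp add: power2_eq_square algebra_simps)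
  qed
  have b3: "(C * \<epsilon>\<^sup>2 * (p + cg) + \<epsilon> * e1) + \<gamma> * (C * \<epsilon>\<^sup>2 * (p + cg) + \<epsilon> * e1 + sqrt (2 * \<gamma>) * (p * \<epsilon> * sqrt \<epsilon>)) \<le> \<epsilon> * e"
  proof -
    have "(1 + \<gamma>) * (C * \<epsilon> * (p + cg)) + (1 + \<gamma>) * e1 + \<gamma> * (sqrt (2 * \<gamma>) * (p * sqrt \<epsilon>)) \<le> e"
      using Phi nn e1(2) unfolding \<Phi>_def by linarith
    then have "\<epsilon> * ((1 + \<gamma>) * (C * \<epsilon> * (p + cg)) + (1 + \<gamma>) * e1 + \<gamma> * (sqrt (2 * \<gamma>) * (p * sqrt \<epsilon>))) \<le> \<epsilon> * e"
      using \<epsilon> by (intro mult_left_mono) auto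
    then show ?thesis by (simp add: power2_eq_square algebra_simps)
  qed
  have disp: "L2le ?L (\<lambda>\<omega>. snd (metropolis \<epsilon> (fst (snd \<omega>)) (fst \<omega>)) - snd (fst \<omega>)) (\<epsilon> * (p + e))"
  proof -
    have "L2le ?L (\<lambda>\<omega>. \<epsilon> * norm (fst (fst \<omega>)) + (\<epsilon>\<^sup>2 / 2) * norm (g (snd (fst \<omega>)))) (\<epsilon> * p + \<epsilon>\<^sup>2 / 2 * cg)"
      using L2le_add[OF L2le_scaleR[OF L2le_norm[OF v], of \<epsilon>] L2le_scaleR[OF L2le_norm[OF G], of "\<epsilon>\<^sup>2 / 2"]] \<epsilon> by simp
    then have "L2le ?L (\<lambda>\<omega>. snd (metropolis \<epsilon> (fst (snd \<omega>)) (fst \<omega>)) - snd (fst \<omega>)) (\<epsilon> * p + \<epsilon>\<^sup>2 / 2 * cg)"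
    proof (rule L2le_dominated)
      show "(\<lambda>\<omega>. snd (metropolis \<epsilon> (fst (snd \<omega>)) (fst \<omega>)) - snd (fst \<omega>)) \<in> borel_measurable ?L" by measurable
      fix \<omega> :: "('a \<times> 'a) \<times> real \<times> ('a \<times> 'a)"
      obtain v x u n where \<omega>: "\<omega> = ((v, x), u, n)" by (metis prod.exhaust)
      have "norm (\<epsilon> *\<^sub>R (v - (\<epsilon> / 2) *\<^sub>R g x)) \<le> \<epsilon> * (norm v + norm ((\<epsilon> / 2) *\<^sub>R g x))"
        using norm_triangle_ineq4[of v "(\<epsilon> / 2) *\<^sub>R g x"] \<epsilon> by (simp add: mult_left_mono)
      then have "norm (\<epsilon> *\<^sub>R (v - (\<epsilon> / 2) *\<^sub>R g x)) \<le> \<epsilon> * norm v + (\<epsilon>\<^sup>2 / 2) * norm (g x)"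
        using \<epsilon> by (simp add: power2_eq_square algebra_simps)
      then have "norm (snd (metropolis \<epsilon> u (v, x)) - x) \<le> \<epsilon> * norm v + (\<epsilon>\<^sup>2 / 2) * norm (g x)"
        using \<epsilon> by (auto simp: metropolis_def leapfrog_def Let_def flip_def)
      then show "norm (snd (metropolis \<epsilon> (fst (snd \<omega>)) (fst \<omega>)) - snd (fst \<omega>))
        \<le> norm (\<epsilon> * norm (fst (fst \<omega>)) + (\<epsilon>\<^sup>2 / 2) * norm (g (snd (fst \<omega>))))"
        by (simp add: \<omega>)
    qed
    moreover have "\<epsilon> * p + \<epsilon>\<^sup>2 / 2 * cg \<le> \<epsilon> * (p + e)"
    proof -
      have "\<epsilon> / 2 * cg \<le> e" using Phi nn e unfolding \<Phi>_def by linarith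
      then have "\<epsilon> * (\<epsilon> / 2 * cg) \<le> \<epsilon> * e" using \<epsilon> by (intro mult_left_mono) auto
      then show ?thesis by (simp add: power2_eq_square algebra_simps)
    qed
    ultimately show ?thesis by (rule L2le_mono_bound)
  qed
  have "real (N + N1) * \<epsilon> = h" "0 < N + N1" by (auto simp: \<epsilon>_def E_def N1_def)
  then show ?thesis
    using \<epsilon>(1) L2le_mono_bound[OF R1 b1] L2le_mono_bound[OF R3 b3] disp unfolding p_def by blast
qed

section \<open>Fine steps of the coupled pair\<close>

definition dv :: "('a \<times> 'a) \<times> ('a \<times> 'a) \<Rightarrow> 'a" where
  "dv p = fst (fst p) - fst (snd p)"

definition dx :: "('a \<times> 'a) \<times> ('a \<times> 'a) \<Rightarrow> 'a" where
  "dx p = snd (fst p) - snd (snd p)"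

definition dg :: "('a \<times> 'a) \<times> ('a \<times> 'a) \<Rightarrow> 'a" where
  "dg p = g (snd (fst p)) - g (snd (snd p))"

lemma measurable_diffs [measurable]:
  "dv \<in> borel_measurable ((borel \<Otimes>\<^sub>M borel) \<Otimes>\<^sub>M (borel \<Otimes>\<^sub>M borel))"
  "dx \<in> borel_measurable ((borel \<Otimes>\<^sub>M borel) \<Otimes>\<^sub>M (borel \<Otimes>\<^sub>M borel))"
  "dg \<in> borel_measurable ((borel \<Otimes>\<^sub>M borel) \<Otimes>\<^sub>M (borel \<Otimes>\<^sub>M borel))"
  unfolding dv_def dx_def dg_def by measurable

text \<open>One fine step of the coupled chains: \<open>q = (p, p')\<close> holds the pair at the beginning of the
  coarse step, whose gradient stays frozen in the first component, and the current pair.\<close>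

definition fine_step ::
  "real \<Rightarrow> ((('a \<times> 'a) \<times> ('a \<times> 'a)) \<times> (('a \<times> 'a) \<times> ('a \<times> 'a))) \<times> real \<times> ('a \<times> 'a) \<Rightarrow>
    (('a \<times> 'a) \<times> ('a \<times> 'a)) \<times> (('a \<times> 'a) \<times> ('a \<times> 'a))" where
  "fine_step \<epsilon> \<omega> = (fst (fst \<omega>),
    (kstep \<epsilon> (g (snd (fst (fst (fst \<omega>))))) (fst (snd (fst \<omega>))) (snd (snd \<omega>)),
     ystep \<epsilon> (fst (snd \<omega>)) (snd (snd \<omega>)) (snd (snd (fst \<omega>)))))"

abbreviation "pairS \<equiv> (borel \<Otimes>\<^sub>M borel) \<Otimes>\<^sub>M (borel \<Otimes>\<^sub>M borel) :: (('a \<times> 'a) \<times> ('a \<times> 'a)) measure"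

lemma measurable_fine_step [measurable]:
  "fine_step \<epsilon> \<in> (pairS \<Otimes>\<^sub>M pairS) \<Otimes>\<^sub>M (borel \<Otimes>\<^sub>M (borel \<Otimes>\<^sub>M borel)) \<rightarrow>\<^sub>M pairS \<Otimes>\<^sub>M pairS"
  unfolding fine_step_def by measurable

text \<open>The algorithm keeps the gradient from the start of the coarse step while the stationary
  chain uses its current one. The gradient difference is thus the initial \<open>dg\<close> minus G,
  the drift of the stationary gradient since then, and G is the only source of error that does not
  vanish with \<epsilon>.\<close>

lemma fine_step_diffs:
  fixes \<omega> and \<epsilon> :: real
  defines "q \<equiv> fst \<omega>" and "res \<equiv> residual \<epsilon> (snd (snd (fst \<omega>)), snd \<omega>)"
  defines "G \<equiv> g (snd (snd (snd q))) - g (snd (snd (fst q)))"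
  shows "dv (snd (fine_step \<epsilon> \<omega>)) = p0 \<epsilon> *\<^sub>R dv (snd q) - p1 \<epsilon> *\<^sub>R (dg (fst q) - G) - fst res"
    and "dv (snd (fine_step \<epsilon> \<omega>)) + \<gamma> *\<^sub>R dx (snd (fine_step \<epsilon> \<omega>))
      = (dv (snd q) + \<gamma> *\<^sub>R dx (snd q)) - \<epsilon> *\<^sub>R (dg (fst q) - G) - (fst res + \<gamma> *\<^sub>R snd res)"
proof -
  obtain p x y u n where \<omega>: "\<omega> = ((p, x, y), u, n)" by (metis prod.exhaust)
  define H where "H = g (snd (fst p)) - g (snd y)"
  have H: "dg (fst q) - G = H" by (simp add: dg_def G_def q_def \<omega> H_def)
  have y: "ystep \<epsilon> u n y = kstep \<epsilon> (g (snd y)) y n + res" by (simp add: res_def residual_def \<omega>)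
  have x': "snd (fine_step \<epsilon> \<omega>) = (kstep \<epsilon> (g (snd (fst p))) x n, ystep \<epsilon> u n y)"
    by (simp add: fine_step_def \<omega>)
  have q: "snd q = (x, y)" by (simp add: q_def \<omega>)
  have v: "dv (snd (fine_step \<epsilon> \<omega>)) = p0 \<epsilon> *\<^sub>R dv (x, y) - p1 \<epsilon> *\<^sub>R H - fst res"
    unfolding x' y by (simp add: dv_def kstep_def H_def algebra_simps)
  have x: "dx (snd (fine_step \<epsilon> \<omega>)) = dx (x, y) + p1 \<epsilon> *\<^sub>R dv (x, y) - p2 \<epsilon> *\<^sub>R H - snd res"
    unfolding x' y by (simp add: dx_def dv_def kstep_def H_def algebra_simps)
  show "dv (snd (fine_step \<epsilon> \<omega>)) = p0 \<epsilon> *\<^sub>R dv (snd q) - p1 \<epsilon> *\<^sub>R (dg (fst q) - G) - fst res"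
    unfolding H q by (rule v)
  have "dv (snd (fine_step \<epsilon> \<omega>)) + \<gamma> *\<^sub>R dx (snd (fine_step \<epsilon> \<omega>))
    = (p0 \<epsilon> + \<gamma> * p1 \<epsilon>) *\<^sub>R dv (x, y) + \<gamma> *\<^sub>R dx (x, y) - (p1 \<epsilon> + \<gamma> * p2 \<epsilon>) *\<^sub>R H - (fst res + \<gamma> *\<^sub>R snd res)"
    unfolding v x by (simp add: algebra_simps)
  then show "dv (snd (fine_step \<epsilon> \<omega>)) + \<gamma> *\<^sub>R dx (snd (fine_step \<epsilon> \<omega>))
      = (dv (snd q) + \<gamma> *\<^sub>R dx (snd q)) - \<epsilon> *\<^sub>R (dg (fst q) - G) - (fst res + \<gamma> *\<^sub>R snd res)"
    unfolding H q p0_p1 p1_p2 by simp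
qed

lemma fine_chain:
  fixes J :: "(('a \<times> 'a) \<times> ('a \<times> 'a)) measure"
  assumes J: "prob_space J" "sets J = sets pairS"
    and J_snd: "\<And>F. F \<in> borel_measurable (borel \<Otimes>\<^sub>M borel) \<Longrightarrow> (\<integral>\<^sup>+p. F (snd p) \<partial>J) = (\<integral>\<^sup>+z. F z \<partial>stationary)"
    and \<epsilon>: "0 < \<epsilon>" and r: "0 \<le> r" and c: "0 \<le> c"
    and res1: "L2le (local_space \<epsilon>) (\<lambda>\<omega>. fst (residual \<epsilon> \<omega>)) r"
    and res2: "L2le (local_space \<epsilon>) (\<lambda>\<omega>. fst (residual \<epsilon> \<omega>) + \<gamma> *\<^sub>R snd (residual \<epsilon> \<omega>)) r"
    and disp: "L2le (local_space \<epsilon>) (\<lambda>\<omega>. snd (metropolis \<epsilon> (fst (snd \<omega>)) (fst \<omega>)) - snd (fst \<omega>)) c"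
  defines "e \<equiv> \<lambda>i. \<epsilon> * M * c * (real i)\<^sup>2 / 2 + real i * r"
  shows "\<exists>Q. prob_space Q \<and> sets Q = sets (pairS \<Otimes>\<^sub>M pairS) \<and>
    (\<forall>F \<in> borel_measurable pairS. (\<integral>\<^sup>+q. F (fst q) \<partial>Q) = (\<integral>\<^sup>+p. F p \<partial>J)) \<and>
    (\<forall>F \<in> borel_measurable pairS. (\<integral>\<^sup>+q. F (fst (fst q), fst (snd q)) \<partial>Q)
      = (\<integral>\<^sup>+p. \<integral>\<^sup>+n. F (fst p, kstep (real i * \<epsilon>) (g (snd (fst p))) (fst p) n) \<partial>noise (real i * \<epsilon>) \<partial>J)) \<and>
    (\<forall>F \<in> borel_measurable (borel \<Otimes>\<^sub>M borel). (\<integral>\<^sup>+q. F (snd (snd q)) \<partial>Q) = (\<integral>\<^sup>+z. F z \<partial>stationary)) \<and>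
    L2le Q (\<lambda>q. snd (snd (snd q)) - snd (snd (fst q))) (real i * c) \<and>
    L2le Q (\<lambda>q. (dv (snd q) + \<gamma> *\<^sub>R dx (snd q)) - ((dv (fst q) + \<gamma> *\<^sub>R dx (fst q)) - (real i * \<epsilon>) *\<^sub>R dg (fst q))) (e i) \<and>
    L2le Q (\<lambda>q. dv (snd q) - (p0 (real i * \<epsilon>) *\<^sub>R dv (fst q) - p1 (real i * \<epsilon>) *\<^sub>R dg (fst q))) (e i)"
proof (induction i)
  case 0
  let ?T = "\<lambda>p. (p, p)"
  let ?Q = "distr J (pairS \<Otimes>\<^sub>M pairS) ?T"
  interpret J: prob_space J by (rule J)
  note [measurable_cong] = J(2)
  have T: "?T \<in> J \<rightarrow>\<^sub>M pairS \<Otimes>\<^sub>M pairS" by measurable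
  have int: "(\<integral>\<^sup>+q. F q \<partial>?Q) = (\<integral>\<^sup>+p. F (p, p) \<partial>J)" if "F \<in> borel_measurable (pairS \<Otimes>\<^sub>M pairS)" for F
    using that by (subst nn_integral_distr[OF T]) auto
  \<comment> \<open>A step of length 0 with \<open>noise 0\<close> is the identity, so before the
    first fine step the current pair is the starting pair.\<close>
  have k: "(\<integral>\<^sup>+n. F (kstep 0 G x n) \<partial>noise 0) = F x" if [measurable]: "F \<in> borel_measurable (borel \<Otimes>\<^sub>M borel)" for F :: "'a \<times> 'a \<Rightarrow> ennreal" and G x
    unfolding noise_def
    by (subst nn_integral_gaussian_pair) (auto simp: kstep_def n\<alpha>_def n\<beta>_def n\<sigma>_def gaussian.emeasure_space_1[simplified])
  have k0: "(\<integral>\<^sup>+n. F (x, kstep 0 G x n) \<partial>noise 0) = F (x, x)" if F: "F \<in> borel_measurable pairS" for F :: "('a \<times> 'a) \<times> ('a \<times> 'a) \<Rightarrow> ennreal" and G x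
  proof -
    have "(\<lambda>y. F (x, y)) \<in> borel_measurable (borel \<Otimes>\<^sub>M borel)"
      by (rule measurable_compose[OF measurable_Pair1' F]) (simp add: space_pair_measure)
    then show ?thesis by (rule k)
  qed
  have L: "L2le ?Q X 0" if "X \<in> borel_measurable (pairS \<Otimes>\<^sub>M pairS)" "\<And>p. X (p, p) = 0" for X :: "_ \<Rightarrow> 'a"
    using that by (subst L2le_distr[OF T]) (auto simp: L2le_zero)
  show ?case
  proof (intro exI[of _ ?Q] conjI ballI)
    show "prob_space ?Q" by (rule J.prob_space_distr[OF T])
    show "(\<integral>\<^sup>+q. F (fst q) \<partial>?Q) = (\<integral>\<^sup>+p. F p \<partial>J)" if [measurable]: "F \<in> borel_measurable pairS" for F
      by (subst int) auto
    show "(\<integral>\<^sup>+q. F (fst (fst q), fst (snd q)) \<partial>?Q)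
      = (\<integral>\<^sup>+p. \<integral>\<^sup>+n. F (fst p, kstep (real 0 * \<epsilon>) (g (snd (fst p))) (fst p) n) \<partial>noise (real 0 * \<epsilon>) \<partial>J)"
      if [measurable]: "F \<in> borel_measurable pairS" for F
      by (subst int) (auto simp: k0)
    show "(\<integral>\<^sup>+q. F (snd (snd q)) \<partial>?Q) = (\<integral>\<^sup>+z. F z \<partial>stationary)" if [measurable]: "F \<in> borel_measurable (borel \<Otimes>\<^sub>M borel)" for F
      by (subst int) (auto simp: J_snd)
    show "L2le ?Q (\<lambda>q. snd (snd (snd q)) - snd (snd (fst q))) (real 0 * c)"
      using L[of "\<lambda>q. snd (snd (snd q)) - snd (snd (fst q))"] by simp
    show "L2le ?Q (\<lambda>q. (dv (snd q) + \<gamma> *\<^sub>R dx (snd q)) - ((dv (fst q) + \<gamma> *\<^sub>R dx (fst q)) - (real 0 * \<epsilon>) *\<^sub>R dg (fst q))) (e 0)"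
      using L[of "\<lambda>q. (dv (snd q) + \<gamma> *\<^sub>R dx (snd q)) - (dv (fst q) + \<gamma> *\<^sub>R dx (fst q))"] by (simp add: e_def)
    show "L2le ?Q (\<lambda>q. dv (snd q) - (p0 (real 0 * \<epsilon>) *\<^sub>R dv (fst q) - p1 (real 0 * \<epsilon>) *\<^sub>R dg (fst q))) (e 0)"
      using L[of "\<lambda>q. dv (snd q) - dv (fst q)"] by (simp add: e_def)
  qed simp
next
  case (Suc i)
  obtain Q where Q: "prob_space Q" "sets Q = sets (pairS \<Otimes>\<^sub>M pairS)"
    and Qa: "\<And>F. F \<in> borel_measurable pairS \<Longrightarrow> (\<integral>\<^sup>+q. F (fst q) \<partial>Q) = (\<integral>\<^sup>+p. F p \<partial>J)"
    and Qb: "\<And>F. F \<in> borel_measurable pairS \<Longrightarrow> (\<integral>\<^sup>+q. F (fst (fst q), fst (snd q)) \<partial>Q)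
      = (\<integral>\<^sup>+p. \<integral>\<^sup>+n. F (fst p, kstep (real i * \<epsilon>) (g (snd (fst p))) (fst p) n) \<partial>noise (real i * \<epsilon>) \<partial>J)"
    and Qc: "\<And>F. F \<in> borel_measurable (borel \<Otimes>\<^sub>M borel) \<Longrightarrow> (\<integral>\<^sup>+q. F (snd (snd q)) \<partial>Q) = (\<integral>\<^sup>+z. F z \<partial>stationary)"
    and Qd: "L2le Q (\<lambda>q. snd (snd (snd q)) - snd (snd (fst q))) (real i * c)"
    and Qe: "L2le Q (\<lambda>q. (dv (snd q) + \<gamma> *\<^sub>R dx (snd q)) - ((dv (fst q) + \<gamma> *\<^sub>R dx (fst q)) - (real i * \<epsilon>) *\<^sub>R dg (fst q))) (e i)"
    and Qf: "L2le Q (\<lambda>q. dv (snd q) - (p0 (real i * \<epsilon>) *\<^sub>R dv (fst q) - p1 (real i * \<epsilon>) *\<^sub>R dg (fst q))) (e i)"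
    using Suc.IH by blast
  interpret Q: prob_space Q by (rule Q)
  note [measurable_cong] = Q(2)
  let ?U = "unif \<Otimes>\<^sub>M noise \<epsilon>"
  interpret U: prob_space ?U by (rule prob_space_noise_pair)
  let ?O = "Q \<Otimes>\<^sub>M ?U"
  interpret O: pair_prob_space Q ?U ..
  have T: "fine_step \<epsilon> \<in> ?O \<rightarrow>\<^sub>M pairS \<Otimes>\<^sub>M pairS" by measurable
  let ?Q = "distr ?O (pairS \<Otimes>\<^sub>M pairS) (fine_step \<epsilon>)"
  have int: "(\<integral>\<^sup>+q. F q \<partial>?Q) = (\<integral>\<^sup>+q. \<integral>\<^sup>+w. F (fine_step \<epsilon> (q, w)) \<partial>?U \<partial>Q)"
    if [measurable]: "F \<in> borel_measurable (pairS \<Otimes>\<^sub>M pairS)" for F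
    by (subst nn_integral_distr[OF T]) (auto intro!: U.nn_integral_fst[symmetric])
  have drop_u: "(\<integral>\<^sup>+w. F (snd w) \<partial>?U) = (\<integral>\<^sup>+n. F n \<partial>noise \<epsilon>)" if [measurable]: "F \<in> borel_measurable (borel \<Otimes>\<^sub>M borel)" for F
    by (subst noise.nn_integral_fst[symmetric]) (auto simp: unif.emeasure_space_1)
  have i\<epsilon>: "real (Suc i) * \<epsilon> = real i * \<epsilon> + \<epsilon>" by (simp add: algebra_simps)
  \<comment> \<open>The current state of the second chain has the stationary law and the new coin
    and noise are independent of it, so one-step estimates on \<open>local_space\<close>
    transfer.\<close>
  have Loc: "L2le ?O (\<lambda>\<omega>. X (snd (snd (fst \<omega>)), snd \<omega>)) b" if X: "L2le (local_space \<epsilon>) X b" for X :: "_ \<Rightarrow> 'a" and b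
  proof (rule L2leI)
    have X' [measurable]: "X \<in> borel_measurable ((borel \<Otimes>\<^sub>M borel) \<Otimes>\<^sub>M (borel \<Otimes>\<^sub>M (borel \<Otimes>\<^sub>M borel)))"
      using L2le_measurable[OF X] by (simp cong: measurable_cong_sets)
    show "(\<lambda>\<omega>. X (snd (snd (fst \<omega>)), snd \<omega>)) \<in> borel_measurable ?O" by measurable
    have "(\<integral>\<^sup>+\<omega>. ennreal ((norm (X (snd (snd (fst \<omega>)), snd \<omega>)))\<^sup>2) \<partial>?O)
      = (\<integral>\<^sup>+q. \<integral>\<^sup>+w. ennreal ((norm (X (snd (snd q), w)))\<^sup>2) \<partial>?U \<partial>Q)"
      by (subst U.nn_integral_fst[symmetric]) auto
    also have "\<dots> = (\<integral>\<^sup>+z. \<integral>\<^sup>+w. ennreal ((norm (X (z, w)))\<^sup>2) \<partial>?U \<partial>stationary)"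
      by (rule Qc) measurable
    also have "\<dots> = (\<integral>\<^sup>+\<omega>. ennreal ((norm (X \<omega>))\<^sup>2) \<partial>local_space \<epsilon>)"
      unfolding local_space_def by (rule U.nn_integral_fst) measurable
    also have "\<dots> \<le> ennreal (b\<^sup>2)" using X by (simp add: L2le_def)
    finally show "(\<integral>\<^sup>+\<omega>. ennreal ((norm (X (snd (snd (fst \<omega>)), snd \<omega>)))\<^sup>2) \<partial>?O) \<le> ennreal (b\<^sup>2)" .
  qed (use X in \<open>auto dest: L2le_bound_nonneg\<close>)
  have Old: "L2le ?O (\<lambda>\<omega>. X (fst \<omega>)) b" if "L2le Q X b" for X :: "_ \<Rightarrow> 'a" and b
    by (rule L2le_pair_fst[OF that U.prob_space_axioms Q.sigma_finite_measure_axioms])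
  have New: "L2le ?Q X b" if "X \<in> borel_measurable (pairS \<Otimes>\<^sub>M pairS)" "L2le ?O (\<lambda>\<omega>. X (fine_step \<epsilon> \<omega>)) b" for X :: "_ \<Rightarrow> 'a" and b
    using that by (simp add: L2le_distr[OF T])
  have fst_step: "fst (fine_step \<epsilon> \<omega>) = fst (fst \<omega>)" for \<omega> by (simp add: fine_step_def)
  have grad: "L2le ?O (\<lambda>\<omega>. g (snd (snd (snd (fst \<omega>)))) - g (snd (snd (fst (fst \<omega>))))) (M * (real i * c))"
  proof -
    have "L2le ?O (\<lambda>\<omega>. M *\<^sub>R (snd (snd (snd (fst \<omega>))) - snd (snd (fst (fst \<omega>))))) (M * (real i * c))"
      using L2le_scaleR[OF Old[OF Qd], of M] M_pos by simp
    then show ?thesis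
    proof (rule L2le_dominated)
      show "norm (g (snd (snd (snd (fst \<omega>)))) - g (snd (snd (fst (fst \<omega>)))))
        \<le> norm (M *\<^sub>R (snd (snd (snd (fst \<omega>))) - snd (snd (fst (fst \<omega>)))))" for \<omega> :: "((('a \<times> 'a) \<times> ('a \<times> 'a)) \<times> (('a \<times> 'a) \<times> ('a \<times> 'a))) \<times> real \<times> ('a \<times> 'a)"
        using g_lipschitz M_pos by simp
    qed measurable
  qed
  \<comment> \<open>The exact sum has i (i - 1) / 2; using i^2 / 2 leaves \<epsilon> M c / 2 to
    spare.\<close>
  have e_Suc: "e i + \<epsilon> * (M * (real i * c)) + r \<le> e (Suc i)"
  proof -
    have "e (Suc i) - (e i + \<epsilon> * (M * (real i * c)) + r) = \<epsilon> * M * c / 2"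
      by (simp add: e_def power2_eq_square field_simps)
    moreover have "0 \<le> \<epsilon> * M * c / 2" using \<epsilon> M_pos c by simp
    ultimately show ?thesis by linarith
  qed
  show ?case
  proof (intro exI[of _ ?Q] conjI ballI)
    show "prob_space ?Q" by (rule O.prob_space_distr[OF T])
    show "(\<integral>\<^sup>+q. F (fst q) \<partial>?Q) = (\<integral>\<^sup>+p. F p \<partial>J)" if [measurable]: "F \<in> borel_measurable pairS" for F
      by (subst int) (auto simp: fst_step U.emeasure_space_1 Qa)
    show "(\<integral>\<^sup>+q. F (fst (fst q), fst (snd q)) \<partial>?Q)
      = (\<integral>\<^sup>+p. \<integral>\<^sup>+n. F (fst p, kstep (real (Suc i) * \<epsilon>) (g (snd (fst p))) (fst p) n) \<partial>noise (real (Suc i) * \<epsilon>) \<partial>J)"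
      if F [measurable]: "F \<in> borel_measurable pairS" for F
    proof -
      let ?H = "\<lambda>p. \<integral>\<^sup>+n'. F (fst p, kstep \<epsilon> (g (snd (fst p))) (snd p) n') \<partial>noise \<epsilon>"
      have H: "?H \<in> borel_measurable pairS" by measurable
      have "(\<integral>\<^sup>+q. F (fst (fst q), fst (snd q)) \<partial>?Q) = (\<integral>\<^sup>+q. \<integral>\<^sup>+w. F (fst (fst q), kstep \<epsilon> (g (snd (fst (fst q)))) (fst (snd q)) (snd w)) \<partial>?U \<partial>Q)"
        by (subst int) (auto simp: fine_step_def)
      also have "\<dots> = (\<integral>\<^sup>+q. ?H (fst (fst q), fst (snd q)) \<partial>Q)"
        by (intro nn_integral_cong, subst drop_u) auto
      also have "\<dots> = (\<integral>\<^sup>+p. \<integral>\<^sup>+n. ?H (fst p, kstep (real i * \<epsilon>) (g (snd (fst p))) (fst p) n) \<partial>noise (real i * \<epsilon>) \<partial>J)"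
        by (rule Qb[OF H])
      also have "\<dots> = (\<integral>\<^sup>+p. \<integral>\<^sup>+n. F (fst p, kstep (real (Suc i) * \<epsilon>) (g (snd (fst p))) (fst p) n) \<partial>noise (real (Suc i) * \<epsilon>) \<partial>J)"
      proof (rule nn_integral_cong)
        fix p :: "('a \<times> 'a) \<times> ('a \<times> 'a)"
        let ?K = "\<lambda>n. F (fst p, kstep (real (Suc i) * \<epsilon>) (g (snd (fst p))) (fst p) n)"
        let ?C = "\<lambda>(n, n'). (p0 \<epsilon> *\<^sub>R fst n + fst n', snd n + p1 \<epsilon> *\<^sub>R fst n + snd n') :: 'a \<times> 'a"
        have FX: "(\<lambda>y. F (fst p, y)) \<in> borel_measurable (borel \<Otimes>\<^sub>M borel)"
          by (rule measurable_compose[OF measurable_Pair1' F]) (simp add: space_pair_measure)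
        have "kstep (real (Suc i) * \<epsilon>) (g (snd (fst p))) (fst p) \<in> borel \<Otimes>\<^sub>M borel \<rightarrow>\<^sub>M borel \<Otimes>\<^sub>M borel"
          by (rule measurable_kstep[where G="\<lambda>_. g (snd (fst p))" and X="\<lambda>_. fst p" and n="\<lambda>n. n", simplified])
            (simp_all add: space_pair_measure)
        then have K: "?K \<in> borel_measurable (borel \<Otimes>\<^sub>M borel)" using FX by (rule measurable_compose)
        then have K' [measurable]: "(\<lambda>nn. ?K (?C nn)) \<in> borel_measurable ((borel \<Otimes>\<^sub>M borel) \<Otimes>\<^sub>M (borel \<Otimes>\<^sub>M borel))"
          by (rule measurable_compose[rotated]) measurable
        have "(\<integral>\<^sup>+n. ?K n \<partial>noise (real (Suc i) * \<epsilon>)) = (\<integral>\<^sup>+n. ?K n \<partial>distr (noise (real i * \<epsilon>) \<Otimes>\<^sub>M noise \<epsilon>) (borel \<Otimes>\<^sub>M borel) ?C)"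
          unfolding i\<epsilon> using \<epsilon> by (subst noise_convolution) auto
        also have "\<dots> = (\<integral>\<^sup>+nn. ?K (?C nn) \<partial>(noise (real i * \<epsilon>) \<Otimes>\<^sub>M noise \<epsilon>))"
          by (rule nn_integral_distr) (use K in measurable)
        also have "\<dots> = (\<integral>\<^sup>+n. \<integral>\<^sup>+n'. ?K (?C (n, n')) \<partial>noise \<epsilon> \<partial>noise (real i * \<epsilon>))"
          by (rule noise.nn_integral_fst[symmetric]) measurable
        also have "\<dots> = (\<integral>\<^sup>+n. ?H (fst p, kstep (real i * \<epsilon>) (g (snd (fst p))) (fst p) n) \<partial>noise (real i * \<epsilon>))"
          unfolding fst_conv snd_conv prod.case kstep_kstep i\<epsilon> ..
        finally show "(\<integral>\<^sup>+n. ?H (fst p, kstep (real i * \<epsilon>) (g (snd (fst p))) (fst p) n) \<partial>noise (real i * \<epsilon>)) = (\<integral>\<^sup>+n. ?K n \<partial>noise (real (Suc i) * \<epsilon>))" ..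
      qed
      finally show ?thesis .
    qed
    show "(\<integral>\<^sup>+q. F (snd (snd q)) \<partial>?Q) = (\<integral>\<^sup>+z. F z \<partial>stationary)" if [measurable]: "F \<in> borel_measurable (borel \<Otimes>\<^sub>M borel)" for F
    proof -
      have "(\<integral>\<^sup>+q. F (snd (snd q)) \<partial>?Q) = (\<integral>\<^sup>+q. \<integral>\<^sup>+w. F (ystep \<epsilon> (fst w) (snd w) (snd (snd q))) \<partial>?U \<partial>Q)"
        by (subst int) (auto simp: fine_step_def)
      also have "\<dots> = (\<integral>\<^sup>+z. \<integral>\<^sup>+w. F (ystep \<epsilon> (fst w) (snd w) z) \<partial>?U \<partial>stationary)"
        by (rule Qc) measurable
      also have "\<dots> = (\<integral>\<^sup>+z. \<integral>\<^sup>+u. \<integral>\<^sup>+n. F (ystep \<epsilon> u n z) \<partial>noise \<epsilon> \<partial>unif \<partial>stationary)"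
        by (intro nn_integral_cong) (subst noise.nn_integral_fst[symmetric], auto)
      also have "\<dots> = (\<integral>\<^sup>+z. F z \<partial>stationary)" using \<epsilon> by (intro nn_integral_ystep) auto
      finally show ?thesis .
    qed
    show "L2le ?Q (\<lambda>q. snd (snd (snd q)) - snd (snd (fst q))) (real (Suc i) * c)"
    proof (rule New)
      have "L2le ?O (\<lambda>\<omega>. (snd (snd (snd (fst \<omega>))) - snd (snd (fst (fst \<omega>))))
          + (snd (metropolis \<epsilon> (fst (snd \<omega>)) (snd (snd (fst \<omega>)))) - snd (snd (snd (fst \<omega>))))) (real i * c + c)"
        using L2le_add[OF Old[OF Qd] Loc[OF disp]] by simp
      then show "L2le ?O (\<lambda>\<omega>. snd (snd (snd (fine_step \<epsilon> \<omega>))) - snd (snd (fst (fine_step \<epsilon> \<omega>)))) (real (Suc i) * c)"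
        by (simp add: fine_step_def ystep_def algebra_simps)
    qed measurable
    show "L2le ?Q (\<lambda>q. (dv (snd q) + \<gamma> *\<^sub>R dx (snd q)) - ((dv (fst q) + \<gamma> *\<^sub>R dx (fst q)) - (real (Suc i) * \<epsilon>) *\<^sub>R dg (fst q))) (e (Suc i))"
    proof (rule New)
      have "L2le ?O (\<lambda>\<omega>. (((dv (snd (fst \<omega>)) + \<gamma> *\<^sub>R dx (snd (fst \<omega>))) - ((dv (fst (fst \<omega>)) + \<gamma> *\<^sub>R dx (fst (fst \<omega>))) - (real i * \<epsilon>) *\<^sub>R dg (fst (fst \<omega>))))
        + \<epsilon> *\<^sub>R (g (snd (snd (snd (fst \<omega>)))) - g (snd (snd (fst (fst \<omega>))))))
        - (fst (residual \<epsilon> (snd (snd (fst \<omega>)), snd \<omega>)) + \<gamma> *\<^sub>R snd (residual \<epsilon> (snd (snd (fst \<omega>)), snd \<omega>)))) (e i + \<epsilon> * (M * (real i * c)) + r)"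
        using L2le_diff[OF L2le_add[OF Old[OF Qe] L2le_scaleR[OF grad, of \<epsilon>]] Loc[OF res2]] \<epsilon> by simp
      then have "L2le ?O (\<lambda>\<omega>. (dv (snd (fine_step \<epsilon> \<omega>)) + \<gamma> *\<^sub>R dx (snd (fine_step \<epsilon> \<omega>)))
        - ((dv (fst (fine_step \<epsilon> \<omega>)) + \<gamma> *\<^sub>R dx (fst (fine_step \<epsilon> \<omega>))) - (real (Suc i) * \<epsilon>) *\<^sub>R dg (fst (fine_step \<epsilon> \<omega>)))) (e i + \<epsilon> * (M * (real i * c)) + r)"
        unfolding fine_step_diffs(2) fst_step i\<epsilon> by (simp add: algebra_simps)
      then show "L2le ?O (\<lambda>\<omega>. (dv (snd (fine_step \<epsilon> \<omega>)) + \<gamma> *\<^sub>R dx (snd (fine_step \<epsilon> \<omega>)))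
        - ((dv (fst (fine_step \<epsilon> \<omega>)) + \<gamma> *\<^sub>R dx (fst (fine_step \<epsilon> \<omega>))) - (real (Suc i) * \<epsilon>) *\<^sub>R dg (fst (fine_step \<epsilon> \<omega>)))) (e (Suc i))"
        using e_Suc by (rule L2le_mono_bound)
    qed measurable
    show "L2le ?Q (\<lambda>q. dv (snd q) - (p0 (real (Suc i) * \<epsilon>) *\<^sub>R dv (fst q) - p1 (real (Suc i) * \<epsilon>) *\<^sub>R dg (fst q))) (e (Suc i))"
    proof (rule New)
      have e0: "0 \<le> \<epsilon>" using \<epsilon> by simp
      have "L2le ?O (\<lambda>\<omega>. (p0 \<epsilon> *\<^sub>R (dv (snd (fst \<omega>)) - (p0 (real i * \<epsilon>) *\<^sub>R dv (fst (fst \<omega>)) - p1 (real i * \<epsilon>) *\<^sub>R dg (fst (fst \<omega>))))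
        + p1 \<epsilon> *\<^sub>R (g (snd (snd (snd (fst \<omega>)))) - g (snd (snd (fst (fst \<omega>))))))
        - fst (residual \<epsilon> (snd (snd (fst \<omega>)), snd \<omega>))) (p0 \<epsilon> * e i + p1 \<epsilon> * (M * (real i * c)) + r)"
        using L2le_diff[OF L2le_add[OF L2le_scaleR[OF Old[OF Qf], of "p0 \<epsilon>"] L2le_scaleR[OF grad, of "p1 \<epsilon>"]] Loc[OF res1]]
          p0_pos[of \<epsilon>] p1_bounds(1)[OF e0] by simp
      then have "L2le ?O (\<lambda>\<omega>. dv (snd (fine_step \<epsilon> \<omega>))
        - (p0 (real (Suc i) * \<epsilon>) *\<^sub>R dv (fst (fine_step \<epsilon> \<omega>)) - p1 (real (Suc i) * \<epsilon>) *\<^sub>R dg (fst (fine_step \<epsilon> \<omega>)))) (p0 \<epsilon> * e i + p1 \<epsilon> * (M * (real i * c)) + r)"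
        unfolding fine_step_diffs(1) fst_step i\<epsilon> p0_add p1_add by (simp add: algebra_simps)
      \<comment> \<open>Since p0 is at most 1 and p1 at most \<epsilon>, the velocity coordinate
        obeys the same recursion as the first coordinate.\<close>
      moreover have "p0 \<epsilon> * e i + p1 \<epsilon> * (M * (real i * c)) + r \<le> e (Suc i)"
      proof -
        have "0 \<le> e i" using Qe by (rule L2le_bound_nonneg)
        then have "p0 \<epsilon> * e i \<le> e i" using p0_le_1[OF e0] p0_pos[of \<epsilon>] by (simp add: mult_left_le_one_le)
        moreover have "p1 \<epsilon> * (M * (real i * c)) \<le> \<epsilon> * (M * (real i * c))"
          using p1_bounds(2)[OF e0] M_pos c by (intro mult_right_mono) auto
        ultimately show ?thesis using e_Suc by linarith
      qed
      ultimately show "L2le ?O (\<lambda>\<omega>. dv (snd (fine_step \<epsilon> \<omega>))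
        - (p0 (real (Suc i) * \<epsilon>) *\<^sub>R dv (fst (fine_step \<epsilon> \<omega>)) - p1 (real (Suc i) * \<epsilon>) *\<^sub>R dg (fst (fine_step \<epsilon> \<omega>)))) (e (Suc i))"
        by (rule L2le_mono_bound)
    qed measurable
  qed simp
qed

end

section \<open>Wasserstein distance through couplings\<close>

lemma ennreal_sqrt_le:
  assumes "x \<le> ennreal (c\<^sup>2)" "0 \<le> c"
  shows "ennreal_sqrt x \<le> ennreal c"
proof -
  have "x \<noteq> \<infinity>" using assms(1) by (auto simp: top_unique)
  moreover have "enn2real x \<le> c\<^sup>2" using enn2real_mono[OF assms(1)] by simp
  ultimately show ?thesis
    using assms(2) real_sqrt_le_mono[of "enn2real x" "c\<^sup>2"] by (simp add: ennreal_sqrt_def ennreal_leI)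
qed

lemma W2_le:
  fixes K :: "('a::euclidean_space \<times> 'a) measure"
  assumes "K \<in> couplings \<mu> \<nu>" "L2le K (\<lambda>z. fst z - snd z) c"
  shows "W2 \<mu> \<nu> \<le> ennreal c"
  unfolding W2_def
proof (rule ennreal_sqrt_le)
  show "(INF K\<in>couplings \<mu> \<nu>. \<integral>\<^sup>+z. ennreal ((norm (fst z - snd z))\<^sup>2) \<partial>K) \<le> ennreal (c\<^sup>2)"
    using assms by (intro INF_lower2[OF assms(1)]) (simp add: L2le_def)
qed (use assms(2) in \<open>rule L2le_bound_nonneg\<close>)

text \<open>Existence of a minimizing coupling is avoided: the slack e is sent to 0 in the final
  estimate.\<close>

lemma W2_near_optimal_coupling:
  fixes \<mu> \<nu> :: "'a::euclidean_space measure"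
  assumes "W2 \<mu> \<nu> = ennreal w" "0 \<le> w" "0 < e"
  shows "\<exists>K\<in>couplings \<mu> \<nu>. L2le K (\<lambda>z. fst z - snd z) (w + e)"
proof -
  let ?I = "INF K\<in>couplings \<mu> \<nu>. \<integral>\<^sup>+z. ennreal ((norm (fst z - snd z))\<^sup>2) \<partial>K"
  have I: "?I \<noteq> \<infinity>" "sqrt (enn2real ?I) = w"
    using assms(1,2) by (auto simp: W2_def ennreal_sqrt_def split: if_splits)
  then have "?I = ennreal (w\<^sup>2)" by (metis enn2real_nonneg ennreal_enn2real_if infinity_ennreal_def real_sqrt_pow2)
  also have "\<dots> < ennreal ((w + e)\<^sup>2)" using assms by (intro ennreal_lessI) (auto intro: power_strict_mono)
  finally obtain K where K: "K \<in> couplings \<mu> \<nu>" "(\<integral>\<^sup>+z. ennreal ((norm (fst z - snd z))\<^sup>2) \<partial>K) < ennreal ((w + e)\<^sup>2)"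
    by (auto simp: INF_less_iff)
  have "sets K = sets (borel \<Otimes>\<^sub>M borel)" using K(1) by (simp add: couplings_def)
  then have "(\<lambda>z. fst z - snd z) \<in> borel_measurable K" by (simp cong: measurable_cong_sets)
  then show ?thesis using K assms by (auto simp: L2le_def less_imp_le)
qed

section \<open>Coarse steps and summation of their errors\<close>

context kinetic
begin

definition twisted :: "('a \<times> 'a) \<times> ('a \<times> 'a) \<Rightarrow> 'a \<times> 'a" where
  "twisted p = (dv p + \<gamma> *\<^sub>R dx p, dv p)"

lemma measurable_twisted: "twisted \<in> borel_measurable pairS"
  unfolding twisted_def by (rule borel_measurable_Pair) measurable

lemma contraction_factor:
  assumes "m + M \<le> \<gamma>\<^sup>2" "0 < h" "h \<le> m / (4 * \<gamma> * M)"
  shows "0 < 1 - 3/4 * m * h / \<gamma>" "1 - 3/4 * m * h / \<gamma> < 1"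
proof -
  have "m * h / \<gamma> \<le> m * (m / (4 * \<gamma> * M)) / \<gamma>"
    using assms m_pos \<gamma>_pos by (intro divide_right_mono mult_left_mono) auto
  also have "\<dots> = (m / M) * (m / \<gamma>\<^sup>2) / 4" by (simp add: power2_eq_square)
  also have "\<dots> \<le> 1 * 1 / 4"
    using m_pos m_le_M M_pos assms(1) \<gamma>_pos by (intro divide_right_mono mult_mono) auto
  finally have t: "m * h / \<gamma> < 4 / 3" by simp
  have "3/4 * (m * h / \<gamma>) < 3/4 * (4/3)" using t by (rule mult_strict_left_mono) simp
  then have "3/4 * m * h / \<gamma> < 1" by simp
  then show "0 < 1 - 3/4 * m * h / \<gamma>" by simp
  have "0 < 3/4 * m * h / \<gamma>" using m_pos assms(2) \<gamma>_pos by simp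
  then show "1 - 3/4 * m * h / \<gamma> < 1" by linarith
qed

lemma coarse_step:
  fixes J :: "(('a \<times> 'a) \<times> ('a \<times> 'a)) measure"
  assumes J: "prob_space J" "sets J = sets pairS"
    and J_snd: "\<And>F. F \<in> borel_measurable (borel \<Otimes>\<^sub>M borel) \<Longrightarrow> (\<integral>\<^sup>+p. F (snd p) \<partial>J) = (\<integral>\<^sup>+z. F z \<partial>stationary)"
    and \<gamma>: "m + M \<le> \<gamma>\<^sup>2" and h: "0 < h" "h \<le> m / (4 * \<gamma> * M)"
    and D: "L2le J twisted D" and \<delta>: "0 < \<delta>"
  shows "\<exists>J'. prob_space J' \<and> sets J' = sets pairS \<and>
    (\<forall>F \<in> borel_measurable (borel \<Otimes>\<^sub>M borel). (\<integral>\<^sup>+p. F (fst p) \<partial>J')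
      = (\<integral>\<^sup>+p. \<integral>\<^sup>+n. F (kstep h (g (snd (fst p))) (fst p) n) \<partial>noise h \<partial>J)) \<and>
    (\<forall>F \<in> borel_measurable (borel \<Otimes>\<^sub>M borel). (\<integral>\<^sup>+p. F (snd p) \<partial>J') = (\<integral>\<^sup>+z. F z \<partial>stationary)) \<and>
    L2le J' twisted ((1 - 3/4 * m * h / \<gamma>) * D + sqrt 2 * (M * h\<^sup>2 * sqrt DIM('a) / 2 + \<delta>))"
proof -
  \<comment> \<open>The tolerance e enters twice over a coarse step: through the displacement as M
    h^2 e / 2 and through the residuals as h e. Dividing \<delta> by their total weight makes the
    excess exactly \<delta>.\<close>
  define K where "K = M * h\<^sup>2 / 2 + h"
  have K: "0 < K" using M_pos h by (simp add: K_def add_nonneg_pos)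
  define e where "e = \<delta> / K"
  have e: "0 < e" "K * e = \<delta>" using \<delta> K by (auto simp: e_def)
  define p where "p = sqrt (real DIM('a))"
  have p: "0 \<le> p" by (simp add: p_def)
  obtain \<epsilon> N where \<epsilon>: "0 < \<epsilon>" "real N * \<epsilon> = h"
    and res1: "L2le (local_space \<epsilon>) (\<lambda>\<omega>. fst (residual \<epsilon> \<omega>)) (\<epsilon> * e)"
    and res2: "L2le (local_space \<epsilon>) (\<lambda>\<omega>. fst (residual \<epsilon> \<omega>) + \<gamma> *\<^sub>R snd (residual \<epsilon> \<omega>)) (\<epsilon> * e)"
    and disp: "L2le (local_space \<epsilon>) (\<lambda>\<omega>. snd (metropolis \<epsilon> (fst (snd \<omega>)) (fst \<omega>)) - snd (fst \<omega>)) (\<epsilon> * (p + e))"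
    using local_error[OF h(1) e(1)] unfolding p_def by blast
  define b where "b = M * h\<^sup>2 * p / 2 + \<delta>"
  have "\<epsilon> * M * (\<epsilon> * (p + e)) * (real N)\<^sup>2 / 2 + real N * (\<epsilon> * e) = M * (real N * \<epsilon>)\<^sup>2 * (p + e) / 2 + (real N * \<epsilon>) * e"
    by (simp add: power2_eq_square)
  also have "\<dots> = M * h\<^sup>2 * p / 2 + K * e" unfolding \<epsilon>(2) by (simp add: K_def field_simps)
  finally have b: "\<epsilon> * M * (\<epsilon> * (p + e)) * (real N)\<^sup>2 / 2 + real N * (\<epsilon> * e) = b" by (simp add: b_def e)
  have nn: "0 \<le> \<epsilon> * e" "0 \<le> \<epsilon> * (p + e)" using \<epsilon> e p by auto
  obtain Q where Q: "prob_space Q" "sets Q = sets (pairS \<Otimes>\<^sub>M pairS)"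
    and Qa: "\<And>F. F \<in> borel_measurable pairS \<Longrightarrow> (\<integral>\<^sup>+q. F (fst q) \<partial>Q) = (\<integral>\<^sup>+p. F p \<partial>J)"
    and Qb: "\<And>F. F \<in> borel_measurable pairS \<Longrightarrow> (\<integral>\<^sup>+q. F (fst (fst q), fst (snd q)) \<partial>Q)
      = (\<integral>\<^sup>+p. \<integral>\<^sup>+n. F (fst p, kstep h (g (snd (fst p))) (fst p) n) \<partial>noise h \<partial>J)"
    and Qc: "\<And>F. F \<in> borel_measurable (borel \<Otimes>\<^sub>M borel) \<Longrightarrow> (\<integral>\<^sup>+q. F (snd (snd q)) \<partial>Q) = (\<integral>\<^sup>+z. F z \<partial>stationary)"
    and Qe: "L2le Q (\<lambda>q. (dv (snd q) + \<gamma> *\<^sub>R dx (snd q)) - ((dv (fst q) + \<gamma> *\<^sub>R dx (fst q)) - h *\<^sub>R dg (fst q))) b"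
    and Qf: "L2le Q (\<lambda>q. dv (snd q) - (p0 h *\<^sub>R dv (fst q) - p1 h *\<^sub>R dg (fst q))) b"
    using fine_chain[OF J J_snd \<epsilon>(1) nn res1 res2 disp, of N] unfolding \<epsilon>(2) b by blast
  interpret Q: prob_space Q by (rule Q)
  note [measurable_cong] = Q(2)
  let ?J = "distr Q pairS snd"
  have T: "snd \<in> Q \<rightarrow>\<^sub>M pairS" by measurable
  have int: "(\<integral>\<^sup>+p. F p \<partial>?J) = (\<integral>\<^sup>+q. F (snd q) \<partial>Q)" if "F \<in> borel_measurable pairS" for F
    using that by (subst nn_integral_distr[OF T]) auto
  have init: "L2le Q (\<lambda>q. twisted (fst q)) D"
  proof (rule L2leI)
    note [measurable] = measurable_twisted
    show "(\<lambda>q. twisted (fst q)) \<in> borel_measurable Q" by measurable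
    have "(\<integral>\<^sup>+q. ennreal ((norm (twisted (fst q)))\<^sup>2) \<partial>Q) = (\<integral>\<^sup>+p. ennreal ((norm (twisted p))\<^sup>2) \<partial>J)"
      by (rule Qa[of "\<lambda>p. ennreal ((norm (twisted p))\<^sup>2)"]) measurable
    then show "(\<integral>\<^sup>+q. ennreal ((norm (twisted (fst q)))\<^sup>2) \<partial>Q) \<le> ennreal (D\<^sup>2)" using D by (simp add: L2le_def)
  qed (use D in \<open>rule L2le_bound_nonneg\<close>)
  let ?q = "1 - 3/4 * m * h / \<gamma>"
  have q: "0 < ?q" using contraction_factor[OF \<gamma> h] by simp
  \<comment> \<open>The twisted difference that a coarse step would produce if the stationary
    gradient were frozen as well. The contraction lemma applies to it, and the two bounds from the
    fine chain measure the deviation from it.\<close>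
  define V where "V p = ((dv p + \<gamma> *\<^sub>R dx p) - h *\<^sub>R dg p, p0 h *\<^sub>R dv p - p1 h *\<^sub>R dg p)" for p
  have V_le: "norm (V p) \<le> norm (?q *\<^sub>R twisted p)" for p
  proof -
    have "0 \<le> (dg p - m *\<^sub>R dx p) \<bullet> (M *\<^sub>R dx p - dg p)"
      using g_cocoercive[of "snd (fst p)" "snd (snd p)"] by (simp add: dg_def dx_def)
    from contraction_step[OF m_pos m_le_M \<gamma>_pos \<gamma> h this, of "dv p"]
    have "(norm (V p))\<^sup>2 \<le> ?q\<^sup>2 * (norm (twisted p))\<^sup>2"
      by (simp add: V_def twisted_def norm_prod_def p0_def p1_def)
    then have "(norm (V p))\<^sup>2 \<le> (norm (?q *\<^sub>R twisted p))\<^sup>2" by (simp add: power_mult_distrib)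
    then show ?thesis by (rule power2_le_imp_le) simp
  qed
  have V: "L2le Q (\<lambda>q. V (fst q)) (?q * D)"
  proof (rule L2le_dominated)
    show "L2le Q (\<lambda>q. ?q *\<^sub>R twisted (fst q)) (?q * D)" using L2le_scaleR[OF init, of ?q] q by simp
    show "(\<lambda>q. V (fst q)) \<in> borel_measurable Q"
      unfolding V_def by (rule borel_measurable_Pair) measurable
    show "norm (V (fst q)) \<le> norm (?q *\<^sub>R twisted (fst q))" for q by (rule V_le)
  qed
  have "L2le Q (\<lambda>q. V (fst q) + ((dv (snd q) + \<gamma> *\<^sub>R dx (snd q)) - ((dv (fst q) + \<gamma> *\<^sub>R dx (fst q)) - h *\<^sub>R dg (fst q)),
      dv (snd q) - (p0 h *\<^sub>R dv (fst q) - p1 h *\<^sub>R dg (fst q)))) (?q * D + sqrt (b\<^sup>2 + b\<^sup>2))"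
    by (rule L2le_add[OF V L2le_Pair[OF Qe Qf]])
  then have "L2le Q (\<lambda>q. twisted (snd q)) (?q * D + sqrt (b\<^sup>2 + b\<^sup>2))"
    by (simp add: V_def twisted_def)
  moreover have "sqrt (b\<^sup>2 + b\<^sup>2) = sqrt 2 * b"
    using L2le_bound_nonneg[OF Qe] by (simp add: real_sqrt_mult flip: mult_2)
  ultimately have tw: "L2le ?J twisted (?q * D + sqrt 2 * b)"
    by (simp add: L2le_distr[OF T measurable_twisted])
  show ?thesis
  proof (intro exI[of _ ?J] conjI ballI)
    show "prob_space ?J" by (rule Q.prob_space_distr[OF T])
    show "(\<integral>\<^sup>+p. F (fst p) \<partial>?J) = (\<integral>\<^sup>+p. \<integral>\<^sup>+n. F (kstep h (g (snd (fst p))) (fst p) n) \<partial>noise h \<partial>J)"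
      if [measurable]: "F \<in> borel_measurable (borel \<Otimes>\<^sub>M borel)" for F
      using Qb[of "\<lambda>p. F (snd p)"] by (subst int) auto
    show "(\<integral>\<^sup>+p. F (snd p) \<partial>?J) = (\<integral>\<^sup>+z. F z \<partial>stationary)" if [measurable]: "F \<in> borel_measurable (borel \<Otimes>\<^sub>M borel)" for F
      by (subst int) (auto simp: Qc)
    show "L2le ?J twisted (?q * D + sqrt 2 * (M * h\<^sup>2 * sqrt DIM('a) / 2 + \<delta>))"
      using tw by (simp add: b_def p_def)
  qed simp
qed

text \<open>The recursion D to q D + b has fixed point b / (1 - q), and 1 - q = 3/4 m h / \<gamma>.
  Allowing that fixed point as additive term makes the induction close.\<close>

lemma coupled_iterates:
  fixes \<mu> :: "nat \<Rightarrow> ('a \<times> 'a) measure"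
  assumes \<mu>_step: "\<And>k F. F \<in> borel_measurable (borel \<Otimes>\<^sub>M borel) \<Longrightarrow>
      (\<integral>\<^sup>+x. F x \<partial>\<mu> (Suc k)) = (\<integral>\<^sup>+x. \<integral>\<^sup>+n. F (kstep h (g (snd x)) x n) \<partial>noise h \<partial>\<mu> k)"
    and \<gamma>: "m + M \<le> \<gamma>\<^sup>2" and h: "0 < h" "h \<le> m / (4 * \<gamma> * M)" and \<delta>: "0 < \<delta>"
    and J: "prob_space J" "sets J = sets pairS"
    and J_fst: "\<And>F. F \<in> borel_measurable (borel \<Otimes>\<^sub>M borel) \<Longrightarrow> (\<integral>\<^sup>+p. F (fst p) \<partial>J) = (\<integral>\<^sup>+x. F x \<partial>\<mu> 0)"
    and J_snd: "\<And>F. F \<in> borel_measurable (borel \<Otimes>\<^sub>M borel) \<Longrightarrow> (\<integral>\<^sup>+p. F (snd p) \<partial>J) = (\<integral>\<^sup>+z. F z \<partial>stationary)"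
    and D: "L2le J twisted D"
  shows "\<exists>J. prob_space J \<and> sets J = sets pairS \<and>
    (\<forall>F \<in> borel_measurable (borel \<Otimes>\<^sub>M borel). (\<integral>\<^sup>+p. F (fst p) \<partial>J) = (\<integral>\<^sup>+x. F x \<partial>\<mu> k)) \<and>
    (\<forall>F \<in> borel_measurable (borel \<Otimes>\<^sub>M borel). (\<integral>\<^sup>+p. F (snd p) \<partial>J) = (\<integral>\<^sup>+z. F z \<partial>stationary)) \<and>
    L2le J twisted ((1 - 3/4 * m * h / \<gamma>) ^ k * D + sqrt 2 * (M * h\<^sup>2 * sqrt DIM('a) / 2 + \<delta>) / (3/4 * m * h / \<gamma>))"
proof (induction k)
  case 0
  have "0 \<le> sqrt 2 * (M * h\<^sup>2 * sqrt DIM('a) / 2 + \<delta>) / (3/4 * m * h / \<gamma>)"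
    using M_pos m_pos \<gamma>_pos h \<delta> by simp
  then have "L2le J twisted ((1 - 3/4 * m * h / \<gamma>) ^ 0 * D + sqrt 2 * (M * h\<^sup>2 * sqrt DIM('a) / 2 + \<delta>) / (3/4 * m * h / \<gamma>))"
    by (intro L2le_mono_bound[OF D]) simp
  then show ?case using J J_fst J_snd by blast
next
  case (Suc k)
  define q where "q = 1 - 3/4 * m * h / \<gamma>"
  define b where "b = sqrt 2 * (M * h\<^sup>2 * sqrt DIM('a) / 2 + \<delta>)"
  have q1: "3/4 * m * h / \<gamma> = 1 - q" "q < 1" using contraction_factor[OF \<gamma> h] by (auto simp: q_def)
  obtain J where J: "prob_space J" "sets J = sets pairS"
    and J_fst: "\<And>F. F \<in> borel_measurable (borel \<Otimes>\<^sub>M borel) \<Longrightarrow> (\<integral>\<^sup>+p. F (fst p) \<partial>J) = (\<integral>\<^sup>+x. F x \<partial>\<mu> k)"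
    and J_snd: "\<And>F. F \<in> borel_measurable (borel \<Otimes>\<^sub>M borel) \<Longrightarrow> (\<integral>\<^sup>+p. F (snd p) \<partial>J) = (\<integral>\<^sup>+z. F z \<partial>stationary)"
    and D: "L2le J twisted (q ^ k * D + b / (1 - q))"
    using Suc.IH unfolding b_def q1(1)[symmetric] q_def[symmetric] by blast
  obtain J' where J': "prob_space J'" "sets J' = sets pairS"
    and J'_fst: "\<And>F. F \<in> borel_measurable (borel \<Otimes>\<^sub>M borel) \<Longrightarrow> (\<integral>\<^sup>+p. F (fst p) \<partial>J')
      = (\<integral>\<^sup>+p. \<integral>\<^sup>+n. F (kstep h (g (snd (fst p))) (fst p) n) \<partial>noise h \<partial>J)"
    and J'_snd: "\<And>F. F \<in> borel_measurable (borel \<Otimes>\<^sub>M borel) \<Longrightarrow> (\<integral>\<^sup>+p. F (snd p) \<partial>J') = (\<integral>\<^sup>+z. F z \<partial>stationary)"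
    and D': "L2le J' twisted (q * (q ^ k * D + b / (1 - q)) + b)"
    using coarse_step[OF J J_snd \<gamma> h D \<delta>] unfolding b_def q_def[symmetric] by blast
  have "q * (q ^ k * D + b / (1 - q)) + b = q ^ Suc k * D + b / (1 - q)"
    using q1(2) by (simp add: field_simps)
  moreover have "(\<integral>\<^sup>+p. F (fst p) \<partial>J') = (\<integral>\<^sup>+x. F x \<partial>\<mu> (Suc k))" if F [measurable]: "F \<in> borel_measurable (borel \<Otimes>\<^sub>M borel)" for F
    unfolding J'_fst[OF F] \<mu>_step[OF F] by (rule J_fst) measurable
  ultimately show ?case
    using J' J'_snd D' unfolding b_def[symmetric] q1(1) unfolding q1(1)[symmetric] q_def[symmetric] by metis
qed

lemma W2_iterates:
  fixes \<mu> :: "nat \<Rightarrow> ('a \<times> 'a) measure" and \<nu>0 :: "'a measure"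
  assumes \<mu>_sets: "\<And>k. sets (\<mu> k) = sets (borel \<Otimes>\<^sub>M borel)"
    and \<mu>_0: "\<mu> 0 = gaussian \<Otimes>\<^sub>M \<nu>0" and \<nu>0: "prob_space \<nu>0" "sets \<nu>0 = sets borel"
    and \<mu>_step: "\<And>k F. F \<in> borel_measurable (borel \<Otimes>\<^sub>M borel) \<Longrightarrow>
      (\<integral>\<^sup>+x. F x \<partial>\<mu> (Suc k)) = (\<integral>\<^sup>+x. \<integral>\<^sup>+n. F (kstep h (g (snd x)) x n) \<partial>noise h \<partial>\<mu> k)"
    and \<gamma>: "m + M \<le> \<gamma>\<^sup>2" and h: "0 < h" "h \<le> m / (4 * \<gamma> * M)"
  shows "W2 (distr (\<mu> k) borel snd) target
    \<le> ennreal (sqrt 2 * (1 - 3/4 * m * h / \<gamma>) ^ k) * W2 \<nu>0 target + ennreal (M * h * sqrt (2 * DIM('a)) / m)"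
proof (cases "W2 \<nu>0 target = \<infinity>")
  case True
  define c where "c = sqrt 2 * (1 - 3/4 * m * h / \<gamma>) ^ k"
  \<comment> \<open>Positivity is essential, as 0 times infinity is 0 in \<open>ennreal\<close>;
    with it the right side is infinite.\<close>
  have "0 < c" using contraction_factor[OF \<gamma> h] by (simp add: c_def)
  then show ?thesis using True unfolding c_def[symmetric] by (simp add: ennreal_mult_top ennreal_eq_0_iff)
next
  case False
  define q where "q = 1 - 3/4 * m * h / \<gamma>"
  have q: "0 < q" "q < 1" using contraction_factor[OF \<gamma> h] by (auto simp: q_def)
  define s where "s = sqrt (real DIM('a))"
  have s: "0 < s" by (simp add: s_def)
  obtain w where w: "0 \<le> w" "W2 \<nu>0 target = ennreal w" using False by (cases "W2 \<nu>0 target") auto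
  have sqrt2: "(4::real) / 3 < sqrt 2" by (rule real_less_rsqrt) (simp add: power2_eq_square)
  \<comment> \<open>Chosen so that 2 \<delta> / (3/4 m h) fills exactly the gap between 4/3 M h s /
    m and sqrt 2 M h s / m.\<close>
  define \<delta> where "\<delta> = (sqrt 2 - 4/3) * (M * h * s / m) * (3/8 * m * h)"
  have \<delta>: "0 < \<delta>" using sqrt2 M_pos m_pos h s by (simp add: \<delta>_def)
  have main: "W2 (distr (\<mu> k) borel snd) target \<le> ennreal (sqrt 2 * q ^ k * (w + e) + M * h * (sqrt 2 * s) / m)"
    if e: "0 < e" for e
  proof -
    obtain K where K: "K \<in> couplings \<nu>0 target" "L2le K (\<lambda>z. fst z - snd z) (w + e)"
      using W2_near_optimal_coupling[OF w(2,1) e] by blast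
    have Ks [measurable_cong]: "sets K = sets (borel \<Otimes>\<^sub>M borel)" and K1: "distr K borel fst = \<nu>0" and K2: "distr K borel snd = target"
      using K(1) by (auto simp: couplings_def)
    have fstK: "fst \<in> borel_measurable K" and sndK: "snd \<in> borel_measurable K" by measurable
    interpret K: prob_space K
    proof
      have "emeasure K (space K) = emeasure (distr K borel fst) UNIV"
        using emeasure_distr[OF fstK, of UNIV] by simp
      also have "\<dots> = 1"
        using prob_space.emeasure_space_1[OF \<nu>0(1)] sets_eq_imp_space_eq[OF \<nu>0(2)] by (simp add: K1)
      finally show "emeasure K (space K) = 1" .
    qed
    let ?G = "gaussian :: 'a measure"
    interpret GK: pair_prob_space ?G K ..
    interpret nu0: prob_space \<nu>0 by (rule \<nu>0)
    note [measurable_cong] = \<nu>0(2)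
    \<comment> \<open>Both copies receive the same velocity, which is possible because both initial
      laws have an independent standard normal velocity. The twisted difference is then (\<gamma>
      \<Delta>\<theta>, 0).\<close>
    let ?T = "\<lambda>(v, z). ((v, fst z), (v, snd z))"
    have T: "?T \<in> ?G \<Otimes>\<^sub>M K \<rightarrow>\<^sub>M pairS" by measurable
    let ?J = "distr (?G \<Otimes>\<^sub>M K) pairS ?T"
    have int: "(\<integral>\<^sup>+p. F p \<partial>?J) = (\<integral>\<^sup>+v. \<integral>\<^sup>+z. F ((v, fst z), (v, snd z)) \<partial>K \<partial>?G)" if [measurable]: "F \<in> borel_measurable pairS" for F
      by (subst nn_integral_distr[OF T]) (auto simp: K.nn_integral_fst[symmetric])
    have J: "prob_space ?J" "sets ?J = sets pairS" by (rule GK.prob_space_distr[OF T]) simp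
    have sec: "(\<lambda>x. F (v, x)) \<in> borel_measurable borel" if "F \<in> borel_measurable (borel \<Otimes>\<^sub>M borel)" for F :: "'a \<times> 'a \<Rightarrow> ennreal" and v
      by (rule measurable_compose[OF measurable_Pair1' that]) simp
    have J_fst: "(\<integral>\<^sup>+p. F (fst p) \<partial>?J) = (\<integral>\<^sup>+x. F x \<partial>\<mu> 0)" if F [measurable]: "F \<in> borel_measurable (borel \<Otimes>\<^sub>M borel)" for F
    proof -
      have "(\<integral>\<^sup>+p. F (fst p) \<partial>?J) = (\<integral>\<^sup>+v. \<integral>\<^sup>+z. F (v, fst z) \<partial>K \<partial>?G)" by (subst int) auto
      also have "\<dots> = (\<integral>\<^sup>+v. \<integral>\<^sup>+x. F (v, x) \<partial>distr K borel fst \<partial>?G)"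
        by (rule nn_integral_cong, subst nn_integral_distr[OF fstK]) (use sec[OF F] in auto)
      also have "\<dots> = (\<integral>\<^sup>+x. F x \<partial>\<mu> 0)" unfolding K1 \<mu>_0 by (rule nu0.nn_integral_fst) measurable
      finally show ?thesis .
    qed
    have J_snd: "(\<integral>\<^sup>+p. F (snd p) \<partial>?J) = (\<integral>\<^sup>+z. F z \<partial>stationary)" if F [measurable]: "F \<in> borel_measurable (borel \<Otimes>\<^sub>M borel)" for F
    proof -
      have "(\<integral>\<^sup>+p. F (snd p) \<partial>?J) = (\<integral>\<^sup>+v. \<integral>\<^sup>+z. F (v, snd z) \<partial>K \<partial>?G)" by (subst int) auto
      also have "\<dots> = (\<integral>\<^sup>+v. \<integral>\<^sup>+x. F (v, x) \<partial>distr K borel snd \<partial>?G)"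
        by (rule nn_integral_cong, subst nn_integral_distr[OF sndK]) (use sec[OF F] in auto)
      also have "\<dots> = (\<integral>\<^sup>+z. F z \<partial>stationary)" unfolding K2 by (rule nn_integral_stationary[symmetric]) measurable
      finally show ?thesis .
    qed
    have D: "L2le ?J twisted (\<gamma> * (w + e))"
    proof -
      have "L2le (?G \<Otimes>\<^sub>M K) (\<lambda>p. fst (snd p) - snd (snd p)) (w + e)"
        by (rule L2le_pair_snd[OF K(2) gaussian.prob_space_axioms K.sigma_finite_measure_axioms])
      then have "L2le (?G \<Otimes>\<^sub>M K) (\<lambda>p. (\<gamma> *\<^sub>R (fst (snd p) - snd (snd p)), 0 :: 'a)) (sqrt ((\<gamma> * (w + e))\<^sup>2 + 0\<^sup>2))"
        using L2le_Pair[OF L2le_scaleR L2le_zero, of _ _ "w + e" \<gamma>] \<gamma>_pos by simp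
      moreover have "twisted (?T p) = (\<gamma> *\<^sub>R (fst (snd p) - snd (snd p)), 0 :: 'a)" for p :: "'a \<times> 'a \<times> 'a"
        by (simp add: twisted_def dv_def dx_def split_beta)
      ultimately show ?thesis
        using \<gamma>_pos w e by (simp add: L2le_distr[OF T measurable_twisted])
    qed
    define B where "B = q ^ k * (\<gamma> * (w + e)) + sqrt 2 * (M * h\<^sup>2 * s / 2 + \<delta>) / (3/4 * m * h / \<gamma>)"
    obtain J' where J': "prob_space J'" and J's [measurable_cong]: "sets J' = sets pairS"
      and J'_fst: "\<And>F. F \<in> borel_measurable (borel \<Otimes>\<^sub>M borel) \<Longrightarrow> (\<integral>\<^sup>+p. F (fst p) \<partial>J') = (\<integral>\<^sup>+x. F x \<partial>\<mu> k)"
      and J'_snd: "\<And>F. F \<in> borel_measurable (borel \<Otimes>\<^sub>M borel) \<Longrightarrow> (\<integral>\<^sup>+p. F (snd p) \<partial>J') = (\<integral>\<^sup>+z. F z \<partial>stationary)"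
      and D': "L2le J' twisted B"
      using coupled_iterates[OF \<mu>_step \<gamma> h \<delta> J J_fst J_snd D, of k] unfolding B_def q_def s_def by blast
    let ?S = "\<lambda>p. (snd (fst p), snd (snd p))"
    have S: "?S \<in> J' \<rightarrow>\<^sub>M borel \<Otimes>\<^sub>M borel" by measurable
    let ?K = "distr J' (borel \<Otimes>\<^sub>M borel) ?S"
    have "?K \<in> couplings (distr (\<mu> k) borel snd) target"
    proof -
      have snd\<mu>: "snd \<in> borel_measurable (\<mu> k)" using \<mu>_sets[of k] by (simp cong: measurable_cong_sets)
      have sndS: "snd \<in> borel_measurable stationary" by measurable
      have law: "distr ?K borel fst = distr (\<mu> k) borel snd" "distr ?K borel snd = target"
      proof -
        show "distr ?K borel fst = distr (\<mu> k) borel snd"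
        proof (rule measure_eqI)
          fix A :: "'a set" assume "A \<in> sets (distr ?K borel fst)"
          then have A [measurable]: "A \<in> sets borel" by simp
          have "emeasure (distr ?K borel fst) A = (\<integral>\<^sup>+x. indicator A x \<partial>distr ?K borel fst)" by simp
          also have "\<dots> = (\<integral>\<^sup>+p. indicator A (snd (fst p)) \<partial>J')"
            by (subst nn_integral_distr, measurable, subst nn_integral_distr[OF S]) auto
          also have "\<dots> = (\<integral>\<^sup>+x. indicator A (snd x) \<partial>\<mu> k)" by (rule J'_fst) measurable
          also have "\<dots> = (\<integral>\<^sup>+x. indicator A x \<partial>distr (\<mu> k) borel snd)" by (subst nn_integral_distr[OF snd\<mu>]) auto
          finally show "emeasure (distr ?K borel fst) A = emeasure (distr (\<mu> k) borel snd) A" by simp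
        qed simp
        show "distr ?K borel snd = target"
        proof (rule measure_eqI)
          fix A :: "'a set" assume "A \<in> sets (distr ?K borel snd)"
          then have A [measurable]: "A \<in> sets borel" by simp
          have "emeasure (distr ?K borel snd) A = (\<integral>\<^sup>+x. indicator A x \<partial>distr ?K borel snd)" by simp
          also have "\<dots> = (\<integral>\<^sup>+p. indicator A (snd (snd p)) \<partial>J')"
            by (subst nn_integral_distr, measurable, subst nn_integral_distr[OF S]) auto
          also have "\<dots> = (\<integral>\<^sup>+z. indicator A (snd z) \<partial>stationary)" by (rule J'_snd) measurable
          also have "\<dots> = (\<integral>\<^sup>+x. indicator A x \<partial>target)"
            by (subst nn_integral_stationary) (auto simp: gaussian.emeasure_space_1[simplified])
          finally show "emeasure (distr ?K borel snd) A = emeasure target A" by simp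
        qed simp
      qed
      then show ?thesis by (simp add: couplings_def)
    qed
    moreover have "L2le ?K (\<lambda>z. fst z - snd z) (sqrt 2 * q ^ k * (w + e) + M * h * (sqrt 2 * s) / m)"
    proof -
      have "L2le J' (\<lambda>p. dx p) (sqrt 2 / \<gamma> * B)"
      proof (rule L2le_dominated)
        show "L2le J' (\<lambda>p. (sqrt 2 / \<gamma>) *\<^sub>R twisted p) (sqrt 2 / \<gamma> * B)"
          using L2le_scaleR[OF D', of "sqrt 2 / \<gamma>"] \<gamma>_pos by simp
        fix p :: "('a \<times> 'a) \<times> ('a \<times> 'a)"
        \<comment> \<open>\<gamma> \<Delta>\<theta> is the difference of the two twisted
          coordinates, hence at most sqrt 2 times their joint norm.\<close>
        have "(norm (\<gamma> *\<^sub>R dx p))\<^sup>2 \<le> 2 * (norm (dv p + \<gamma> *\<^sub>R dx p))\<^sup>2 + 2 * (norm (dv p))\<^sup>2"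
          using norm_add_sq_le[of 1 "dv p + \<gamma> *\<^sub>R dx p" "- dv p"] by simp
        then have "(norm (\<gamma> *\<^sub>R dx p))\<^sup>2 \<le> (sqrt 2 * norm (twisted p))\<^sup>2"
          by (simp add: twisted_def norm_prod_def power_mult_distrib)
        then have "norm (\<gamma> *\<^sub>R dx p) \<le> sqrt 2 * norm (twisted p)" by (rule power2_le_imp_le) simp
        then show "norm (dx p) \<le> norm ((sqrt 2 / \<gamma>) *\<^sub>R twisted p)" using \<gamma>_pos by (simp add: field_simps)
      qed measurable
      moreover have "sqrt 2 / \<gamma> * B = sqrt 2 * q ^ k * (w + e) + M * h * (sqrt 2 * s) / m"
      proof -
        have "c / \<gamma> * (q ^ k * (\<gamma> * (w + e)) + c * X / (3/4 * m * h / \<gamma>)) = c * q ^ k * (w + e) + c\<^sup>2 * X / (3/4 * m * h)" for c X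
          using \<gamma>_pos m_pos h by (simp add: field_simps power2_eq_square)
        then have "sqrt 2 / \<gamma> * B = sqrt 2 * q ^ k * (w + e) + (sqrt 2)\<^sup>2 * (M * h\<^sup>2 * s / 2 + \<delta>) / (3/4 * m * h)"
          unfolding B_def .
        also have "(sqrt 2)\<^sup>2 * (M * h\<^sup>2 * s / 2 + \<delta>) / (3/4 * m * h) = M * h * (sqrt 2 * s) / m"
          using m_pos h by (simp add: \<delta>_def field_simps power2_eq_square)
        finally show ?thesis .
      qed
      ultimately show ?thesis
        by (simp add: L2le_distr[OF S] dx_def)
    qed
    ultimately show ?thesis by (rule W2_le)
  qed
  have nn: "0 \<le> sqrt 2 * q ^ k" "0 \<le> M * h * (sqrt 2 * s) / m" using q M_pos m_pos h s by auto
  have "W2 (distr (\<mu> k) borel snd) target \<le> ennreal (sqrt 2 * q ^ k * w + M * h * (sqrt 2 * s) / m)"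
  proof (rule ennreal_le_epsilon)
    fix e :: real assume e: "0 < e"
    have c: "0 < sqrt 2 * q ^ k" using q by simp
    have "sqrt 2 * q ^ k * (w + e / (sqrt 2 * q ^ k)) + M * h * (sqrt 2 * s) / m = (sqrt 2 * q ^ k * w + M * h * (sqrt 2 * s) / m) + e"
      using q by (simp add: field_simps)
    then show "W2 (distr (\<mu> k) borel snd) target \<le> ennreal (sqrt 2 * q ^ k * w + M * h * (sqrt 2 * s) / m) + ennreal e"
      using main[of "e / (sqrt 2 * q ^ k)"] e c nn w by (simp add: ennreal_plus[symmetric] add_ac del: ennreal_plus)
  qed
  also have "\<dots> = ennreal (sqrt 2 * q ^ k) * W2 \<nu>0 target + ennreal (M * h * sqrt (2 * DIM('a)) / m)"
    using nn w by (simp add: ennreal_plus ennreal_mult s_def real_sqrt_mult)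
  finally show ?thesis by (simp add: q_def)
qed

end

section \<open>The law of the algorithm\<close>

context kinetic
begin

lemma has_integral_deriv_from_0:
  fixes F F' :: "real \<Rightarrow> real"
  assumes "0 \<le> t" "F 0 = 0" "\<And>x. (F has_real_derivative F' x) (at x)"
  shows "(F' has_integral F t) {0..t}"
  using fundamental_theorem_of_calculus[of 0 t F F'] assms
  by (simp add: has_field_derivative_at_within flip: has_real_derivative_iff_has_vector_derivative)

lemma psi_0: "psi \<gamma> 0 = p0"
  by (simp add: fun_eq_iff p0_def)

lemma psi_1: "0 \<le> t \<Longrightarrow> psi \<gamma> 1 t = p1 t"
  using has_integral_deriv_from_0[OF _ zero_simps(2) deriv_p1, of t] by (simp add: psi_0[simplified] integral_unique)

lemma psi_2: "0 \<le> t \<Longrightarrow> psi \<gamma> 2 t = p2 t"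
proof -
  assume t: "0 \<le> t"
  have "psi \<gamma> 2 t = integral {0..t} (psi \<gamma> 1)" by (simp add: numeral_2_eq_2)
  also have "\<dots> = integral {0..t} p1" by (intro integral_cong psi_1) auto
  also have "\<dots> = p2 t"
    using has_integral_deriv_from_0[OF t zero_simps(3) deriv_p2] by (rule integral_unique)
  finally show ?thesis .
qed

lemma klmc_cov_entries:
  assumes h: "0 \<le> h"
  shows "klmc_cov \<gamma> h $ 1 $ 1 = c11 h" "klmc_cov \<gamma> h $ 1 $ 2 = c12 h" "klmc_cov \<gamma> h $ 2 $ 2 = c22 h"
proof -
  define W where "W t = (vector [psi \<gamma> 0 t, psi \<gamma> 1 t] :: real^2)" for t
  define S :: "real^2^2" where "S = vector [vector [c11 h, c12 h], vector [c12 h, c22 h]]"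
  have W: "W t $ 1 = p0 t" "0 \<le> t \<Longrightarrow> W t $ 2 = p1 t" for t
    by (simp_all only: W_def vector_2 psi_0 psi_1)
  note d = has_integral_deriv_from_0[OF h]
  have entry: "((\<lambda>t. W t $ i * W t $ j) has_integral S $ i $ j) {0..h}" for i j
  proof -
    have "((\<lambda>t. p0 t * p0 t) has_integral c11 h) {0..h}" "((\<lambda>t. p0 t * p1 t) has_integral c12 h) {0..h}"
      "((\<lambda>t. p1 t * p0 t) has_integral c12 h) {0..h}" "((\<lambda>t. p1 t * p1 t) has_integral c22 h) {0..h}"
      using d[OF _ deriv_c11] d[OF _ deriv_c12] d[OF _ deriv_c22] by (simp_all add: power2_eq_square mult.commute)
    \<comment> \<open>The closed form of \<open>psi\<close> is valid for nonnegative times, so the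
      integrands are identified on the interval only.\<close>
    moreover have "((\<lambda>t. W t $ i * W t $ j) has_integral S $ i $ j) {0..h}
      \<longleftrightarrow> ((\<lambda>t. (if i = 1 then p0 t else p1 t) * (if j = 1 then p0 t else p1 t)) has_integral S $ i $ j) {0..h}"
      using exhaust_2[of i] exhaust_2[of j] by (intro has_integral_cong) (auto simp: W)
    ultimately show ?thesis
      using exhaust_2[of i] exhaust_2[of j] by (auto simp: S_def)
  qed
  have "((\<lambda>t. \<chi> i j. W t $ i * W t $ j) has_integral S) {0..h}"
    unfolding has_integral_componentwise_iff[of _ S]
    using entry by (auto simp: Basis_vec_def inner_axis)
  then have "klmc_cov \<gamma> h = S"
    unfolding klmc_cov_def Let_def W_def[symmetric] by (rule integral_unique)
  then show "klmc_cov \<gamma> h $ 1 $ 1 = c11 h" "klmc_cov \<gamma> h $ 1 $ 2 = c12 h" "klmc_cov \<gamma> h $ 2 $ 2 = c22 h"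
    by (simp_all add: S_def)
qed

end

section \<open>From the hypotheses on f and the noise to the abstract setting\<close>

lemma gradient_GDERIV:
  fixes f :: "'a::euclidean_space \<Rightarrow> real"
  assumes "f differentiable (at x)"
  shows "(f has_derivative (\<lambda>u. gradient f x \<bullet> u)) (at x)"
proof -
  obtain D where D: "(f has_derivative D) (at x)" using assms by (auto simp: differentiable_def)
  have lin: "linear D" using D by (rule has_derivative_linear)
  \<comment> \<open>The Riesz vector of the derivative. It exists by linearity and is unique, which
    gives the definite description in \<open>gradient\<close> its value.\<close>
  define d where "d = (\<Sum>b\<in>Basis. D b *\<^sub>R b)"
  have "D u = u \<bullet> d" for u
  proof -
    have "D u = D (\<Sum>b\<in>Basis. (u \<bullet> b) *\<^sub>R b)" by (simp add: euclidean_representation)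
    also have "\<dots> = (\<Sum>b\<in>Basis. (u \<bullet> b) * D b)" using lin by (simp add: linear_sum linear_cmul)
    finally show ?thesis by (simp add: d_def inner_sum_right mult.commute)
  qed
  then have "D = (\<lambda>u. u \<bullet> d)" by (rule ext)
  then have d: "GDERIV f x :> d" using D by (simp add: gderiv_def)
  have "gradient f x = d"
    unfolding gradient_def
  proof (rule the_equality[where P="\<lambda>D. GDERIV f x :> D", OF d])
    fix d' assume "GDERIV f x :> d'"
    then have "(\<lambda>u. u \<bullet> d') = (\<lambda>u. u \<bullet> d)"
      using d unfolding gderiv_def by (rule has_derivative_unique)
    then show "d' = d" by (metis vector_eq_ldot)
  qed
  then show ?thesis using d by (simp add: gderiv_def inner_commute)
qed

lemma mat_vector_mult: "mat c *v u = c *\<^sub>R u"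
  for u :: "real^'n"
  by (simp add: vec_eq_iff matrix_vector_mult_def mat_def if_distrib[of "\<lambda>x. x * _"] cong: if_cong)

lemma kinetic_gradient:
  fixes f :: "real^'n \<Rightarrow> real"
  assumes m: "0 < m" "m \<le> M" and f: "twice_differentiable f"
    and hess: "\<And>x. mat m \<preceq>\<^sub>L hessian f x \<and> hessian f x \<preceq>\<^sub>L mat M" and \<gamma>: "0 < \<gamma>"
  shows "kinetic f (gradient f) m M \<gamma>"
proof
  show "(f has_derivative (\<lambda>u. gradient f x \<bullet> u)) (at x)" for x
    using f by (intro gradient_GDERIV) (simp add: twice_differentiable_def)
  show "\<exists>H. (gradient f has_derivative H) (at x) \<and> (\<forall>u. m * (norm u)\<^sup>2 \<le> u \<bullet> H u \<and> u \<bullet> H u \<le> M * (norm u)\<^sup>2)" for x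
  proof (intro exI conjI allI)
    show "(gradient f has_derivative (\<lambda>u. hessian f x *v u)) (at x)"
      using f unfolding hessian_def jacobian_works[symmetric] by (simp add: twice_differentiable_def)
    show "m * (norm u)\<^sup>2 \<le> u \<bullet> (hessian f x *v u)" "u \<bullet> (hessian f x *v u) \<le> M * (norm u)\<^sup>2" for u
      using hess[of x] unfolding loewner_le_def pos_semidef_def
      by (auto simp: matrix_vector_mult_diff_rdistrib mat_vector_mult inner_diff_right power2_norm_eq_inner)
  qed
qed (use m \<gamma> in auto)

text \<open>The Markov property of the algorithm in integrated form: the state after k steps is a
  function of the initial pair and the first k noise vectors, hence independent of the next one,
  whose law is \<open>noise h\<close>.\<close>

lemma klmc_law_step:
  fixes f :: "real^'n \<Rightarrow> real" and P :: "'w measure"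
  assumes kin: "kinetic f (gradient f) m M \<gamma>" and P: "prob_space P"
    and noise: "klmc_noise P \<gamma> h v0 \<theta>0 \<xi> \<xi>'" and h: "0 < h"
  defines "Z \<equiv> klmc f \<gamma> h v0 \<theta>0 \<xi> \<xi>'"
  shows "Z k \<in> P \<rightarrow>\<^sub>M borel \<Otimes>\<^sub>M borel"
    and "F \<in> borel_measurable (borel \<Otimes>\<^sub>M borel) \<Longrightarrow> (\<integral>\<^sup>+\<omega>. F (Z (Suc k) \<omega>) \<partial>P)
      = (\<integral>\<^sup>+\<omega>. \<integral>\<^sup>+n. F (kinetic.kstep \<gamma> h (gradient f (snd (Z k \<omega>))) (Z k \<omega>) n) \<partial>kinetic.noise \<gamma> h \<partial>P)"
proof -
  interpret kinetic f "gradient f" m M \<gamma> by (rule kin)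
  interpret P: prob_space P by (rule P)
  define X where "X j \<omega> = (if j = 0 then (v0 \<omega>, \<theta>0 \<omega>) else (\<xi> j \<omega>, \<xi>' j \<omega>))" for j \<omega>
  have ind: "P.indep_vars (\<lambda>_. borel) X UNIV"
    using noise unfolding klmc_noise_def X_def by blast
  \<comment> \<open>The algorithm as a deterministic function of the whole input sequence, obtained
    by running \<open>klmc\<close> on sequence space. Measurability and dependence on finitely many
    inputs are proved for it, and the actual iterate is its value at the random sequence.\<close>
  define C :: "nat \<Rightarrow> (nat \<Rightarrow> (real^'n) \<times> (real^'n)) \<Rightarrow> (real^'n) \<times> (real^'n)"
    where "C = klmc f \<gamma> h (\<lambda>x. fst (x 0)) (\<lambda>x. snd (x 0)) (\<lambda>j x. fst (x j)) (\<lambda>j x. snd (x j))"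
  have psi: "psi \<gamma> 0 h = p0 h" "psi \<gamma> 1 h = p1 h" "psi \<gamma> 2 h = p2 h"
    using h psi_0 psi_1[of h] psi_2[of h] by auto
  have C_0: "C 0 x = x 0" for x by (simp add: C_def)
  have C_Suc: "C (Suc j) x = kstep h (gradient f (snd (C j x))) (C j x) (x (Suc j))" for j x
    unfolding C_def klmc.simps psi kstep_def Let_def by (simp add: split_beta)
  have Z_Suc: "Z (Suc j) \<omega> = kstep h (gradient f (snd (Z j \<omega>))) (Z j \<omega>) (X (Suc j) \<omega>)" for j \<omega>
    unfolding Z_def klmc.simps psi kstep_def Let_def X_def by (simp add: split_beta)
  have ZC: "Z j \<omega> = C j (\<lambda>i. X i \<omega>)" for j \<omega>
  proof (induction j)
    case 0
    then show ?case by (simp add: C_0 Z_def X_def)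
  next
    case (Suc j)
    then show ?case by (simp only: C_Suc Z_Suc)
  qed
  have C_cong: "(\<And>i. i \<le> j \<Longrightarrow> x i = y i) \<Longrightarrow> C j x = C j y" for j x y
    by (induction j) (simp_all add: C_0 C_Suc)
  have C_meas: "j \<le> k \<Longrightarrow> C j \<in> (\<Pi>\<^sub>M i\<in>{..k}. borel) \<rightarrow>\<^sub>M borel \<Otimes>\<^sub>M borel" for j k
  proof (induction j)
    case 0
    then show ?case
      unfolding C_0[abs_def] borel_prod by (intro measurable_component_singleton) auto
  next
    case (Suc j)
    have [measurable]: "(\<lambda>x :: nat \<Rightarrow> (real^'n) \<times> (real^'n). x (Suc j)) \<in> (\<Pi>\<^sub>M i\<in>{..k}. borel) \<rightarrow>\<^sub>M borel \<Otimes>\<^sub>M borel"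
      unfolding borel_prod using Suc.prems by (intro measurable_component_singleton) auto
    have [measurable]: "C j \<in> (\<Pi>\<^sub>M i\<in>{..k}. borel) \<rightarrow>\<^sub>M borel \<Otimes>\<^sub>M borel" using Suc by simp
    show ?case unfolding C_Suc[abs_def] by measurable
  qed
  have Z_restrict: "Z k = C k \<circ> (\<lambda>\<omega>. restrict (\<lambda>i. X i \<omega>) {..k})" for k
    by (auto simp: ZC fun_eq_iff intro!: C_cong)
  \<comment> \<open>Blocks of an independent family over disjoint index sets are independent: the
    indices up to k determine the state, and index k + 1 is the new noise.\<close>
  have "P.indep_var (\<Pi>\<^sub>M i\<in>{..k}. borel) (\<lambda>\<omega>. restrict (\<lambda>i. X i \<omega>) {..k}) (\<Pi>\<^sub>M i\<in>{Suc k}. borel) (\<lambda>\<omega>. restrict (\<lambda>i. X i \<omega>) {Suc k})"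
    by (rule P.indep_var_restrict[OF ind]) auto
  then have "P.indep_var (borel \<Otimes>\<^sub>M borel) (C k \<circ> (\<lambda>\<omega>. restrict (\<lambda>i. X i \<omega>) {..k}))
      borel ((\<lambda>x. x (Suc k)) \<circ> (\<lambda>\<omega>. restrict (\<lambda>i. X i \<omega>) {Suc k}))"
    by (rule P.indep_var_compose) (auto intro: C_meas)
  then have indep: "P.indep_var (borel \<Otimes>\<^sub>M borel) (Z k) (borel \<Otimes>\<^sub>M borel) (X (Suc k))"
    unfolding Z_restrict borel_prod by (simp add: comp_def)
  then show Zk: "Z k \<in> P \<rightarrow>\<^sub>M borel \<Otimes>\<^sub>M borel" by (rule P.indep_var_rv1)
  have Xk: "X (Suc k) \<in> P \<rightarrow>\<^sub>M borel \<Otimes>\<^sub>M borel" using indep by (rule P.indep_var_rv2)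
  have law: "distr P (borel \<Otimes>\<^sub>M borel) (X (Suc k)) = noise h"
  proof -
    have "distr P (borel \<Otimes>\<^sub>M borel) (\<lambda>\<omega>. (\<xi> (Suc k) \<omega>, \<xi>' (Suc k) \<omega>)) = gaussian_pair (n\<alpha> h) (n\<beta> h) (n\<sigma> h)"
    proof (rule distr_iid_gaussian_pairs[OF P, where S="klmc_cov \<gamma> h"])
      have k: "1 \<le> Suc k" by simp
      show "P.indep_vars (\<lambda>_. borel) (\<lambda>i \<omega>. vector [\<xi> (Suc k) \<omega> $ i, \<xi>' (Suc k) \<omega> $ i] :: real^2) UNIV"
        using noise k unfolding klmc_noise_def by blast
      show "is_gaussian (distr P borel (\<lambda>\<omega>. vector [\<xi> (Suc k) \<omega> $ i, \<xi>' (Suc k) \<omega> $ i])) 0 (klmc_cov \<gamma> h)" for i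
        using noise k unfolding klmc_noise_def by blast
    qed (use h noise_coeffs[of h] klmc_cov_entries[of h] in auto)
    moreover have "X (Suc k) = (\<lambda>\<omega>. (\<xi> (Suc k) \<omega>, \<xi>' (Suc k) \<omega>))" by (simp add: X_def fun_eq_iff)
    ultimately show ?thesis by (simp add: noise_def)
  qed
  assume F [measurable]: "F \<in> borel_measurable (borel \<Otimes>\<^sub>M borel)"
  let ?E = "borel \<Otimes>\<^sub>M borel :: ((real^'n) \<times> (real^'n)) measure"
  let ?H = "\<lambda>p. F (kstep h (gradient f (snd (fst p))) (fst p) (snd p))"
  have H: "?H \<in> borel_measurable (?E \<Otimes>\<^sub>M ?E)" by measurable
  have ZX: "(\<lambda>\<omega>. (Z k \<omega>, X (Suc k) \<omega>)) \<in> P \<rightarrow>\<^sub>M ?E \<Otimes>\<^sub>M ?E" using Zk Xk by measurable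
  have "(\<integral>\<^sup>+\<omega>. F (Z (Suc k) \<omega>) \<partial>P) = (\<integral>\<^sup>+\<omega>. ?H (Z k \<omega>, X (Suc k) \<omega>) \<partial>P)" by (simp add: Z_Suc)
  also have "\<dots> = (\<integral>\<^sup>+p. ?H p \<partial>distr P (?E \<Otimes>\<^sub>M ?E) (\<lambda>\<omega>. (Z k \<omega>, X (Suc k) \<omega>)))"
    using H by (subst nn_integral_distr[OF ZX]) auto
  also have "distr P (?E \<Otimes>\<^sub>M ?E) (\<lambda>\<omega>. (Z k \<omega>, X (Suc k) \<omega>)) = distr P ?E (Z k) \<Otimes>\<^sub>M noise h"
    using indep unfolding P.indep_var_distribution_eq law by simp
  also have "(\<integral>\<^sup>+p. ?H p \<partial>(distr P ?E (Z k) \<Otimes>\<^sub>M noise h)) = (\<integral>\<^sup>+x. \<integral>\<^sup>+n. ?H (x, n) \<partial>noise h \<partial>distr P ?E (Z k))"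
    by (rule noise.nn_integral_fst[symmetric]) measurable
  also have "\<dots> = (\<integral>\<^sup>+\<omega>. \<integral>\<^sup>+n. ?H (Z k \<omega>, n) \<partial>noise h \<partial>P)"
    by (subst nn_integral_distr[OF Zk]) auto
  finally show "(\<integral>\<^sup>+\<omega>. F (Z (Suc k) \<omega>) \<partial>P)
      = (\<integral>\<^sup>+\<omega>. \<integral>\<^sup>+n. F (kstep h (gradient f (snd (Z k \<omega>))) (Z k \<omega>) n) \<partial>noise h \<partial>P)" by simp
qed

theorem theorem2:
  fixes f :: "real^'n \<Rightarrow> real"
    and m M \<gamma> h :: real
    and \<nu>0 :: "(real^'n) measure"
    and P :: "'w measure"
    and v0 \<theta>0 :: "'w \<Rightarrow> real^'n"
    and \<xi> \<xi>' :: "nat \<Rightarrow> 'w \<Rightarrow> real^'n"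
    and k :: nat
  assumes "0 < m" and "m \<le> M"
    and "twice_differentiable f"
    and "\<And>x. mat m \<preceq>\<^sub>L hessian f x \<and> hessian f x \<preceq>\<^sub>L mat M"
    and "prob_space \<nu>0" and "sets \<nu>0 = sets borel"
    and "prob_space P"
    and "klmc_noise P \<gamma> h v0 \<theta>0 \<xi> \<xi>'"
    and "distr P (borel \<Otimes>\<^sub>M borel) (\<lambda>\<omega>. (v0 \<omega>, \<theta>0 \<omega>)) = std_gaussian \<Otimes>\<^sub>M \<nu>0"
    and "sqrt (m + M) \<le> \<gamma>"
    and "0 < h" and "h \<le> m / (4 * \<gamma> * M)"
  shows "W2 (distr P borel (\<lambda>\<omega>. snd (klmc f \<gamma> h v0 \<theta>0 \<xi> \<xi>' k \<omega>))) (gibbs f)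
    \<le> ennreal (sqrt 2 * (1 - 0.75 * m * h / \<gamma>) ^ k) * W2 \<nu>0 (gibbs f)
      + ennreal (M * h * sqrt (2 * real CARD('n)) / m)"
proof -
  have "0 < sqrt (m + M)" using assms(1,2) by simp
  then have \<gamma>: "0 < \<gamma>" using assms(10) by linarith
  have \<gamma>2: "m + M \<le> \<gamma>\<^sup>2" using real_le_rsqrt sqrt_le_D[OF assms(10)] by blast
  have kin: "kinetic f (gradient f) m M \<gamma>" by (rule kinetic_gradient[OF assms(1-4) \<gamma>])
  interpret kinetic f "gradient f" m M \<gamma> by (rule kin)
  let ?Z = "klmc f \<gamma> h v0 \<theta>0 \<xi> \<xi>'"
  define \<mu> where "\<mu> k = distr P (borel \<Otimes>\<^sub>M borel) (?Z k)" for k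
  note Z = klmc_law_step[OF kin assms(7,8,11)]
  have step: "(\<integral>\<^sup>+x. F x \<partial>\<mu> (Suc k)) = (\<integral>\<^sup>+x. \<integral>\<^sup>+n. F (kstep h (gradient f (snd x)) x n) \<partial>noise h \<partial>\<mu> k)"
    if F [measurable]: "F \<in> borel_measurable (borel \<Otimes>\<^sub>M borel)" for k F
  proof -
    have "(\<lambda>x. \<integral>\<^sup>+n. F (kstep h (gradient f (snd x)) x n) \<partial>noise h) \<in> borel_measurable (borel \<Otimes>\<^sub>M borel)"
      by measurable
    then have "(\<integral>\<^sup>+x. \<integral>\<^sup>+n. F (kstep h (gradient f (snd x)) x n) \<partial>noise h \<partial>\<mu> k) = (\<integral>\<^sup>+\<omega>. F (?Z (Suc k) \<omega>) \<partial>P)"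
      unfolding \<mu>_def Z(2)[OF F] by (subst nn_integral_distr[OF Z(1)]) (simp_all del: klmc.simps)
    also have "\<dots> = (\<integral>\<^sup>+x. F x \<partial>\<mu> (Suc k))"
      unfolding \<mu>_def using F by (subst nn_integral_distr[OF Z(1)]) (simp_all del: klmc.simps)
    finally show ?thesis ..
  qed
  have "\<mu> 0 = gaussian \<Otimes>\<^sub>M \<nu>0" using assms(9) by (simp add: \<mu>_def std_gaussian_eq_gaussian)
  from W2_iterates[OF _ this assms(5,6) step \<gamma>2 assms(11,12), of k]
  have "W2 (distr (\<mu> k) borel snd) target
    \<le> ennreal (sqrt 2 * (1 - 3/4 * m * h / \<gamma>) ^ k) * W2 \<nu>0 target + ennreal (M * h * sqrt (2 * DIM(real^'n)) / m)"
    by (simp add: \<mu>_def)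
  moreover have "distr (\<mu> k) borel snd = distr P borel (\<lambda>\<omega>. snd (?Z k \<omega>))"
    unfolding \<mu>_def using Z(1)[of k] by (subst distr_distr) (auto simp: comp_def)
  moreover have "target = gibbs f" by (simp add: target_def gibbs_def)
  ultimately show ?thesis by simp
qed

end
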